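(* Let $S=\{u=F(x,y)\}\subset\mathbb{R}^3$ range over real-analytic graphed surfaces with $F_{xx}$ nowhere zero and $F_{xx}F_{yy}-F_{xy}^2\equiv 0$, within the branch $\mathsf S\equiv 0$, where $$\mathsf S=\frac{F_{xx}F_{xxy}-F_{xy}F_{xxx}}{F_{xx}^2}.$$ Then: (1) Every such surface is (locally, near each of its points) special affinely equivalent to the product of a curve in $\mathbb{R}^{2}_{x,u}$ with $\mathbb{R}_y$, i.e. to a surface $\{u=f(x)\}$; and two such products $\{u=f(x)\}$ and $\{v=g(s)\}$ (with $f''$, $g''$ nowhere zero) are $\mathsf{SA}_3(\mathbb{R})$-equivalent if and only if the plane curves $\{u=f(x)\}$ and $\{v=g(s)\}$ are $\mathsf A_2(\mathbb{R})$-equivalent. (2) The expression $$\mathsf P=\frac13\,\frac{-5F_{xxx}^2+3F_{xx}F_{xxxx}}{F_{xx}^2}$$ is a relative invariant, of order $4$. (3) $\mathsf P\equiv 0$ if and only if the surface is (locally) $\mathsf{SA}_3(\mathbb{R})$-equivalent to $\{u=x^2\}$, the product of a parabola and $\mathbb{R}_y$. (4) If $\mathsf P\neq 0$ (nowhere zero), then for each point $p\in S$ the surface germ $(S,p)$ is $\mathsf{SA}_3(\mathbb{R})$-equivalent to a germ at the origin of the form $$u=\frac{x^2}{2!}\pm\frac{x^4}{4!}+F_{5,0}\frac{x^5}{5!}+\sum_{j\ge 6}F_{j,0}\frac{x^j}{j!}.$$ This form is unique, and the collection of coefficients $F_{5,0},\{F_{j,0}\}_{j\ge6}$ is in one-to-one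 correspondence with equivalence classes (for a given sign $\pm$), in the following sense: there is a neighbourhood $\mathcal U$ of the identity in $\mathsf{SL}_3(\mathbb{R})$ such that if two surfaces of this form, with coefficients $F_{j,0}$ and $G_{j,0}$, correspond to each other as germs at the origin under an element of $\mathcal U$, then their signs $\pm$ agree and $G_{j,0}=F_{j,0}$ for all $j\ge 5$.
   Context: $\mathsf{SA}_3(\mathbb{R})=\mathsf{SL}_3(\mathbb{R})\ltimes\mathbb{R}^3$ is the group of affine transformations of $\mathbb{R}^3$ whose linear part has determinant $1$; $\mathsf A_2(\mathbb{R})=\mathsf{GL}_2(\mathbb{R})\ltimes\mathbb{R}^2$ is the full affine group of the plane. All surfaces and curves are real-analytic and considered locally; germs $(S,p)$ and $(S',p')$ are equivalent under a group if some element $g$ of it satisfies $g(p)=p'$ and maps a neighbourhood of $p$ in $S$ onto a neighbourhood of $p'$ in $S'$; two connected surfaces (or curves) are (locally) equivalent if some germ of the one is equivalent to some germ of the other. By convention, a (relative) invariant attached to a surface is assumed either to vanish identically or to vanish nowhere; "$\neq0$" means nowhere zero. A relative invariant of order $n$ in the branch considered is a function of $x,y$ and the partial derivatives of the graphing function up to order $n$ such that, whenever a transformation in $\mathsf{SA}_3(\mathbb{R})$ (not far from the identity) maps $\{u=F(x,y)\}$ to $\{v=G(s,t)\}$, both in the branch, its value on $G$ at $(s,t)$ equals a nowhere vanishing factor times its value on $F$ at the corresponding point $(x,y)$. *)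

theory Defs
  imports "HOL-Analysis.Analysis"
begin

section \<open>Real-analytic functions and partial derivatives\<close>

text \<open>Functions are total; only their values on the open set in question matter.\<close>

definition real_analytic_on :: "(real \<Rightarrow> real) \<Rightarrow> real set \<Rightarrow> bool" where
  "real_analytic_on f I \<longleftrightarrow>
     (\<forall>a\<in>I. \<exists>r>0. \<exists>c :: nat \<Rightarrow> real. \<forall>x. \<bar>x - a\<bar> < r \<longrightarrow>
        (\<lambda>n. c n * (x - a) ^ n) sums f x)"

definition real_analytic2_on :: "(real \<Rightarrow> real \<Rightarrow> real) \<Rightarrow> (real \<times> real) set \<Rightarrow> bool" where
  "real_analytic2_on F U \<longleftrightarrow>
     (\<forall>(a, b)\<in>U. \<exists>r>0. \<exists>c :: nat \<Rightarrow> nat \<Rightarrow> real. \<forall>x y. \<bar>x - a\<bar> < r \<and> \<bar>y - b\<bar> < r \<longrightarrow>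
        ((\<lambda>(i, j). c i j * (x - a) ^ i * (y - b) ^ j) has_sum F x y) UNIV)"

definition partial_x :: "(real \<Rightarrow> real \<Rightarrow> real) \<Rightarrow> real \<Rightarrow> real \<Rightarrow> real" where
  "partial_x F x y = deriv (\<lambda>t. F t y) x"

definition partial_y :: "(real \<Rightarrow> real \<Rightarrow> real) \<Rightarrow> real \<Rightarrow> real \<Rightarrow> real" where
  "partial_y F x y = deriv (\<lambda>t. F x t) y"

definition partials :: "nat \<Rightarrow> nat \<Rightarrow> (real \<Rightarrow> real \<Rightarrow> real) \<Rightarrow> real \<Rightarrow> real \<Rightarrow> real" where
  "partials i j F = (partial_y ^^ j) ((partial_x ^^ i) F)"

text \<open>The jet of order \<open>n\<close>; entries of higher order are set to \<open>0\<close>, so that a function of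
  the jet is a function of the partial derivatives of order at most \<open>n\<close>.\<close>

definition jet :: "nat \<Rightarrow> (real \<Rightarrow> real \<Rightarrow> real) \<Rightarrow> real \<Rightarrow> real \<Rightarrow> nat \<Rightarrow> nat \<Rightarrow> real" where
  "jet n F x y = (\<lambda>i j. if i + j \<le> n then partials i j F x y else 0)"

section \<open>Transformation groups, germs and local equivalence\<close>

definition SL3 :: "(real ^ 3 ^ 3) set" where
  "SL3 = {A. det A = 1}"

definition SA3 :: "(real ^ 3 \<Rightarrow> real ^ 3) set" where
  "SA3 = {(\<lambda>v. A *v v + b) | A b. A \<in> SL3}"

definition A2 :: "(real ^ 2 \<Rightarrow> real ^ 2) set" where
  "A2 = {(\<lambda>v. A *v v + b) | (A :: real ^ 2 ^ 2) b. invertible A}"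

definition germ_map ::
  "('a::topological_space \<Rightarrow> 'a) \<Rightarrow> 'a set \<Rightarrow> 'a \<Rightarrow> 'a set \<Rightarrow> 'a \<Rightarrow> bool" where
  "germ_map \<phi> S p S' p' \<longleftrightarrow> \<phi> p = p' \<and>
     (\<exists>N N'. openin (top_of_set S) N \<and> p \<in> N \<and>
             openin (top_of_set S') N' \<and> p' \<in> N' \<and> \<phi> ` N = N')"

definition germ_equivalent ::
  "('a::topological_space \<Rightarrow> 'a) set \<Rightarrow> 'a set \<Rightarrow> 'a \<Rightarrow> 'a set \<Rightarrow> 'a \<Rightarrow> bool" where
  "germ_equivalent \<G> S p S' p' \<longleftrightarrow> (\<exists>\<phi>\<in>\<G>. germ_map \<phi> S p S' p')"

definition locally_equivalent ::
  "('a::topological_space \<Rightarrow> 'a) set \<Rightarrow> 'a set \<Rightarrow> 'a set \<Rightarrow> bool" where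
  "locally_equivalent \<G> S S' \<longleftrightarrow> (\<exists>p\<in>S. \<exists>p'\<in>S'. germ_equivalent \<G> S p S' p')"

section \<open>Graphed surfaces and curves\<close>

definition graph_surface :: "(real \<Rightarrow> real \<Rightarrow> real) \<Rightarrow> (real \<times> real) set \<Rightarrow> (real ^ 3) set" where
  "graph_surface F U = {vector [x, y, F x y] | x y. (x, y) \<in> U}"

definition graph_curve :: "(real \<Rightarrow> real) \<Rightarrow> real set \<Rightarrow> (real ^ 2) set" where
  "graph_curve f I = {vector [x, f x] | x. x \<in> I}"

definition product_surface :: "(real \<Rightarrow> real) \<Rightarrow> real set \<Rightarrow> (real ^ 3) set" where
  "product_surface f I = graph_surface (\<lambda>x y. f x) (I \<times> UNIV)"

definition inv_S :: "(real \<Rightarrow> real \<Rightarrow> real) \<Rightarrow> real \<Rightarrow> real \<Rightarrow> real" where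
  "inv_S F x y =
     (partials 2 0 F x y * partials 2 1 F x y - partials 1 1 F x y * partials 3 0 F x y)
       / (partials 2 0 F x y)\<^sup>2"

definition inv_P :: "(real \<Rightarrow> real \<Rightarrow> real) \<Rightarrow> real \<Rightarrow> real \<Rightarrow> real" where
  "inv_P F x y =
     1/3 * ((- 5 * (partials 3 0 F x y)\<^sup>2 + 3 * partials 2 0 F x y * partials 4 0 F x y)
       / (partials 2 0 F x y)\<^sup>2)"

definition branch_S0 :: "(real \<Rightarrow> real \<Rightarrow> real) \<Rightarrow> (real \<times> real) set \<Rightarrow> bool" where
  "branch_S0 F U \<longleftrightarrow>
     open U \<and> connected U \<and> U \<noteq> {} \<and> real_analytic2_on F U \<and>
     (\<forall>(x, y)\<in>U. partials 2 0 F x y \<noteq> 0) \<and>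
     (\<forall>(x, y)\<in>U. partials 2 0 F x y * partials 0 2 F x y - (partials 1 1 F x y)\<^sup>2 = 0) \<and>
     (\<forall>(x, y)\<in>U. inv_S F x y = 0)"

definition nondegenerate_curve :: "(real \<Rightarrow> real) \<Rightarrow> real set \<Rightarrow> bool" where
  "nondegenerate_curve f I \<longleftrightarrow>
     open I \<and> connected I \<and> I \<noteq> {} \<and> real_analytic_on f I \<and>
     (\<forall>x\<in>I. (deriv ^^ 2) f x \<noteq> 0)"

section \<open>Relative invariants\<close>

text \<open>The affine maps not far from the identity are those whose linear part and translation part
  form a pair in a neighbourhood \<open>N\<close> of \<open>(mat 1, 0)\<close>. The point \<open>(s, t)\<close> corresponding to \<open>(x, y)\<close>
  is given by the first two coordinates of the image of \<open>(x, y, F x y)\<close>. The factor \<open>\<mu>\<close> has to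
  be real-analytic: for an arbitrary function \<open>\<mu>\<close> the condition would only say that the zero
  sets correspond.\<close>

definition relative_invariant ::
  "((real \<Rightarrow> real \<Rightarrow> real) \<Rightarrow> (real \<times> real) set \<Rightarrow> bool) \<Rightarrow> nat \<Rightarrow>
   ((real \<Rightarrow> real \<Rightarrow> real) \<Rightarrow> real \<Rightarrow> real \<Rightarrow> real) \<Rightarrow> bool" where
  "relative_invariant branch n J \<longleftrightarrow>
     (\<exists>\<Phi>. \<forall>F U. branch F U \<longrightarrow> (\<forall>(x, y)\<in>U. J F x y = \<Phi> x y (jet n F x y))) \<and>
     (\<exists>N. open N \<and> (mat 1, 0) \<in> N \<and>
        (\<forall>(A, b)\<in>N. \<forall>F U G V.
           A \<in> SL3 \<and> branch F U \<and> branch G V \<and>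
           (\<lambda>v. A *v v + b) ` graph_surface F U = graph_surface G V \<longrightarrow>
           (\<exists>\<mu>. real_analytic2_on \<mu> U \<and> (\<forall>(x, y)\<in>U. \<mu> x y \<noteq> 0) \<and>
              (\<forall>(x, y)\<in>U. let w = A *v vector [x, y, F x y] + b in
                 J G (w $ 1) (w $ 2) = \<mu> x y * J F x y))))"

section \<open>Normal forms\<close>

text \<open>\<open>f x = x\<^sup>2/2! + \<epsilon> x\<^sup>4/4! + (\<Sum>j\<ge>5. c j x\<^sup>j/j!)\<close> for \<open>\<bar>x\<bar> < r\<close>, with \<open>\<epsilon> = \<plusminus>1\<close>;
  the values \<open>c j\<close> for \<open>j < 5\<close> are irrelevant.\<close>

definition normal_form :: "real \<Rightarrow> (nat \<Rightarrow> real) \<Rightarrow> (real \<Rightarrow> real) \<Rightarrow> real \<Rightarrow> bool" where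
  "normal_form \<epsilon> c f r \<longleftrightarrow> \<epsilon> \<in> {1, -1} \<and> r > 0 \<and>
     (\<forall>x. \<bar>x\<bar> < r \<longrightarrow>
        (\<lambda>k. c (k + 5) * x ^ (k + 5) / fact (k + 5)) sums
          (f x - (x ^ 2 / fact 2 + \<epsilon> * x ^ 4 / fact 4)))"

end

theory Submission
  imports Defs "HOL-Complex_Analysis.Conformal_Mappings"
begin

text \<open>
  Put \<open>k = F\<^sub>x\<^sub>y / F\<^sub>x\<^sub>x\<close>. Then \<open>k\<^sub>x = S = 0\<close>, and the Hessian condition forces \<open>k\<^sub>y = 0\<close>, so that \<open>k\<close> is
  constant; it follows that \<open>F\<^sub>y = k F\<^sub>x + c\<close> with a constant \<open>c\<close>, and locally
  \<open>F = f (x + k y) + c y\<close>. A unimodular shear turns the surface into the product of the curve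
  \<open>u = f x\<close> with a line. Since \<open>f''\<close> has no zeros, a special affine map between two such products
  must respect the rulings; it therefore induces an affine map of the plane between the profile
  curves, and conversely every plane affine map extends to a unimodular one by rescaling \<open>y\<close>.

  Under a plane affine map the first four derivatives of the profile transform explicitly, which gives
  \<open>P\<^sub>g = P\<^sub>f / m\<^sup>2\<close> with \<open>m = a + b f'\<close>. The normal form is obtained by spending the affine freedom on
  the 3-jet and, if \<open>P \<noteq> 0\<close>, on the size of the quartic coefficient. If \<open>P\<close> vanishes, then
  \<open>f'''\<^sup>3 / f''\<^sup>5\<close> is constant, hence zero after normalization, and the profile is a parabola.

  Analyticity in one variable is handled through holomorphic extensions, which provide inverse
  functions and the identity theorem.
\<close>

section \<open>Real-analytic functions of one variable\<close>

text \<open>The determinant condition does not restrict the profile: once rulings go to rulings, the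
  scaling along \<open>y\<close> absorbs the determinant of any invertible plane map, so the
  unimodular problem in space becomes the full affine problem in the plane. The first integral for
  \<open>P = 0\<close> is the separated form of \<open>3 f'' f'''' = 5 f'''^2\<close>, namely 3 d
  log f''' = 5 d log f''; as a quotient of powers it also makes sense where \<open>f'''\<close>
  vanishes. Some conclusions are global on \<open>U\<close>, whereas an equivalence concerns one
  germ. Therefore the constants \<open>k\<close> and \<open>c\<close> are obtained on all of
  \<open>U\<close> by connectedness, one formula for the multiplier serves every point, and
  vanishing of \<open>P\<close> is spread from a germ to \<open>U\<close> by the identity theorem.
  Nearness to the identity enters the uniqueness claim through one reflection: diag(-1, -1, 1) is
  unimodular, preserves the shape of the normal form and changes the sign of all odd
  coefficients.\<close>

definition real_analytic_at :: "(real \<Rightarrow> real) \<Rightarrow> real \<Rightarrow> bool" where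
  "real_analytic_at f a \<longleftrightarrow> (\<exists>r>0. \<exists>h. h holomorphic_on ball (complex_of_real a) r \<and>
     (\<forall>x. \<bar>x - a\<bar> < r \<longrightarrow> h (complex_of_real x) = of_real (f x)))"

lemma real_analytic_atI:
  assumes "r > 0" "h holomorphic_on ball (complex_of_real a) r"
    "\<And>x. \<bar>x - a\<bar> < r \<Longrightarrow> h (complex_of_real x) = of_real (f x)"
  shows "real_analytic_at f a"
  unfolding real_analytic_at_def using assms by blast

lemma real_analytic_atE:
  assumes "real_analytic_at f a"
  obtains r h where "r > 0" "h holomorphic_on ball (complex_of_real a) r"
    "\<And>x. \<bar>x - a\<bar> < r \<Longrightarrow> h (complex_of_real x) = of_real (f x)"
  using assms unfolding real_analytic_at_def by (elim exE conjE) simp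

lemma eventually_nhds_abs:
  fixes a :: real
  shows "eventually P (nhds a) \<longleftrightarrow> (\<exists>d>0. \<forall>x. \<bar>x - a\<bar> < d \<longrightarrow> P x)"
  by (simp add: eventually_nhds_metric dist_real_def)

lemma eventually_abs_less: "0 < d \<Longrightarrow> \<forall>\<^sub>F x in nhds a. \<bar>x - a\<bar> < (d::real)"
  using eventually_nhds_abs by blast

lemma dist_of_real_complex: "dist (complex_of_real a) (complex_of_real x) = \<bar>x - a\<bar>"
  by (simp add: dist_real_def abs_minus_commute)

text \<open>A complex derivative can be computed along the real axis. There the extension takes real
  values, so its imaginary part has derivative 0 and the complex derivative is the real one. Hence
  the derivative of the extension extends the derivative on the same disc.\<close>

lemma holomorphic_extension_deriv:
  assumes h: "h holomorphic_on ball (complex_of_real a) r"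
    and f: "\<And>x. \<bar>x - a\<bar> < r \<Longrightarrow> h (complex_of_real x) = of_real (f x)"
    and x: "\<bar>x - a\<bar> < r"
  shows "(f has_real_derivative deriv f x) (at x)" "deriv h (of_real x) = of_real (deriv f x)"
proof -
  let ?d = "deriv h (of_real x)"
  have "complex_of_real x \<in> ball (complex_of_real a) r"
    using x by (simp add: dist_real_def abs_minus_commute)
  then have "(h has_field_derivative ?d) (at (of_real x))"
    using h holomorphic_derivI open_ball by blast
  then have v: "((\<lambda>t. h (complex_of_real t)) has_vector_derivative ?d) (at x)"
    by (rule has_vector_derivative_real_field)
  have v': "((\<lambda>t. complex_of_real (f t)) has_vector_derivative ?d) (at x)"
    by (rule has_vector_derivative_transform_within_open[OF v open_greaterThanLessThan[of "a - r" "a + r"]])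
      (use f x in \<open>auto simp: abs_less_iff\<close>)
  have re: "(f has_real_derivative Re ?d) (at x)"
    using bounded_linear.has_vector_derivative[OF bounded_linear_Re v']
    by (simp add: has_real_derivative_iff_has_vector_derivative)
  have "((\<lambda>t. 0) has_vector_derivative Im ?d) (at x)"
    using bounded_linear.has_vector_derivative[OF bounded_linear_Im v'] by simp
  then have "Im ?d = 0"
    using has_vector_derivative_const vector_derivative_unique_at by blast
  moreover have "deriv f x = Re ?d" using re DERIV_imp_deriv by blast
  ultimately show "(f has_real_derivative deriv f x) (at x)" "?d = of_real (deriv f x)"
    using re by (auto simp: complex_eq_iff)
qed

lemma real_analytic_at_has_deriv:
  "real_analytic_at f a \<Longrightarrow> (f has_real_derivative deriv f a) (at a)"
proof (erule real_analytic_atE)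
  fix r h assume *: "r > 0" "h holomorphic_on ball (complex_of_real a) r"
    "\<And>x. \<bar>x - a\<bar> < r \<Longrightarrow> h (complex_of_real x) = of_real (f x)"
  show ?thesis by (rule holomorphic_extension_deriv(1)[OF *(2,3)]) (use *(1) in simp_all)
qed

lemma real_analytic_at_isCont: "real_analytic_at f a \<Longrightarrow> isCont f a"
  using real_analytic_at_has_deriv DERIV_isCont by blast

lemma real_analytic_at_deriv:
  assumes "real_analytic_at f a" shows "real_analytic_at (deriv f) a"
proof -
  from assms obtain r h where r: "r > 0" "h holomorphic_on ball (complex_of_real a) r"
    "\<And>x. \<bar>x - a\<bar> < r \<Longrightarrow> h (complex_of_real x) = of_real (f x)"
    by (rule real_analytic_atE) auto
  show ?thesis
    by (rule real_analytic_atI[OF r(1) holomorphic_deriv[OF r(2) open_ball]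
          holomorphic_extension_deriv(2)[OF r(2,3)]])
qed

lemma real_analytic_at_eventually:
  assumes "real_analytic_at f a" shows "\<forall>\<^sub>F x in nhds a. real_analytic_at f x"
proof -
  from assms obtain r h where r: "r > 0" "h holomorphic_on ball (complex_of_real a) r"
    "\<And>x. \<bar>x - a\<bar> < r \<Longrightarrow> h (complex_of_real x) = of_real (f x)"
    by (rule real_analytic_atE) auto
  have "real_analytic_at f x" if x: "\<bar>x - a\<bar> < r" for x
  proof -
    have s: "ball (complex_of_real x) (r - \<bar>x - a\<bar>) \<subseteq> ball (complex_of_real a) r"
    proof
      fix z assume "z \<in> ball (complex_of_real x) (r - \<bar>x - a\<bar>)"
      then show "z \<in> ball (complex_of_real a) r"
        using dist_triangle[of "of_real a" z "of_real x"] dist_of_real_complex[of a x] by simp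
    qed
    show ?thesis
    proof (rule real_analytic_atI)
      show "0 < r - \<bar>x - a\<bar>" using x by simp
      show "h holomorphic_on ball (complex_of_real x) (r - \<bar>x - a\<bar>)"
        using holomorphic_on_subset[OF r(2) s] .
      show "h (complex_of_real y) = of_real (f y)" if "\<bar>y - x\<bar> < r - \<bar>x - a\<bar>" for y
        using that by (intro r(3)) linarith
    qed
  qed
  then show ?thesis using r(1) by (auto simp: eventually_nhds_abs)
qed

lemma real_analytic_at_eventually_has_deriv:
  "real_analytic_at f a \<Longrightarrow> \<forall>\<^sub>F x in nhds a. (f has_real_derivative deriv f x) (at x)"
  by (drule real_analytic_at_eventually, erule eventually_mono) (rule real_analytic_at_has_deriv)

lemma real_analytic_at_const [simp]: "real_analytic_at (\<lambda>_. c) a"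
  by (rule real_analytic_atI[of 1 "\<lambda>_. of_real c"]) auto

lemma real_analytic_at_ident [simp]: "real_analytic_at (\<lambda>x. x) a"
  by (rule real_analytic_atI[of 1 "\<lambda>x. x"]) auto

section \<open>Closure of analyticity under algebraic operations\<close>

lemma real_analytic_at_add:
  assumes "real_analytic_at f a" "real_analytic_at g a"
  shows "real_analytic_at (\<lambda>x. f x + g x) a"
proof -
  obtain r h where r: "r > 0" "h holomorphic_on ball (complex_of_real a) r"
    "\<And>x. \<bar>x - a\<bar> < r \<Longrightarrow> h (complex_of_real x) = of_real (f x)"
    using assms(1) by (rule real_analytic_atE) auto
  obtain s k where s: "s > 0" "k holomorphic_on ball (complex_of_real a) s"
    "\<And>x. \<bar>x - a\<bar> < s \<Longrightarrow> k (complex_of_real x) = of_real (g x)"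
    using assms(2) by (rule real_analytic_atE) auto
  have "ball (complex_of_real a) (min r s) \<subseteq> ball (complex_of_real a) r"
    "ball (complex_of_real a) (min r s) \<subseteq> ball (complex_of_real a) s" by auto
  then have "h holomorphic_on ball (of_real a) (min r s)" "k holomorphic_on ball (of_real a) (min r s)"
    using r(2) s(2) holomorphic_on_subset by blast+
  then show ?thesis
    by (intro real_analytic_atI[of "min r s" "\<lambda>z. h z + k z"] holomorphic_on_add)
      (simp_all add: r(1,3) s(1,3))
qed

lemma real_analytic_at_mult:
  assumes "real_analytic_at f a" "real_analytic_at g a"
  shows "real_analytic_at (\<lambda>x. f x * g x) a"
proof -
  obtain r h where r: "r > 0" "h holomorphic_on ball (complex_of_real a) r"
    "\<And>x. \<bar>x - a\<bar> < r \<Longrightarrow> h (complex_of_real x) = of_real (f x)"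
    using assms(1) by (rule real_analytic_atE) auto
  obtain s k where s: "s > 0" "k holomorphic_on ball (complex_of_real a) s"
    "\<And>x. \<bar>x - a\<bar> < s \<Longrightarrow> k (complex_of_real x) = of_real (g x)"
    using assms(2) by (rule real_analytic_atE) auto
  have "ball (complex_of_real a) (min r s) \<subseteq> ball (complex_of_real a) r"
    "ball (complex_of_real a) (min r s) \<subseteq> ball (complex_of_real a) s" by auto
  then have "h holomorphic_on ball (of_real a) (min r s)" "k holomorphic_on ball (of_real a) (min r s)"
    using r(2) s(2) holomorphic_on_subset by blast+
  then show ?thesis
    by (intro real_analytic_atI[of "min r s" "\<lambda>z. h z * k z"] holomorphic_on_mult)
      (simp_all add: r(1,3) s(1,3))
qed

lemma real_analytic_at_inverse:
  assumes f: "real_analytic_at f a" and nz: "f a \<noteq> 0"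
  shows "real_analytic_at (\<lambda>x. inverse (f x)) a"
proof -
  from f obtain r h where r: "r > 0" "h holomorphic_on ball (complex_of_real a) r"
    "\<And>x. \<bar>x - a\<bar> < r \<Longrightarrow> h (complex_of_real x) = of_real (f x)"
    by (rule real_analytic_atE) auto
  have "isCont h (of_real a)"
    using r(1,2) holomorphic_on_imp_continuous_on[of h] continuous_on_eq_continuous_at[OF open_ball]
    by (metis centre_in_ball)
  moreover have "h (of_real a) \<noteq> 0" using nz r by auto
  ultimately obtain e where e: "e > 0" "\<And>z. dist (of_real a) z < e \<Longrightarrow> h z \<noteq> 0"
    using continuous_at_avoid[of "of_real a" h 0] by blast
  show ?thesis
  proof (rule real_analytic_atI[of "min r e"])
    show "(\<lambda>z. inverse (h z)) holomorphic_on ball (complex_of_real a) (min r e)"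
      using e(2) by (intro holomorphic_on_inverse holomorphic_on_subset[OF r(2)]) auto
  qed (simp_all add: r(1,3) e(1))
qed

lemma real_analytic_at_cong:
  assumes "real_analytic_at f a" "\<forall>\<^sub>F x in nhds a. f x = g x"
  shows "real_analytic_at g a"
proof -
  from assms(1) obtain r h where r: "r > 0" "h holomorphic_on ball (complex_of_real a) r"
    "\<And>x. \<bar>x - a\<bar> < r \<Longrightarrow> h (complex_of_real x) = of_real (f x)"
    by (rule real_analytic_atE) auto
  from assms(2) obtain e where e: "e > 0" "\<And>x. \<bar>x - a\<bar> < e \<Longrightarrow> f x = g x"
    by (auto simp: eventually_nhds_abs)
  show ?thesis
    by (rule real_analytic_atI[of "min r e" h])
      (auto simp: r(1,3) e(1) simp flip: e(2) intro!: holomorphic_on_subset[OF r(2)])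
qed

section \<open>Taylor expansions and power series\<close>

lemma holomorphic_extension_iterated_deriv:
  assumes "h holomorphic_on ball (complex_of_real a) r"
    and "\<And>x. \<bar>x - a\<bar> < r \<Longrightarrow> h (complex_of_real x) = of_real (f x)" "\<bar>x - a\<bar> < r"
  shows "(deriv ^^ n) h (of_real x) = of_real ((deriv ^^ n) f x)"
  using assms
proof (induction n arbitrary: h f)
  case 0 then show ?case by simp
next
  case (Suc n)
  have "(deriv ^^ n) (deriv h) (complex_of_real x) = of_real ((deriv ^^ n) (deriv f) x)"
    using Suc.prems(1,3) holomorphic_extension_deriv(2)[OF Suc.prems(1,2)]
    by (intro Suc.IH) (auto intro: holomorphic_deriv)
  then show ?case by (simp add: funpow_swap1)
qed

text \<open>The expansion is valid on the whole interval cut out by the disc of the extension, not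
  merely near the centre; the domain of a normal form is read off from this radius.\<close>

lemma holomorphic_extension_taylor:
  assumes "h holomorphic_on ball (complex_of_real a) r"
    and "\<And>x. \<bar>x - a\<bar> < r \<Longrightarrow> h (complex_of_real x) = of_real (f x)" "\<bar>x - a\<bar> < r"
  shows "(\<lambda>n. (deriv ^^ n) f a / fact n * (x - a) ^ n) sums f x"
proof -
  have "(\<lambda>n. (deriv ^^ n) h (of_real a) / fact n * (of_real x - of_real a) ^ n) sums h (of_real x)"
    using assms(3) by (intro holomorphic_power_series[OF assms(1)]) (simp add: dist_real_def abs_minus_commute)
  moreover have "\<bar>a - a\<bar> < r" using assms(3) by linarith
  ultimately have "(\<lambda>n. complex_of_real ((deriv ^^ n) f a / fact n * (x - a) ^ n)) sums of_real (f x)"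
    using holomorphic_extension_iterated_deriv[OF assms(1,2)] assms(2)[OF assms(3)] by simp
  then show ?thesis by (simp only: sums_of_real_iff)
qed

text \<open>A real power series that converges at distance \<open>t\<close> from its centre
  converges in the complex disc of radius \<open>t\<close>, so the same coefficients define the
  holomorphic extension.\<close>

lemma real_analytic_at_powser:
  assumes r: "r > 0" and s: "\<And>x. \<bar>x - a\<bar> < r \<Longrightarrow> (\<lambda>n. c n * (x - a) ^ n) sums f x"
  shows "real_analytic_at f a"
proof -
  define h where "h z = (\<Sum>n. of_real (c n) * (z - of_real a) ^ n)" for z :: complex
  have sm: "(\<lambda>n. of_real (c n) * (z - of_real a) ^ n) sums h z"
    if z: "z \<in> ball (complex_of_real a) r" for z
  proof -
    obtain t where t: "norm (z - of_real a) < t" "t < r"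
      using z dense by (metis dist_commute dist_norm mem_ball)
    have "0 < t" using t(1) norm_ge_zero le_less_trans by blast
    then have "summable (\<lambda>n. c n * t ^ n)" using s[of "a + t"] t(2) by (auto simp: sums_iff)
    then have "summable (\<lambda>n. complex_of_real (c n) * of_real t ^ n)"
      using summable_of_real[of "\<lambda>n. c n * t ^ n", where ?'a = complex] by simp
    then have "summable (\<lambda>n. complex_of_real (c n) * (z - of_real a) ^ n)"
      using powser_inside t(1) \<open>0 < t\<close> by (metis abs_of_pos norm_of_real)
    then show ?thesis unfolding h_def by (rule summable_sums)
  qed
  have "h holomorphic_on ball (complex_of_real a) r"
    by (rule power_series_holomorphic[where a = "\<lambda>n. of_real (c n)"]) (rule sm)
  moreover have "h (of_real x) = of_real (f x)" if "\<bar>x - a\<bar> < r" for x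
  proof -
    have "(\<lambda>n. complex_of_real (c n * (x - a) ^ n)) sums of_real (f x)"
      using s[OF that] by (simp only: sums_of_real_iff)
    moreover have "of_real x \<in> ball (complex_of_real a) r" using that by (simp add: dist_real_def abs_minus_commute)
    ultimately show ?thesis using sm[of "of_real x"] sums_unique2 by fastforce
  qed
  ultimately show ?thesis by (rule real_analytic_atI[OF r])
qed

lemma real_analytic_on_iff: "real_analytic_on f I \<longleftrightarrow> (\<forall>a\<in>I. real_analytic_at f a)"
  unfolding real_analytic_on_def
proof (intro ball_cong refl iffI)
  fix a assume "\<exists>r>0. \<exists>c. \<forall>x. \<bar>x - a\<bar> < r \<longrightarrow> (\<lambda>n. c n * (x - a) ^ n) sums f x"
  then show "real_analytic_at f a" by (elim exE conjE) (rule real_analytic_at_powser, auto)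
next
  fix a assume "real_analytic_at f a"
  then obtain r h where r: "r > 0" "h holomorphic_on ball (complex_of_real a) r"
    "\<And>x. \<bar>x - a\<bar> < r \<Longrightarrow> h (complex_of_real x) = of_real (f x)"
    by (rule real_analytic_atE) auto
  then show "\<exists>r>0. \<exists>c. \<forall>x. \<bar>x - a\<bar> < r \<longrightarrow> (\<lambda>n. c n * (x - a) ^ n) sums f x"
    using holomorphic_extension_taylor[OF r(2,3)] by meson
qed

text \<open>Termwise differentiation replaces \<open>c\<close> by \<open>diffs c\<close> and keeps
  the radius, so an induction over all coefficient sequences applies.\<close>

lemma powser_iterated_deriv:
  assumes "r > 0" and "\<And>x. \<bar>x\<bar> < r \<Longrightarrow> (\<lambda>n. c n * x ^ n) sums f x"
  shows "(deriv ^^ n) f 0 = fact n * (c n :: real)"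
  using assms(2)
proof (induction n arbitrary: c f)
  case 0
  have "(\<lambda>n. c n * 0 ^ n) sums f 0" by (rule 0) (use \<open>r > 0\<close> in simp)
  from sums_unique2[OF this powser_sums_zero] show ?case by simp
next
  case (Suc n)
  have "(\<lambda>n. diffs c n * x ^ n) sums deriv f x" if x: "\<bar>x\<bar> < r" for x
  proof -
    obtain K where K: "\<bar>x\<bar> < K" "K < r" using dense x by blast
    have sK: "summable (\<lambda>n. c n * K ^ n)" using Suc.prems[of K] K by (auto simp: sums_iff)
    have d: "((\<lambda>x. \<Sum>n. c n * x ^ n) has_real_derivative (\<Sum>n. diffs c n * x ^ n)) (at x)"
      using K by (intro termdiffs_strong[OF sK]) auto
    have "\<forall>\<^sub>F y in nhds x. \<bar>y - x\<bar> < r - \<bar>x\<bar>" using x by (intro eventually_abs_less) simp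
    then have "\<forall>\<^sub>F y in nhds x. (\<Sum>n. c n * y ^ n) = f y"
    proof eventually_elim
      case (elim y)
      then have "\<bar>y\<bar> < r" by linarith
      from Suc.prems[OF this] show ?case by (simp add: sums_iff)
    qed
    then have "(f has_real_derivative (\<Sum>n. diffs c n * x ^ n)) (at x)"
      using iffD1[OF DERIV_cong_ev[OF refl _ refl] d] by blast
    then have "deriv f x = (\<Sum>n. diffs c n * x ^ n)" by (rule DERIV_imp_deriv)
    moreover have "summable (\<lambda>n. diffs c n * x ^ n)"
      using K(1) by (intro termdiff_converges[of _ K])
        (auto intro!: powser_inside[OF sK])
    ultimately show ?thesis by (simp add: summable_sums)
  qed
  from Suc.IH[OF this] show ?case by (simp add: funpow_swap1 diffs_def)
qed

section \<open>Germs of derivatives and the identity theorem\<close>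

lemma real_analytic_at_iterated_deriv:
  "real_analytic_at f a \<Longrightarrow> real_analytic_at ((deriv ^^ n) f) a"
  by (induction n) (simp_all add: real_analytic_at_deriv)

lemma iterated_deriv_cong_ev:
  fixes f g :: "real \<Rightarrow> real"
  assumes "\<forall>\<^sub>F x in nhds a. f x = g x"
  shows "\<forall>\<^sub>F x in nhds a. (deriv ^^ n) f x = (deriv ^^ n) g x"
proof (induction n)
  case (Suc n)
  from iffD2[OF eventually_eventually Suc]
  show ?case
  proof eventually_elim
    case (elim x)
    then have "deriv ((deriv ^^ n) f) x = deriv ((deriv ^^ n) g) x" by (rule deriv_cong_ev) simp
    then show ?case by simp
  qed
qed (use assms in simp)

text \<open>On each disc of a holomorphic extension the complex identity theorem spreads the zeros;
  connectedness of \<open>I\<close> passes from disc to disc.\<close>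

lemma real_analytic_vanishing:
  assumes I: "connected I" "open I" "\<And>x. x \<in> I \<Longrightarrow> real_analytic_at f x"
    and a: "a \<in> I" "\<forall>\<^sub>F x in nhds a. f x = 0" and b: "b \<in> I"
  shows "f b = 0"
proof -
  have "\<forall>\<^sub>F x in nhds b. f x = 0"
  proof (rule connected_induction_simple[where P = "\<lambda>b. \<forall>\<^sub>F x in nhds b. f x = 0", OF I(1) a(1) b a(2)])
    fix c assume c: "c \<in> I"
    from I(3)[OF c] obtain r h where r: "r > 0" "h holomorphic_on ball (complex_of_real c) r"
      "\<And>x. \<bar>x - c\<bar> < r \<Longrightarrow> h (complex_of_real x) = of_real (f x)"
      by (rule real_analytic_atE) auto
    have "\<forall>\<^sub>F x in nhds z. f x = 0" if y: "\<bar>y - c\<bar> < r" and fy: "\<forall>\<^sub>F x in nhds y. f x = 0" and z: "\<bar>z - c\<bar> < r" for y z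
    proof -
      from fy obtain d where d: "d > 0" "\<And>x. \<bar>x - y\<bar> < d \<Longrightarrow> f x = 0" by (auto simp: eventually_nhds_abs)
      define e where "e = min d (r - \<bar>y - c\<bar>)"
      have e: "e > 0" using d y by (auto simp: e_def)
      \<comment> \<open>The identity theorem asks for zeros accumulating in the complex plane; the
        real zeros around \<open>y\<close> accumulate at \<open>y\<close>.\<close>
      have lim: "of_real y islimpt (of_real ` {y - e<..<y + e} :: complex set)"
        unfolding islimpt_approachable
      proof (intro allI impI)
        fix \<epsilon> :: real assume "\<epsilon> > 0"
        define t where "t = y + min \<epsilon> e / 2"
        have "t \<in> {y - e<..<y + e}" "t \<noteq> y" "\<bar>y - t\<bar> < \<epsilon>"
          using e \<open>\<epsilon> > 0\<close> by (auto simp: t_def min_def)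
        then show "\<exists>x'\<in>of_real ` {y - e<..<y + e}. x' \<noteq> complex_of_real y \<and> dist x' (of_real y) < \<epsilon>"
          by (intro bexI[of _ "of_real t"] conjI) (auto simp: dist_real_def abs_minus_commute)
      qed
      have hz: "h w = 0" if "w \<in> ball (complex_of_real c) r" for w
        by (rule analytic_continuation[OF r(2) open_ball connected_ball _ _ lim _ that])
          (use y d r(3) in \<open>auto simp: dist_real_def abs_minus_commute e_def\<close>)
      have "f x = 0" if "\<bar>x - c\<bar> < r" for x
        using hz[of "of_real x"] r(3)[OF that] that by (simp add: dist_real_def abs_minus_commute)
      moreover have "\<forall>\<^sub>F x in nhds z. \<bar>x - z\<bar> < r - \<bar>z - c\<bar>" using z by (intro eventually_abs_less) simp
      ultimately show ?thesis by (auto elim!: eventually_mono)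
    qed
    then show "\<exists>T. openin (top_of_set I) T \<and> c \<in> T \<and> (\<forall>x\<in>T. \<forall>y\<in>T.
        (\<forall>\<^sub>F x in nhds x. f x = 0) \<longrightarrow> (\<forall>\<^sub>F x in nhds y. f x = 0))"
      using c r(1) I(2)
      by (intro exI[of _ "I \<inter> ball c r"]) (auto simp: dist_real_def abs_minus_commute)
  qed
  then show ?thesis by (rule eventually_nhds_x_imp_x)
qed

section \<open>Affine images of plane curves\<close>

lemma deriv_numerals:
  "(deriv ^^ 2) f = deriv (deriv f)" "(deriv ^^ 3) f = deriv (deriv (deriv f))"
  "(deriv ^^ 4) f = deriv (deriv (deriv (deriv f)))"
  by (simp_all add: eval_nat_numeral)

text \<open>For \<open>f'' > 0\<close> this is three times \<open>f''\<close> to the power 2/3 times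
  the equiaffine curvature of the graph, the latter being -1/2 times the second derivative of
  \<open>f''\<close> to the power -2/3. This is why it detects parabolas.\<close>

definition curve_P :: "(real \<Rightarrow> real) \<Rightarrow> real \<Rightarrow> real" where
  "curve_P f x = 1/3 * ((- 5 * ((deriv ^^ 3) f x)\<^sup>2 + 3 * (deriv ^^ 2) f x * (deriv ^^ 4) f x)
     / ((deriv ^^ 2) f x)\<^sup>2)"

lemma real_analytic_at_curve_P:
  assumes "real_analytic_at f a" "(deriv ^^ 2) f a \<noteq> 0"
  shows "real_analytic_at (curve_P f) a"
proof -
  note r = real_analytic_at_iterated_deriv[OF assms(1)]
  have "real_analytic_at (\<lambda>x. 1/3 * ((- 5 * ((deriv ^^ 3) f x * (deriv ^^ 3) f x)
      + 3 * (deriv ^^ 2) f x * (deriv ^^ 4) f x)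
      * inverse ((deriv ^^ 2) f x * (deriv ^^ 2) f x))) a"
    using assms(2)
    by (intro real_analytic_at_mult real_analytic_at_add real_analytic_at_inverse r
        real_analytic_at_const) simp
  then show ?thesis
    by (rule real_analytic_at_cong) (simp add: curve_P_def power2_eq_square field_simps)
qed

text \<open>Differentiates an identity \<open>g (s x) = w x\<close> with
  \<open>s x = a x + b f x + e\<close>. Hypothesis and conclusion both hold on a neighbourhood, so
  the rule applies to its own output; this is how the derivatives of an affine image are found order
  by order.\<close>

lemma chain_rule_eventually:
  assumes f: "real_analytic_at f x0" and g: "real_analytic_at g (a * x0 + b * f x0 + e)"
    and eq: "\<forall>\<^sub>F x in nhds x0. g (a * x + b * f x + e) = w x"
    and w: "\<forall>\<^sub>F x in nhds x0. (w has_real_derivative w' x) (at x)"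
  shows "\<forall>\<^sub>F x in nhds x0. deriv g (a * x + b * f x + e) * (a + b * deriv f x) = w' x"
proof -
  define s where "s x = a * x + b * f x + e" for x
  have "isCont s x0" unfolding s_def using real_analytic_at_isCont[OF f] by (intro continuous_intros)
  then have lim: "filterlim s (nhds (s x0)) (nhds x0)"
    by (simp add: isCont_def tendsto_at_iff_tendsto_nhds)
  have "\<forall>\<^sub>F x in nhds x0. real_analytic_at g (s x)"
    by (rule eventually_compose_filterlim[OF real_analytic_at_eventually lim]) (use g in \<open>simp add: s_def\<close>)
  moreover note real_analytic_at_eventually[OF f] iffD2[OF eventually_eventually eq] w
  ultimately show ?thesis
  proof eventually_elim
    case (elim x)
    have "(s has_real_derivative a + b * deriv f x) (at x)"
      unfolding s_def using real_analytic_at_has_deriv[OF elim(2)]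
      by (auto intro!: derivative_eq_intros)
    then have "((\<lambda>x. g (s x)) has_real_derivative deriv g (s x) * (a + b * deriv f x)) (at x)"
      using real_analytic_at_has_deriv[OF elim(1)] by (rule DERIV_chain2[rotated])
    moreover have "((\<lambda>x. g (s x)) has_real_derivative w' x) (at x)"
      using iffD2[OF DERIV_cong_ev[OF refl _ refl] elim(4)] elim(3) by (simp add: s_def)
    ultimately show ?case unfolding s_def by (rule DERIV_unique)
  qed
qed

text \<open>The quotient rule with the common power of \<open>m\<close> cancelled. Each use is
  followed by a division by \<open>m\<close>, the derivative of the new abscissa, which is why the
  denominators of an affine image have the exponents 1, 3, 5, 7.\<close>

lemma DERIV_quotient_power:
  fixes u m :: "real \<Rightarrow> real"
  assumes "(u has_real_derivative u') (at x)" "(m has_real_derivative m') (at x)" "m x \<noteq> 0"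
  shows "((\<lambda>x. u x / m x ^ n) has_real_derivative (u' * m x - real n * u x * m') / m x ^ Suc n) (at x)"
proof -
  have "((\<lambda>x. u x / m x ^ n) has_real_derivative
      (u' * m x ^ n - u x * (real n * (m' * m x ^ (n - 1)))) / (m x ^ n * m x ^ n)) (at x)"
    using assms by (auto intro!: derivative_eq_intros)
  also have "(u' * m x ^ n - u x * (real n * (m' * m x ^ (n - 1)))) / (m x ^ n * m x ^ n)
      = (u' * m x - real n * u x * m') / m x ^ Suc n"
    using assms(3) by (cases n) (simp_all add: divide_simps algebra_simps)
  finally show ?thesis .
qed

text \<open>With \<open>s = a x + b f + e\<close> as new abscissa, each derivative of
  \<open>h\<close> is the derivative of the preceding expression divided by \<open>s' = m\<close>.
  The number \<open>D\<close> is the determinant of the plane map.\<close>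

lemma affine_image_derivs:
  fixes a b c d e e' :: real
  defines "D \<equiv> a * d - b * c"
  assumes f: "real_analytic_at f x0" and h: "real_analytic_at h (a * x0 + b * f x0 + e)"
    and eq: "\<forall>\<^sub>F x in nhds x0. h (a * x + b * f x + e) = c * x + d * f x + e'"
    and D: "D \<noteq> 0"
  shows "\<forall>\<^sub>F x in nhds x0. let m = a + b * deriv f x; s = a * x + b * f x + e in m \<noteq> 0 \<and>
     deriv h s = (c + d * deriv f x) / m \<and>
     (deriv ^^ 2) h s = D * (deriv ^^ 2) f x / m ^ 3 \<and>
     (deriv ^^ 3) h s = D * ((deriv ^^ 3) f x * m - 3 * b * ((deriv ^^ 2) f x)\<^sup>2) / m ^ 5 \<and>
     (deriv ^^ 4) h s = D * ((deriv ^^ 4) f x * m\<^sup>2 - 10 * b * (deriv ^^ 2) f x * (deriv ^^ 3) f x * m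
        + 15 * b\<^sup>2 * (deriv ^^ 2) f x ^ 3) / m ^ 7"
proof -
  define f1 f2 f3 f4 where "f1 = deriv f" and "f2 = deriv f1" and "f3 = deriv f2" and "f4 = deriv f3"
  define m where "m x = a + b * f1 x" for x
  note fdefs = f1_def f2_def f3_def f4_def
  note chain = chain_rule_eventually[OF f, where a = a and b = b and e = e, folded f1_def, folded m_def]
  have ra: "real_analytic_at f1 x0" "real_analytic_at f2 x0" "real_analytic_at f3 x0"
    unfolding fdefs by (intro real_analytic_at_deriv f)+
  have rah: "real_analytic_at (deriv h) (a * x0 + b * f x0 + e)"
    "real_analytic_at (deriv (deriv h)) (a * x0 + b * f x0 + e)"
    "real_analytic_at (deriv (deriv (deriv h))) (a * x0 + b * f x0 + e)"
    by (intro real_analytic_at_deriv h)+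
  have df: "\<forall>\<^sub>F x in nhds x0. (f has_real_derivative f1 x) (at x)"
    and df1: "\<forall>\<^sub>F x in nhds x0. (f1 has_real_derivative f2 x) (at x)"
    and df2: "\<forall>\<^sub>F x in nhds x0. (f2 has_real_derivative f3 x) (at x)"
    and df3: "\<forall>\<^sub>F x in nhds x0. (f3 has_real_derivative f4 x) (at x)"
    unfolding f4_def unfolding f3_def unfolding f2_def unfolding f1_def
    by (intro real_analytic_at_eventually_has_deriv f ra[unfolded fdefs])+
  have "\<forall>\<^sub>F x in nhds x0. ((\<lambda>x. c * x + d * f x + e') has_real_derivative c + d * f1 x) (at x)"
    using df by eventually_elim (auto intro!: derivative_eq_intros)
  from chain[OF h eq this]
  have e1: "\<forall>\<^sub>F x in nhds x0. deriv h (a * x + b * f x + e) * m x = c + d * f1 x" .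
  have m: "\<forall>\<^sub>F x in nhds x0. m x \<noteq> 0"
    using e1
  proof eventually_elim
    case (elim x)
    show ?case
    proof
      assume m0: "m x = 0"
      \<comment> \<open>The pair (\<open>m\<close>, \<open>c + d f1\<close>) is the image of the
        tangent vector (1, \<open>f1\<close>) under an invertible matrix. If \<open>m\<close> were
        0, the first-order identity would make this image the zero vector.\<close>
      have "D = d * m x - b * (c + d * f1 x)" by (simp add: D_def m_def algebra_simps)
      then show False using m0 elim D by simp
    qed
  qed
  have e1': "\<forall>\<^sub>F x in nhds x0. deriv h (a * x + b * f x + e) = (c + d * f1 x) / m x"
    using e1 m by eventually_elim (simp add: field_simps)
  have dm: "\<forall>\<^sub>F x in nhds x0. (m has_real_derivative b * f2 x) (at x)"
    using df1 unfolding m_def by eventually_elim (auto intro!: derivative_eq_intros)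
  have "\<forall>\<^sub>F x in nhds x0. ((\<lambda>x. (c + d * f1 x) / m x) has_real_derivative D * f2 x / (m x)\<^sup>2) (at x)"
    using df1 dm m
  proof eventually_elim
    case (elim x)
    have "((\<lambda>x. c + d * f1 x) has_real_derivative d * f2 x) (at x)"
      using elim(1) by (auto intro!: derivative_eq_intros)
    from DERIV_quotient_power[OF this elim(2,3), of 1] show ?case
      by (simp add: D_def m_def algebra_simps power2_eq_square)
  qed
  from chain[OF rah(1) e1' this] m
  have e2: "\<forall>\<^sub>F x in nhds x0. deriv (deriv h) (a * x + b * f x + e) = D * f2 x / m x ^ 3"
    by eventually_elim (simp add: field_simps power2_eq_square power3_eq_cube)
  have "\<forall>\<^sub>F x in nhds x0. ((\<lambda>x. D * f2 x / m x ^ 3) has_real_derivative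
      D * (f3 x * m x - 3 * b * (f2 x)\<^sup>2) / m x ^ 4) (at x)"
    using df2 dm m
  proof eventually_elim
    case (elim x)
    from DERIV_quotient_power[OF DERIV_cmult[OF elim(1), of D] elim(2,3), of 3] show ?case
      by (simp add: algebra_simps power2_eq_square)
  qed
  from chain[OF rah(2) e2 this] m
  have e3: "\<forall>\<^sub>F x in nhds x0. deriv (deriv (deriv h)) (a * x + b * f x + e) =
      D * (f3 x * m x - 3 * b * (f2 x)\<^sup>2) / m x ^ 5"
    by eventually_elim (simp add: field_simps eval_nat_numeral)
  have "\<forall>\<^sub>F x in nhds x0. ((\<lambda>x. D * (f3 x * m x - 3 * b * (f2 x)\<^sup>2) / m x ^ 5) has_real_derivative
      D * (f4 x * (m x)\<^sup>2 - 10 * b * f2 x * f3 x * m x + 15 * b\<^sup>2 * f2 x ^ 3) / m x ^ 6) (at x)"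
    using df2 df3 dm m
  proof eventually_elim
    case (elim x)
    have "((\<lambda>x. D * (f3 x * m x - 3 * b * (f2 x)\<^sup>2)) has_real_derivative
        D * (f4 x * m x - 5 * b * f2 x * f3 x)) (at x)"
      using elim(1-3) by (auto intro!: derivative_eq_intros simp: algebra_simps)
    from DERIV_quotient_power[OF this elim(3,4), of 5] show ?case
      by (simp add: algebra_simps power2_eq_square power3_eq_cube)
  qed
  from chain[OF rah(3) e3 this] m
  have e4: "\<forall>\<^sub>F x in nhds x0. deriv (deriv (deriv (deriv h))) (a * x + b * f x + e) =
      D * (f4 x * (m x)\<^sup>2 - 10 * b * f2 x * f3 x * m x + 15 * b\<^sup>2 * f2 x ^ 3) / m x ^ 7"
    by eventually_elim (simp add: field_simps eval_nat_numeral)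
  show ?thesis
    using m e1' e2 e3 e4
    by eventually_elim (simp add: Let_def deriv_numerals fdefs m_def)
qed

text \<open>In \<open>3 h'' h'''' - 5 h'''^2\<close> the terms with \<open>b\<close> and
  \<open>b^2\<close> cancel, 30 against 30 and 45 against 45. What remains is scaled by
  \<open>D^2 / m^8\<close>, and division by \<open>h''^2\<close> removes \<open>D\<close> and leaves
  the square of \<open>m\<close>.\<close>

lemma affine_image_curve_P:
  fixes a b c d e e' :: real
  assumes f: "real_analytic_at f x0" and h: "real_analytic_at h (a * x0 + b * f x0 + e)"
    and eq: "\<forall>\<^sub>F x in nhds x0. h (a * x + b * f x + e) = c * x + d * f x + e'"
    and D: "a * d - b * c \<noteq> 0" and f2: "(deriv ^^ 2) f x0 \<noteq> 0"
  shows "\<forall>\<^sub>F x in nhds x0. a + b * deriv f x \<noteq> 0 \<and>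
    curve_P h (a * x + b * f x + e) = curve_P f x / (a + b * deriv f x)\<^sup>2"
proof -
  have "isCont ((deriv ^^ 2) f) x0"
    by (intro real_analytic_at_isCont real_analytic_at_iterated_deriv f)
  then have "\<forall>\<^sub>F x in nhds x0. (deriv ^^ 2) f x \<noteq> 0"
    using f2 by (intro tendsto_imp_eventually_ne[where c = "(deriv ^^ 2) f x0"])
      (simp_all add: isCont_def tendsto_at_iff_tendsto_nhds)
  with affine_image_derivs[OF f h eq D] show ?thesis
  proof eventually_elim
    case (elim x)
    define m where "m = a + b * deriv f x"
    define f2 f3 f4 where "f2 = (deriv ^^ 2) f x" and "f3 = (deriv ^^ 3) f x" and "f4 = (deriv ^^ 4) f x"
    define D where "D = a * d - b * c"
    have m: "m \<noteq> 0" and f2: "f2 \<noteq> 0" and D: "D \<noteq> 0"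
      using elim assms(4) by (auto simp: Let_def m_def f2_def D_def)
    have "3 * (D * f2 / m ^ 3) * (D * (f4 * m\<^sup>2 - 10 * b * f2 * f3 * m + 15 * b\<^sup>2 * f2 ^ 3) / m ^ 7)
        - 5 * (D * (f3 * m - 3 * b * f2\<^sup>2) / m ^ 5)\<^sup>2
        = D\<^sup>2 / m ^ 8 * (3 * f2 * f4 - 5 * f3\<^sup>2)"
      using m by (simp add: field_simps eval_nat_numeral)
    moreover have "(D * f2 / m ^ 3)\<^sup>2 = D\<^sup>2 / m ^ 8 * (f2\<^sup>2 * m\<^sup>2)"
      using m by (simp add: field_simps eval_nat_numeral)
    moreover have "D\<^sup>2 / m ^ 8 \<noteq> 0" using D m by simp
    ultimately have "(3 * (D * f2 / m ^ 3) * (D * (f4 * m\<^sup>2 - 10 * b * f2 * f3 * m + 15 * b\<^sup>2 * f2 ^ 3) / m ^ 7)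
        - 5 * (D * (f3 * m - 3 * b * f2\<^sup>2) / m ^ 5)\<^sup>2) / (D * f2 / m ^ 3)\<^sup>2
        = (3 * f2 * f4 - 5 * f3\<^sup>2) / f2\<^sup>2 / m\<^sup>2"
      by (simp del: times_divide_eq_left)
    moreover have "(deriv ^^ 2) h (a * x + b * f x + e) = D * f2 / m ^ 3"
      "(deriv ^^ 3) h (a * x + b * f x + e) = D * (f3 * m - 3 * b * f2\<^sup>2) / m ^ 5"
      "(deriv ^^ 4) h (a * x + b * f x + e)
         = D * (f4 * m\<^sup>2 - 10 * b * f2 * f3 * m + 15 * b\<^sup>2 * f2 ^ 3) / m ^ 7"
      using elim(1) by (simp_all add: Let_def m_def f2_def f3_def f4_def D_def)
    ultimately have "curve_P h (a * x + b * f x + e) = curve_P f x / m\<^sup>2"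
      unfolding curve_P_def f2_def[symmetric] f3_def[symmetric] f4_def[symmetric] by simp
    then show ?case using m by (simp add: m_def)
  qed
qed

text \<open>An affine image of a graph is again a graph where the new abscissa \<open>s\<close> has
  nonzero derivative, and \<open>X\<close> is the inverse of \<open>s\<close>. The complex inverse
  function theorem makes this inverse holomorphic, so the new graphing function comes with its
  extension \<open>k\<close>.\<close>

lemma affine_image_exists:
  fixes a b c d e e' :: real
  assumes f: "real_analytic_at f x0" and m: "a + b * deriv f x0 \<noteq> 0"
  obtains h k X r where "r > 0" "k holomorphic_on ball (of_real (a * x0 + b * f x0 + e)) r"
    "\<And>w. \<bar>w - (a * x0 + b * f x0 + e)\<bar> < r \<Longrightarrow> k (complex_of_real w) = of_real (h w)"
    "\<And>w. \<bar>w - (a * x0 + b * f x0 + e)\<bar> < r \<Longrightarrow> a * X w + b * f (X w) + e = w"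
    "\<And>w. h w = c * X w + d * f (X w) + e'"
    "\<forall>\<^sub>F x in nhds x0. X (a * x + b * f x + e) = x"
    "isCont X (a * x0 + b * f x0 + e)" "X (a * x0 + b * f x0 + e) = x0"
proof -
  define s where "s x = a * x + b * f x + e" for x
  obtain r g where r: "r > 0" "g holomorphic_on ball (complex_of_real x0) r"
    "\<And>x. \<bar>x - x0\<bar> < r \<Longrightarrow> g (complex_of_real x) = of_real (f x)"
    using f by (rule real_analytic_atE) auto
  define \<sigma> where "\<sigma> z = of_real a * z + of_real b * g z + of_real e" for z
  have \<sigma>: "\<sigma> holomorphic_on ball (complex_of_real x0) r"
    unfolding \<sigma>_def by (intro holomorphic_intros r(2))
  have \<sigma>s: "\<sigma> (of_real x) = of_real (s x)" if "\<bar>x - x0\<bar> < r" for x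
    using r(3)[OF that] by (simp add: \<sigma>_def s_def)
  have "(s has_real_derivative a + b * deriv f x0) (at x0)"
    unfolding s_def using real_analytic_at_has_deriv[OF f] by (auto intro!: derivative_eq_intros)
  then have "deriv s x0 \<noteq> 0" using m DERIV_imp_deriv by metis
  then have "deriv \<sigma> (of_real x0) \<noteq> 0"
    using holomorphic_extension_deriv(2)[OF \<sigma> \<sigma>s, of x0] r(1) by simp
  then obtain q where q: "q > 0" "ball (of_real x0) q \<subseteq> ball (complex_of_real x0) r"
    "open (\<sigma> ` ball (of_real x0) q)" "inj_on \<sigma> (ball (of_real x0) q)"
    using has_complex_derivative_locally_invertible[OF \<sigma> _ open_ball] r(1) by (metis centre_in_ball)
  have qr: "q \<le> r" using q(1,2) r(1) by (simp add: ball_subset_ball_iff)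
  obtain \<tau> where \<tau>: "\<tau> holomorphic_on \<sigma> ` ball (of_real x0) q"
    "\<And>z. z \<in> ball (of_real x0) q \<Longrightarrow> \<tau> (\<sigma> z) = z"
    using holomorphic_has_inverse[OF holomorphic_on_subset[OF \<sigma> q(2)] open_ball q(4)] by metis
  define J where "J = {x0 - q<..<x0 + q}"
  have J: "x \<in> J \<longleftrightarrow> \<bar>x - x0\<bar> < q" for x by (auto simp: J_def)
  have Jball: "complex_of_real x \<in> ball (of_real x0) q" if "x \<in> J" for x
    using that by (simp add: J dist_real_def abs_minus_commute)
  have \<tau>s: "\<tau> (of_real (s x)) = of_real x" if "x \<in> J" for x
    using \<tau>(2)[OF Jball[OF that]] \<sigma>s[of x] that qr by (simp add: J)
  have "inj_on s J"
    by (rule inj_onI) (metis \<tau>s of_real_eq_iff)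
  moreover have "continuous_on J s"
  proof -
    have "isCont f x" if "x \<in> J" for x
      using holomorphic_extension_deriv(1)[OF r(2,3), of x] that qr DERIV_isCont by (auto simp: J)
    then show ?thesis unfolding s_def
      by (intro continuous_intros continuous_at_imp_continuous_on) auto
  qed
  moreover have "open J" by (simp add: J_def)
  \<comment> \<open>Real points near \<open>s x0\<close> must come from real points:
    \<open>s\<close> is open on the interval \<open>J\<close>, so near \<open>s x0\<close> the
    complex inverse takes real values on the real axis.\<close>
  ultimately have "open (s ` J)" by (intro invariance_of_domain)
  moreover have x0J: "x0 \<in> J" using q(1) by (simp add: J)
  ultimately obtain r1 where r1: "r1 > 0" "\<And>w. \<bar>w - s x0\<bar> < r1 \<Longrightarrow> w \<in> s ` J"
    by (metis open_dist imageI dist_real_def)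
  have "of_real (s x0) \<in> \<sigma> ` ball (of_real x0) q"
    using \<sigma>s[of x0] r(1) q(1) by (metis Jball x0J abs_zero diff_self imageI)
  then obtain r2 where r2: "r2 > 0" "ball (of_real (s x0)) r2 \<subseteq> \<sigma> ` ball (of_real x0) q"
    using q(3) open_contains_ball by blast
  define R where "R = min r1 r2"
  define X where "X w = Re (\<tau> (of_real w))" for w
  define h where "h w = c * X w + d * f (X w) + e'" for w
  define k where "k z = of_real c * \<tau> z + of_real d * g (\<tau> z) + of_real e'" for z
  have sub: "ball (of_real (s x0)) R \<subseteq> \<sigma> ` ball (of_real x0) q" using r2(2) by (auto simp: R_def)
  then have \<tau>R: "\<tau> holomorphic_on ball (of_real (s x0)) R" using \<tau>(1) holomorphic_on_subset by blast
  have "\<tau> ` ball (of_real (s x0)) R \<subseteq> ball (of_real x0) r"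
    using sub \<tau>(2) q(2) by fastforce
  then have "(g \<circ> \<tau>) holomorphic_on ball (of_real (s x0)) R"
    by (intro holomorphic_on_compose_gen[OF \<tau>R r(2)])
  then have k: "k holomorphic_on ball (of_real (s x0)) R"
    unfolding k_def comp_def by (intro holomorphic_intros \<tau>R)
  have X: "X w \<in> J \<and> s (X w) = w \<and> \<tau> (of_real w) = of_real (X w)" if w: "\<bar>w - s x0\<bar> < R" for w
  proof -
    obtain x where "x \<in> J" "w = s x" using r1(2)[of w] w by (auto simp: R_def)
    then show ?thesis using \<tau>s[of x] by (simp add: X_def)
  qed
  show ?thesis
  proof (rule that[of R k h X], unfold s_def[symmetric])
    show "R > 0" using r1 r2 by (simp add: R_def)
    show "k holomorphic_on ball (of_real (s x0)) R" by (rule k)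
    show "k (of_real w) = of_real (h w)" if "\<bar>w - s x0\<bar> < R" for w
      using X[OF that] r(3)[of "X w"] qr by (simp add: k_def h_def J)
    show "s (X w) = w" if "\<bar>w - s x0\<bar> < R" for w using X[OF that] by simp
    show "h w = c * X w + d * f (X w) + e'" for w by (simp add: h_def)
    have "\<forall>\<^sub>F x in nhds x0. x \<in> J"
      using \<open>open J\<close> x0J by (rule eventually_nhds_in_open)
    then show "\<forall>\<^sub>F x in nhds x0. X (s x) = x"
      by eventually_elim (simp add: X_def \<tau>s)
    have "isCont \<tau> (of_real (s x0))"
      using holomorphic_on_imp_continuous_on[OF \<tau>R] \<open>R > 0\<close>
      by (simp add: continuous_on_eq_continuous_at)
    then have "isCont (\<lambda>w. \<tau> (complex_of_real w)) (s x0)"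
      by (rule isCont_o2[where f = complex_of_real and g = \<tau>, rotated]) (intro continuous_intros)
    then show "isCont X (s x0)" unfolding X_def by (rule isCont_Re)
    show "X (s x0) = x0" using \<tau>s[OF x0J] by (simp add: X_def)
  qed
qed

section \<open>Double power series\<close>

text \<open>The coefficients and the radius are explicit because both partial derivatives keep the
  radius; functions with the same coefficients can then be compared on one box.\<close>

definition has_powser2 ::
  "(nat \<Rightarrow> nat \<Rightarrow> real) \<Rightarrow> real \<Rightarrow> real \<Rightarrow> real \<Rightarrow> (real \<Rightarrow> real \<Rightarrow> real) \<Rightarrow> bool" where
  "has_powser2 c a b r F \<longleftrightarrow> r > 0 \<and> (\<forall>x y. \<bar>x - a\<bar> < r \<and> \<bar>y - b\<bar> < r \<longrightarrow>
     ((\<lambda>(i, j). c i j * (x - a) ^ i * (y - b) ^ j) has_sum F x y) UNIV)"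

lemma real_analytic2_on_iff:
  "real_analytic2_on F U \<longleftrightarrow> (\<forall>(a, b)\<in>U. \<exists>r c. has_powser2 c a b r F)"
  unfolding real_analytic2_on_def has_powser2_def by blast

lemma has_powser2_pos: "has_powser2 c a b r F \<Longrightarrow> r > 0"
  by (simp add: has_powser2_def)

lemma has_powser2D:
  assumes "has_powser2 c a b r F" "\<bar>x - a\<bar> < r" "\<bar>y - b\<bar> < r"
  shows "((\<lambda>(i, j). c i j * (x - a) ^ i * (y - b) ^ j) has_sum F x y) UNIV"
  using assms by (simp add: has_powser2_def)

lemma has_powser2_swap:
  assumes "has_powser2 c a b r F"
  shows "has_powser2 (\<lambda>i j. c j i) b a r (\<lambda>y x. F x y)"
  unfolding has_powser2_def
proof (intro conjI allI impI)
  show "r > 0" using assms by (simp add: has_powser2_def)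
  fix y x assume "\<bar>y - b\<bar> < r \<and> \<bar>x - a\<bar> < r"
  then have "((\<lambda>(i, j). c i j * (x - a) ^ i * (y - b) ^ j) has_sum F x y) (UNIV \<times> UNIV)"
    using assms by (simp add: has_powser2_def)
  then show "((\<lambda>(i, j). c j i * (y - b) ^ i * (x - a) ^ j) has_sum F x y) UNIV"
    by (subst (asm) has_sum_swap) (simp add: case_prod_unfold mult_ac)
qed

lemma has_powser2_cong:
  assumes "has_powser2 c a b r F" "0 < r'" "r' \<le> r"
    and "\<And>x y. \<bar>x - a\<bar> < r' \<Longrightarrow> \<bar>y - b\<bar> < r' \<Longrightarrow> F x y = G x y"
  shows "has_powser2 c a b r' G"
  unfolding has_powser2_def
proof (intro conjI allI impI)
  fix x y assume *: "\<bar>x - a\<bar> < r' \<and> \<bar>y - b\<bar> < r'"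
  then have "\<bar>x - a\<bar> < r" "\<bar>y - b\<bar> < r" using assms(3) by auto
  then have "((\<lambda>(i, j). c i j * (x - a) ^ i * (y - b) ^ j) has_sum F x y) UNIV"
    using assms(1) by (simp add: has_powser2_def)
  then show "((\<lambda>(i, j). c i j * (x - a) ^ i * (y - b) ^ j) has_sum G x y) UNIV"
    using assms(4) * by simp
qed (rule assms(2))

lemma has_powser2_unique:
  assumes "has_powser2 c a b r F" "has_powser2 c a b r G" "\<bar>x - a\<bar> < r" "\<bar>y - b\<bar> < r"
  shows "F x y = G x y"
proof -
  have "((\<lambda>(i, j). c i j * (x - a) ^ i * (y - b) ^ j) has_sum F x y) UNIV"
    "((\<lambda>(i, j). c i j * (x - a) ^ i * (y - b) ^ j) has_sum G x y) UNIV"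
    using assms by (simp_all add: has_powser2_def)
  then show ?thesis by (rule has_sum_unique)
qed

text \<open>Differentiation multiplies coefficients by \<open>Suc i\<close>; this bound absorbs that
  factor into a slightly larger radius.\<close>

lemma bounded_nat_times_power:
  fixes q :: real assumes "0 \<le> q" "q < 1"
  obtains C where "C \<ge> 0" "\<And>i. real (Suc i) * q ^ i \<le> C"
proof -
  have "(\<lambda>i. real i * q ^ i + q ^ i) \<longlonglongrightarrow> 0 + 0"
    using assms by (intro tendsto_add powser_times_n_limit_0 LIMSEQ_power_zero) auto
  then have "Bseq (\<lambda>i. real (Suc i) * q ^ i)"
    by (intro convergent_imp_Bseq convergentI) (simp add: algebra_simps)
  then obtain C where "C > 0" "\<And>i. norm (real (Suc i) * q ^ i) \<le> C" by (auto simp: Bseq_def)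
  then show ?thesis using that[of C] by (smt (verit) real_norm_def)
qed

text \<open>Summing over \<open>j\<close> first gives, for fixed \<open>y\<close>, an ordinary power
  series in \<open>x\<close> that may be differentiated termwise. To return to a double series, the
  differentiated terms are compared with the original ones at a radius \<open>K\<close> between |x -
  a| and \<open>r\<close>.\<close>

lemma has_powser2_partial_x:
  assumes F: "has_powser2 c a b r F"
  shows "has_powser2 (\<lambda>i j. real (Suc i) * c (Suc i) j) a b r (partial_x F)"
    and "\<And>x y. \<bar>x - a\<bar> < r \<Longrightarrow> \<bar>y - b\<bar> < r \<Longrightarrow>
      ((\<lambda>t. F t y) has_real_derivative partial_x F x y) (at x)"
proof -
  have main: "((\<lambda>t. F t y) has_real_derivative partial_x F x y) (at x) \<and>
      ((\<lambda>(i, j). real (Suc i) * c (Suc i) j * (x - a) ^ i * (y - b) ^ j) has_sum partial_x F x y) UNIV"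
    if x: "\<bar>x - a\<bar> < r" and y: "\<bar>y - b\<bar> < r" for x y
  proof -
    obtain K where K: "\<bar>x - a\<bar> < K" "K < r" using dense[OF x] by blast
    have K0: "K > 0" using K(1) by linarith
    have hs: "((\<lambda>(i, j). c i j * (t - a) ^ i * (y - b) ^ j) has_sum F t y) (UNIV \<times> UNIV)"
      if "\<bar>t - a\<bar> < r" for t
      using F y that by (simp add: has_powser2_def)
    have sK: "(\<lambda>(i, j). c i j * K ^ i * (y - b) ^ j) summable_on UNIV \<times> UNIV"
      using has_sum_imp_summable[OF hs[of "a + K"]] K K0 by simp
    \<comment> \<open>Coefficients of the one-variable series at fixed \<open>y\<close>. They exist
      because the rows of the double series at \<open>x = a + K\<close> are summable and
      \<open>K ^ i\<close> can be divided out.\<close>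
    define d where "d i = (\<Sum>\<^sub>\<infinity>j. c i j * (y - b) ^ j)" for i
    have d: "((\<lambda>j. c i j * (y - b) ^ j) has_sum d i) UNIV" for i
    proof -
      have "(\<lambda>j. c i j * K ^ i * (y - b) ^ j) summable_on UNIV"
        using summable_on_SigmaD1[OF sK, of i] by simp
      then have "(\<lambda>j. K ^ i * (c i j * (y - b) ^ j)) summable_on UNIV" by (simp add: mult_ac)
      then have "(\<lambda>j. c i j * (y - b) ^ j) summable_on UNIV"
        by (rule iffD1[OF summable_on_cmult_right', rotated]) (use K0 in simp)
      then show ?thesis unfolding d_def by (rule has_sum_infsum)
    qed
    have ser: "(\<lambda>i. d i * (t - a) ^ i) sums F t y" if t: "\<bar>t - a\<bar> < r" for t
    proof (rule has_sum_imp_sums, rule has_sum_Sigma'[OF hs[OF t]])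
      fix i :: nat
      have "((\<lambda>j. (t - a) ^ i * (c i j * (y - b) ^ j)) has_sum (t - a) ^ i * d i) UNIV"
        by (rule has_sum_cmult_right[OF d])
      then show "((\<lambda>j. case (i, j) of (i, j) \<Rightarrow> c i j * (t - a) ^ i * (y - b) ^ j)
          has_sum d i * (t - a) ^ i) UNIV" by (simp add: mult_ac)
    qed
    have sdK: "summable (\<lambda>i. d i * K ^ i)" using ser[of "a + K"] K K0 by (simp add: sums_iff)
    have "((\<lambda>u. \<Sum>n. d n * u ^ n) has_real_derivative (\<Sum>n. diffs d n * (x - a) ^ n)) (at (x - a))"
      using K(1) K0 by (intro termdiffs_strong[OF sdK]) simp
    then have "((\<lambda>t. \<Sum>n. d n * (t - a) ^ n) has_real_derivative (\<Sum>n. diffs d n * (x - a) ^ n)) (at x)"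
      using DERIV_shift[of "\<lambda>u. \<Sum>n. d n * u ^ n" _ x "- a"] by simp
    moreover have "\<forall>\<^sub>F t in nhds x. (\<Sum>n. d n * (t - a) ^ n) = F t y"
    proof -
      have "\<forall>\<^sub>F t in nhds x. \<bar>t - x\<bar> < r - \<bar>x - a\<bar>" using x by (intro eventually_abs_less) simp
      then show ?thesis
      proof eventually_elim
        case (elim t)
        then have "\<bar>t - a\<bar> < r" by linarith
        from ser[OF this] show ?case by (simp add: sums_iff)
      qed
    qed
    ultimately have D: "((\<lambda>t. F t y) has_real_derivative (\<Sum>n. diffs d n * (x - a) ^ n)) (at x)"
      by (rule iffD1[OF DERIV_cong_ev[OF refl _ refl], rotated])
    then have p: "partial_x F x y = (\<Sum>n. diffs d n * (x - a) ^ n)"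
      unfolding partial_x_def by (rule DERIV_imp_deriv)
    \<comment> \<open>With this bound, \<open>C / K\<close> times the terms at radius
      \<open>K\<close> majorizes the differentiated terms.\<close>
    obtain C where C: "C \<ge> 0" "\<And>i. real (Suc i) * (\<bar>x - a\<bar> / K) ^ i \<le> C"
      using bounded_nat_times_power[of "\<bar>x - a\<bar> / K"] K K0 by auto
    have "(\<lambda>(i, j). real (Suc i) * c (Suc i) j * (x - a) ^ i * (y - b) ^ j) summable_on UNIV \<times> UNIV"
    proof -
      let ?h = "\<lambda>(i :: nat, j :: nat). (Suc i, j)"
      have "(\<lambda>(i, j). c i j * K ^ i * (y - b) ^ j) summable_on range ?h"
        using sK by (rule summable_on_subset) simp
      then have "(\<lambda>(i, j). c (Suc i) j * K ^ Suc i * (y - b) ^ j) summable_on UNIV"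
        by (subst (asm) summable_on_reindex) (auto simp: inj_def comp_def case_prod_unfold)
      then have "(\<lambda>p. norm (case p of (i, j) \<Rightarrow> c (Suc i) j * K ^ Suc i * (y - b) ^ j)) summable_on UNIV"
        by (subst (asm) summable_on_iff_abs_summable_on_real)
      then have "(\<lambda>p. C / K * norm (case p of (i, j) \<Rightarrow> c (Suc i) j * K ^ Suc i * (y - b) ^ j)) summable_on UNIV"
        by (rule summable_on_cmult_right)
      then have "(\<lambda>p. norm (case p of (i, j) \<Rightarrow> real (Suc i) * c (Suc i) j * (x - a) ^ i * (y - b) ^ j)) summable_on UNIV"
      proof (rule Infinite_Sum.abs_summable_on_comparison_test')
        fix p :: "nat \<times> nat"
        obtain i j where p: "p = (i, j)" by fastforce
        have "real (Suc i) * \<bar>x - a\<bar> ^ i \<le> C * K ^ i"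
          using C(2)[of i] K0 by (simp add: power_divide field_simps)
        then have "(real (Suc i) * \<bar>x - a\<bar> ^ i) * (\<bar>c (Suc i) j\<bar> * \<bar>y - b\<bar> ^ j)
            \<le> (C * K ^ i) * (\<bar>c (Suc i) j\<bar> * \<bar>y - b\<bar> ^ j)"
          by (intro mult_right_mono) auto
        then show "norm (case p of (i, j) \<Rightarrow> real (Suc i) * c (Suc i) j * (x - a) ^ i * (y - b) ^ j)
            \<le> C / K * norm (case p of (i, j) \<Rightarrow> c (Suc i) j * K ^ Suc i * (y - b) ^ j)"
          using K0 by (simp add: p abs_mult power_abs mult_ac)
      qed
      then show ?thesis by (subst summable_on_iff_abs_summable_on_real) simp
    qed
    then obtain S where S: "((\<lambda>(i, j). real (Suc i) * c (Suc i) j * (x - a) ^ i * (y - b) ^ j) has_sum S) (UNIV \<times> UNIV)"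
      by (auto simp: summable_on_def)
    \<comment> \<open>The value of the double sum is identified with the derivative by summing over
      \<open>j\<close> first once more.\<close>
    have "(\<lambda>i. diffs d i * (x - a) ^ i) sums S"
    proof (rule has_sum_imp_sums, rule has_sum_Sigma'[OF S])
      fix i :: nat
      have "((\<lambda>j. real (Suc i) * (x - a) ^ i * (c (Suc i) j * (y - b) ^ j))
          has_sum real (Suc i) * (x - a) ^ i * d (Suc i)) UNIV"
        by (rule has_sum_cmult_right[OF d])
      then show "((\<lambda>j. case (i, j) of (i, j) \<Rightarrow> real (Suc i) * c (Suc i) j * (x - a) ^ i * (y - b) ^ j)
          has_sum diffs d i * (x - a) ^ i) UNIV" by (simp add: diffs_def mult_ac)
    qed
    then have "S = partial_x F x y" using p by (simp add: sums_iff)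
    with S D p show ?thesis by simp
  qed
  show "\<And>x y. \<bar>x - a\<bar> < r \<Longrightarrow> \<bar>y - b\<bar> < r \<Longrightarrow>
      ((\<lambda>t. F t y) has_real_derivative partial_x F x y) (at x)"
    using main by blast
  show "has_powser2 (\<lambda>i j. real (Suc i) * c (Suc i) j) a b r (partial_x F)"
    using main F by (simp add: has_powser2_def)
qed

lemma partial_y_swap: "partial_y F = (\<lambda>x y. partial_x (\<lambda>y x. F x y) y x)"
  by (simp add: partial_x_def partial_y_def fun_eq_iff)

lemma has_powser2_partial_y:
  assumes F: "has_powser2 c a b r F"
  shows "has_powser2 (\<lambda>i j. real (Suc j) * c i (Suc j)) a b r (partial_y F)"
    and "\<And>x y. \<bar>x - a\<bar> < r \<Longrightarrow> \<bar>y - b\<bar> < r \<Longrightarrow>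
      ((\<lambda>t. F x t) has_real_derivative partial_y F x y) (at y)"
  using has_powser2_swap[OF has_powser2_partial_x(1)[OF has_powser2_swap[OF F]]]
    has_powser2_partial_x(2)[OF has_powser2_swap[OF F]]
  by (simp_all add: partial_y_swap)

lemma has_powser2_centre:
  assumes "has_powser2 c a b r F"
  shows "F a b = c 0 0"
proof -
  have "((\<lambda>(i, j). c i j * (a - a) ^ i * (b - b) ^ j) has_sum F a b) UNIV"
    using has_powser2_pos[OF assms] by (intro has_powser2D[OF assms]) simp_all
  moreover have "((\<lambda>(i, j). c i j * (a - a) ^ i * (b - b) ^ j) has_sum c 0 0) UNIV"
    by (rule has_sum_finite_neutralI[of "{(0, 0)}"]) auto
  ultimately show ?thesis by (rule has_sum_unique)
qed

lemma has_powser2_slice: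
  assumes "has_powser2 c a b r F"
  shows "real_analytic_at (\<lambda>x. F x b) a"
proof (rule real_analytic_at_powser)
  show "r > 0" using assms by (simp add: has_powser2_def)
  fix x assume "\<bar>x - a\<bar> < r"
  then have s: "((\<lambda>(i, j). c i j * (x - a) ^ i * (b - b) ^ j) has_sum F x b) (UNIV \<times> UNIV)"
    using has_powser2D[OF assms, of x b] has_powser2_pos[OF assms] by simp
  show "(\<lambda>i. c i 0 * (x - a) ^ i) sums F x b"
  proof (rule has_sum_imp_sums, rule has_sum_Sigma'[OF s])
    fix i :: nat
    show "((\<lambda>j. case (i, j) of (i, j) \<Rightarrow> c i j * (x - a) ^ i * (b - b) ^ j) has_sum c i 0 * (x - a) ^ i) UNIV"
      by (rule has_sum_finite_neutralI[of "{0}"]) auto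
  qed
qed

text \<open>Total differentiability serves the chain rule along oblique lines. In a box of size
  \<rho> every term of degree at least 2 is bounded by (\<rho> / K)^2 times its size at distance
  \<open>K\<close>, so the remainder is quadratic in \<rho>.\<close>

lemma has_powser2_has_derivative:
  assumes F: "has_powser2 c a b r F"
  shows "((\<lambda>p. F (fst p) (snd p)) has_derivative
    (\<lambda>h. partial_x F a b * fst h + partial_y F a b * snd h)) (at (a, b))"
proof -
  have px: "partial_x F a b = c 1 0" and py: "partial_y F a b = c 0 1"
    using has_powser2_centre[OF has_powser2_partial_x(1)[OF F]]
      has_powser2_centre[OF has_powser2_partial_y(1)[OF F]] by simp_all
  have r: "r > 0" using F by (simp add: has_powser2_def)
  define K where "K = r / 2"
  have K: "0 < K" "K < r" using r by (auto simp: K_def)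
  have "((\<lambda>(i, j). c i j * (a + K - a) ^ i * (b + K - b) ^ j) has_sum F (a + K) (b + K)) UNIV"
    by (rule has_powser2D[OF F]) (use K in simp_all)
  then have "(\<lambda>(i, j). c i j * K ^ i * K ^ j) summable_on UNIV"
    by (simp add: has_sum_imp_summable)
  then have "(\<lambda>p. norm (case p of (i, j) \<Rightarrow> c i j * K ^ i * K ^ j)) summable_on UNIV"
    by (subst (asm) summable_on_iff_abs_summable_on_real)
  then obtain M where M: "((\<lambda>p. norm (case p of (i, j) \<Rightarrow> c i j * K ^ i * K ^ j)) has_sum M) UNIV"
    by (auto simp: summable_on_def)
  have M0: "M \<ge> 0" by (rule has_sum_nonneg[OF M]) simp
  have bound: "\<bar>F x y - F a b - (c 1 0 * (x - a) + c 0 1 * (y - b))\<bar> \<le> (\<rho> / K)\<^sup>2 * M"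
    if x: "\<bar>x - a\<bar> \<le> \<rho>" and y: "\<bar>y - b\<bar> \<le> \<rho>" and \<rho>: "\<rho> \<le> K" for x y \<rho>
  proof -
    define T where "T = (\<lambda>(i, j). c i j * (x - a) ^ i * (y - b) ^ j)"
    have T: "(T has_sum F x y) UNIV"
      unfolding T_def by (rule has_powser2D[OF F]) (use x y \<rho> K in auto)
    \<comment> \<open>The terms of degree at most 1 are removed by adding a finitely supported
      family with the opposite values.\<close>
    have "((\<lambda>(i, j). if i + j \<le> 1 then - T (i, j) else 0) has_sum
        - (F a b + (c 1 0 * (x - a) + c 0 1 * (y - b)))) UNIV"
      by (rule has_sum_finite_neutralI[of "{(0, 0), (1, 0), (0, 1)}"])
        (auto simp: T_def has_powser2_centre[OF F] split: if_splits)
    note has_sum_add[OF T this]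
    moreover have "(\<lambda>p. T p + (case p of (i, j) \<Rightarrow> if i + j \<le> 1 then - T (i, j) else 0))
        = (\<lambda>(i, j). if i + j \<le> 1 then 0 else T (i, j))" by (auto simp: fun_eq_iff)
    ultimately have R: "((\<lambda>(i, j). if i + j \<le> 1 then 0 else T (i, j)) has_sum
        F x y - F a b - (c 1 0 * (x - a) + c 0 1 * (y - b))) UNIV" (is "(?R has_sum ?S) UNIV")
      by (simp add: algebra_simps)
    have B: "((\<lambda>p. (\<rho> / K)\<^sup>2 * norm (case p of (i, j) \<Rightarrow> c i j * K ^ i * K ^ j)) has_sum (\<rho> / K)\<^sup>2 * M) UNIV"
      by (rule has_sum_cmult_right[OF M])
    have le: "\<bar>?R p\<bar> \<le> (\<rho> / K)\<^sup>2 * norm (case p of (i, j) \<Rightarrow> c i j * K ^ i * K ^ j)" for p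
    proof (cases p)
      case (Pair i j)
      have \<rho>0: "0 \<le> \<rho>" using x by linarith
      show ?thesis
      proof (cases "i + j \<le> 1")
        case False
        have "\<bar>x - a\<bar> ^ i * \<bar>y - b\<bar> ^ j \<le> \<rho> ^ i * \<rho> ^ j"
          using x y by (intro mult_mono power_mono) auto
        also have "\<dots> = (\<rho> / K) ^ (i + j) * (K ^ i * K ^ j)"
          using K by (simp add: power_divide power_add)
        also have "\<dots> \<le> (\<rho> / K) ^ 2 * (K ^ i * K ^ j)"
          using K \<rho> \<rho>0 False by (intro mult_right_mono power_decreasing) auto
        finally have "\<bar>c i j\<bar> * (\<bar>x - a\<bar> ^ i * \<bar>y - b\<bar> ^ j) \<le> \<bar>c i j\<bar> * ((\<rho> / K) ^ 2 * (K ^ i * K ^ j))"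
          by (rule mult_left_mono) simp
        then show ?thesis using False Pair K by (simp add: T_def abs_mult power_abs mult_ac)
      qed (use Pair in auto)
    qed
    have "?S \<le> (\<rho> / K)\<^sup>2 * M" using le by (intro has_sum_mono[OF R B]) (smt (verit))
    moreover have "- ?S \<le> (\<rho> / K)\<^sup>2 * M"
      using le by (intro has_sum_mono[OF has_sum_uminusI[OF R] B]) (smt (verit))
    ultimately show ?thesis by linarith
  qed
  show ?thesis unfolding has_derivative_at_alt px py
  proof (intro conjI allI impI)
    show "bounded_linear (\<lambda>h. c 1 0 * fst h + c 0 1 * snd h)"
      by (intro bounded_linear_intros)
    fix e :: real assume e: "e > 0"
    \<comment> \<open>The summand 1 keeps \<open>C\<close> positive when \<open>M\<close> is 0, so
      that \<open>e / C\<close> is a legitimate radius.\<close>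
    define C where "C = M / K\<^sup>2 + 1"
    have C: "C > 0" using M0 by (simp add: C_def add_nonneg_pos)
    show "\<exists>d>0. \<forall>y. norm (y - (a, b)) < d \<longrightarrow>
        norm (F (fst y) (snd y) - F (fst (a, b)) (snd (a, b)) - (c 1 0 * fst (y - (a, b)) + c 0 1 * snd (y - (a, b))))
        \<le> e * norm (y - (a, b))"
    proof (intro exI[of _ "min K (e / C)"] conjI allI impI)
      show "0 < min K (e / C)" using K e C by simp
      fix p :: "real \<times> real" assume p: "norm (p - (a, b)) < min K (e / C)"
      define \<rho> where "\<rho> = norm (p - (a, b))"
      have \<rho>0: "\<rho> \<ge> 0" by (simp add: \<rho>_def)
      have "\<bar>fst p - a\<bar> \<le> \<rho>" "\<bar>snd p - b\<bar> \<le> \<rho>"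
        using norm_fst_le[of "fst p - a" "snd p - b"] norm_snd_le[of "snd p - b" "fst p - a"]
        by (cases p; simp add: \<rho>_def)+
      from bound[OF this] p
      have "\<bar>F (fst p) (snd p) - F a b - (c 1 0 * (fst p - a) + c 0 1 * (snd p - b))\<bar> \<le> (\<rho> / K)\<^sup>2 * M"
        by (simp add: \<rho>_def)
      also have "\<dots> = (\<rho> * (M / K\<^sup>2)) * \<rho>" by (simp add: power2_eq_square)
      also have "\<dots> \<le> (\<rho> * C) * \<rho>" using \<rho>0 by (intro mult_right_mono mult_left_mono) (auto simp: C_def)
      also have "\<dots> \<le> e * \<rho>"
        using p C \<rho>0 by (intro mult_right_mono) (auto simp: \<rho>_def field_simps)
      finally show "norm (F (fst p) (snd p) - F (fst (a, b)) (snd (a, b)) - (c 1 0 * fst (p - (a, b)) + c 0 1 * snd (p - (a, b))))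
        \<le> e * norm (p - (a, b))" by (simp add: \<rho>_def)
    qed
  qed
qed

text \<open>The double series arises by expanding \<open>(X + Y) ^ n\<close> binomially and
  collecting terms by bidegree. Absolute convergence, inherited from the one-variable series at |X|
  + |Y|, justifies the rearrangement.\<close>

lemma real_analytic2_on_ridge:
  assumes q: "real_analytic_at q (a + k * b)"
  shows "\<exists>c r. has_powser2 c a b r (\<lambda>x y. q (x + k * y))"
proof -
  obtain \<rho> g where g: "\<rho> > 0" "g holomorphic_on ball (complex_of_real (a + k * b)) \<rho>"
    "\<And>x. \<bar>x - (a + k * b)\<bar> < \<rho> \<Longrightarrow> g (complex_of_real x) = of_real (q x)"
    using q by (rule real_analytic_atE) auto
  define e where "e n = (deriv ^^ n) q (a + k * b) / fact n" for n
  have e: "(\<lambda>n. e n * t ^ n) sums q (a + k * b + t)" if "\<bar>t\<bar> < \<rho>" for t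
    using holomorphic_extension_taylor[OF g(2,3), of "a + k * b + t"] that by (simp add: e_def)
  have ea: "summable (\<lambda>n. norm (e n * t ^ n))" if t: "\<bar>t\<bar> < \<rho>" for t
  proof -
    obtain K where "\<bar>t\<bar> < K" "K < \<rho>" using dense[OF t] by blast
    then show ?thesis using e[of K] by (intro powser_insidea[of e K t]) (auto simp: sums_iff)
  qed
  \<comment> \<open>Chosen so that |x - a| < r and |y - b| < r force |X| + |Y| < \<rho>.\<close>
  define r where "r = \<rho> / (1 + \<bar>k\<bar>)"
  have r: "r > 0" using g(1) by (simp add: r_def add_pos_nonneg)
  have "has_powser2 (\<lambda>i j. e (i + j) * real ((i + j) choose i) * k ^ j) a b r (\<lambda>x y. q (x + k * y))"
    unfolding has_powser2_def
  proof (intro conjI allI impI r)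
    fix x y assume xy: "\<bar>x - a\<bar> < r \<and> \<bar>y - b\<bar> < r"
    define X Y where "X = x - a" and "Y = k * (y - b)"
    have "\<bar>X\<bar> + \<bar>Y\<bar> < r + \<bar>k\<bar> * r"
    proof -
      have "\<bar>k\<bar> * \<bar>y - b\<bar> \<le> \<bar>k\<bar> * r" using xy by (intro mult_left_mono) auto
      then show ?thesis using xy by (simp add: X_def Y_def abs_mult)
    qed
    also have "r + \<bar>k\<bar> * r = \<rho>" by (simp add: r_def field_simps add_pos_nonneg add_nonneg_eq_0_iff)
    finally have XY: "\<bar>X\<bar> + \<bar>Y\<bar> < \<rho>" .
    define T where "T = (\<lambda>(n, i). e n * (real (n choose i) * X ^ i * Y ^ (n - i)))"
    have rows: "((\<lambda>i. T (n, i)) has_sum e n * (X + Y) ^ n) {..n}" for n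
      by (intro has_sum_finiteI) (simp_all add: T_def binomial_ring sum_distrib_left)
    have "(\<lambda>p. norm (T p)) summable_on Sigma UNIV (\<lambda>n. {..n})"
    proof (rule summable_on_SigmaI)
      show "((\<lambda>i. norm (T (n, i))) has_sum \<bar>e n\<bar> * (\<bar>X\<bar> + \<bar>Y\<bar>) ^ n) {..n}" for n
        by (intro has_sum_finiteI)
          (simp_all add: T_def binomial_ring sum_distrib_left abs_mult power_abs)
      have "summable (\<lambda>n. \<bar>e n\<bar> * (\<bar>X\<bar> + \<bar>Y\<bar>) ^ n)"
        using ea[of "\<bar>X\<bar> + \<bar>Y\<bar>"] XY by (simp add: abs_mult power_abs)
      then show "(\<lambda>n. \<bar>e n\<bar> * (\<bar>X\<bar> + \<bar>Y\<bar>) ^ n) summable_on UNIV"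
        by (rule summable_nonneg_imp_summable_on) simp
    qed simp
    then have sm: "T summable_on Sigma UNIV (\<lambda>n. {..n})"
      by (subst summable_on_iff_abs_summable_on_real)
    have "((\<lambda>n. e n * (X + Y) ^ n) has_sum q (a + k * b + (X + Y))) UNIV"
      using XY by (intro norm_summable_imp_has_sum ea e) auto
    from has_sum_SigmaI[OF rows this sm]
    have "(T has_sum q (x + k * y)) (Sigma UNIV (\<lambda>n. {..n}))"
      by (simp add: X_def Y_def algebra_simps)
    moreover have "(T has_sum q (x + k * y)) (Sigma UNIV (\<lambda>n. {..n})) \<longleftrightarrow>
        ((\<lambda>(i, j). e (i + j) * real (i + j choose i) * k ^ j * (x - a) ^ i * (y - b) ^ j) has_sum q (x + k * y)) UNIV"
      by (rule has_sum_reindex_bij_witness[of _ "\<lambda>(i, j). (i + j, i)" "\<lambda>(n, i). (i, n - i)"])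
        (auto simp: T_def X_def Y_def power_mult_distrib)
    ultimately show "((\<lambda>(i, j). e (i + j) * real (i + j choose i) * k ^ j * (x - a) ^ i * (y - b) ^ j)
        has_sum q (x + k * y)) UNIV" by simp
  qed
  then show ?thesis by blast
qed

section \<open>Surfaces in the branch\<close>

lemma real_analytic2_on_partial_x:
  assumes "real_analytic2_on F U" shows "real_analytic2_on (partial_x F) U"
  unfolding real_analytic2_on_iff
proof clarify
  fix a b assume "(a, b) \<in> U"
  then obtain r c where "has_powser2 c a b r F" using assms by (auto simp: real_analytic2_on_iff)
  from has_powser2_partial_x(1)[OF this]
  show "\<exists>r c. has_powser2 c a b r (partial_x F)" by (intro exI)
qed

lemma real_analytic2_on_partial_y:
  assumes "real_analytic2_on F U" shows "real_analytic2_on (partial_y F) U"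
  unfolding real_analytic2_on_iff
proof clarify
  fix a b assume "(a, b) \<in> U"
  then obtain r c where "has_powser2 c a b r F" using assms by (auto simp: real_analytic2_on_iff)
  from has_powser2_partial_y(1)[OF this]
  show "\<exists>r c. has_powser2 c a b r (partial_y F)" by (intro exI)
qed

text \<open>The mixed derivatives agree because both orders of differentiation produce the same
  coefficient array.\<close>

lemma real_analytic2_on_has_partials:
  assumes "real_analytic2_on F U" "(x, y) \<in> U"
  shows "((\<lambda>t. F t y) has_real_derivative partial_x F x y) (at x)"
    and "((\<lambda>t. F x t) has_real_derivative partial_y F x y) (at y)"
    and "((\<lambda>p. F (fst p) (snd p)) has_derivative
      (\<lambda>h. partial_x F x y * fst h + partial_y F x y * snd h)) (at (x, y))"
    and "real_analytic_at (\<lambda>t. F t y) x"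
    and "partial_x (partial_y F) x y = partial_y (partial_x F) x y"
proof -
  obtain c r where F: "has_powser2 c x y r F" using assms by (auto simp: real_analytic2_on_iff)
  then have r: "\<bar>x - x\<bar> < r" "\<bar>y - y\<bar> < r" using has_powser2_pos by auto
  show "((\<lambda>t. F t y) has_real_derivative partial_x F x y) (at x)"
    using has_powser2_partial_x(2)[OF F] r by blast
  show "((\<lambda>t. F x t) has_real_derivative partial_y F x y) (at y)"
    using has_powser2_partial_y(2)[OF F] r by blast
  show "((\<lambda>p. F (fst p) (snd p)) has_derivative
      (\<lambda>h. partial_x F x y * fst h + partial_y F x y * snd h)) (at (x, y))"
    by (rule has_powser2_has_derivative[OF F])
  show "real_analytic_at (\<lambda>t. F t y) x" by (rule has_powser2_slice[OF F])
  have "has_powser2 (\<lambda>i j. real (Suc j) * (real (Suc i) * c (Suc i) (Suc j))) x y r (partial_y (partial_x F))"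
    by (rule has_powser2_partial_y(1)[OF has_powser2_partial_x(1)[OF F]])
  moreover have "has_powser2 (\<lambda>i j. real (Suc j) * (real (Suc i) * c (Suc i) (Suc j))) x y r (partial_x (partial_y F))"
    using has_powser2_partial_x(1)[OF has_powser2_partial_y(1)[OF F]]
    by (simp add: mult.left_commute)
  ultimately show "partial_x (partial_y F) x y = partial_y (partial_x F) x y"
    using has_powser2_unique r by blast
qed

lemma open_contains_box:
  fixes U :: "(real \<times> real) set"
  assumes "open U" "(a, b) \<in> U"
  obtains r where "r > 0" "\<And>x y. \<bar>x - a\<bar> < r \<Longrightarrow> \<bar>y - b\<bar> < r \<Longrightarrow> (x, y) \<in> U"
proof -
  obtain A B where AB: "open A" "open B" "a \<in> A" "b \<in> B" "A \<times> B \<subseteq> U"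
    using assms by (metis mem_Times_iff fst_conv open_prod_elim snd_conv)
  obtain r s where "r > 0" "\<And>x. \<bar>x - a\<bar> < r \<Longrightarrow> x \<in> A" "s > 0" "\<And>y. \<bar>y - b\<bar> < s \<Longrightarrow> y \<in> B"
    using AB(1-4) by (metis open_dist dist_real_def)
  then show ?thesis using AB(5) by (intro that[of "min r s"]) auto
qed

lemma partial_cong:
  assumes "open U" "\<And>x y. (x, y) \<in> U \<Longrightarrow> F x y = G x y" "(x, y) \<in> U"
  shows "partial_x F x y = partial_x G x y" "partial_y F x y = partial_y G x y"
proof -
  obtain r where r: "r > 0" "\<And>s t. \<bar>s - x\<bar> < r \<Longrightarrow> \<bar>t - y\<bar> < r \<Longrightarrow> (s, t) \<in> U"
    using open_contains_box assms by metis
  have "\<forall>\<^sub>F t in nhds x. F t y = G t y"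
    using eventually_abs_less[OF r(1)] by eventually_elim (use r assms in auto)
  then show "partial_x F x y = partial_x G x y" by (simp add: partial_x_def deriv_cong_ev)
  have "\<forall>\<^sub>F t in nhds y. F x t = G x t"
    using eventually_abs_less[OF r(1)] by eventually_elim (use r assms in auto)
  then show "partial_y F x y = partial_y G x y" by (simp add: partial_y_def deriv_cong_ev)
qed

lemma DERIV_zero_interval_constant:
  fixes f :: "real \<Rightarrow> real"
  assumes "\<And>t. \<bar>t - a\<bar> < r \<Longrightarrow> (f has_real_derivative 0) (at t)" "\<bar>s - a\<bar> < r" "\<bar>t - a\<bar> < r"
  shows "f s = f t"
proof -
  have "\<exists>c. \<forall>x\<in>ball a r. f x = c"
  proof (rule has_field_derivative_zero_constant)
    fix x assume "x \<in> ball a r"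
    then have "(f has_real_derivative 0) (at x)"
      by (intro assms(1)) (simp add: dist_real_def abs_minus_commute)
    then show "(f has_real_derivative 0) (at x within ball a r)" by (rule has_field_derivative_at_within)
  qed simp
  then show ?thesis using assms(2,3) by (auto simp: dist_real_def abs_minus_commute)
qed

text \<open>Inside a box two points are joined by a horizontal and a vertical segment, along each of
  which a single partial derivative decides; connectedness of \<open>U\<close> links the
  boxes.\<close>

lemma zero_partials_constant:
  assumes U: "open U" "connected U"
    and h: "\<And>x y. (x, y) \<in> U \<Longrightarrow> ((\<lambda>t. h t y) has_real_derivative 0) (at x)"
      "\<And>x y. (x, y) \<in> U \<Longrightarrow> ((\<lambda>t. h x t) has_real_derivative 0) (at y)"
  shows "\<exists>C. \<forall>(x, y)\<in>U. h x y = (C :: real)"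
proof (cases "U = {}")
  case False
  then obtain a b where ab: "(a, b) \<in> U" by auto
  have "case p of (x, y) \<Rightarrow> h x y = h a b" if p: "p \<in> U" for p
  proof (rule connected_induction_simple[where P = "\<lambda>p. case p of (x, y) \<Rightarrow> h x y = h a b", OF U(2) ab p])
    fix q assume q: "q \<in> U"
    obtain u v where uv: "q = (u, v)" by fastforce
    obtain r where r: "r > 0" "\<And>x y. \<bar>x - u\<bar> < r \<Longrightarrow> \<bar>y - v\<bar> < r \<Longrightarrow> (x, y) \<in> U"
      using open_contains_box U(1) q uv by metis
    have eq: "h x y = h x' y'" if "\<bar>x - u\<bar> < r" "\<bar>y - v\<bar> < r" "\<bar>x' - u\<bar> < r" "\<bar>y' - v\<bar> < r" for x y x' y'
    proof -
      have "h x y = h x' y"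
      proof (rule DERIV_zero_interval_constant[where f = "\<lambda>t. h t y" and a = u and r = r])
        show "((\<lambda>t. h t y) has_real_derivative 0) (at t)" if "\<bar>t - u\<bar> < r" for t
          by (rule h(1)[OF r(2)]) fact+
      qed fact+
      also have "\<dots> = h x' y'"
      proof (rule DERIV_zero_interval_constant[where f = "\<lambda>t. h x' t" and a = v and r = r])
        show "((\<lambda>t. h x' t) has_real_derivative 0) (at t)" if "\<bar>t - v\<bar> < r" for t
          by (rule h(2)[OF r(2)]) fact+
      qed fact+
      finally show ?thesis .
    qed
    have B: "p \<in> ball u r \<times> ball v r \<longleftrightarrow> \<bar>fst p - u\<bar> < r \<and> \<bar>snd p - v\<bar> < r" for p
      by (auto simp: dist_real_def abs_minus_commute mem_Times_iff)
    show "\<exists>T. openin (top_of_set U) T \<and> q \<in> T \<and> (\<forall>x\<in>T. \<forall>y\<in>T.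
        (case x of (x, y) \<Rightarrow> h x y = h a b) \<longrightarrow> (case y of (x, y) \<Rightarrow> h x y = h a b))"
    proof (intro exI[of _ "ball u r \<times> ball v r"] conjI ballI impI)
      show "openin (top_of_set U) (ball u r \<times> ball v r)"
      proof (rule open_subset)
        show "ball u r \<times> ball v r \<subseteq> U"
        proof
          fix p assume "p \<in> ball u r \<times> ball v r"
          then show "p \<in> U" using r(2)[of "fst p" "snd p"] unfolding B by simp
        qed
      qed (simp add: open_Times)
      show "q \<in> ball u r \<times> ball v r" using r(1) uv by simp
    next
      fix x y assume *: "x \<in> ball u r \<times> ball v r" "y \<in> ball u r \<times> ball v r" "case x of (x, y) \<Rightarrow> h x y = h a b"
      then show "case y of (x, y) \<Rightarrow> h x y = h a b"
        using eq[of "fst x" "snd x" "fst y" "snd y"] unfolding B by (auto simp: case_prod_unfold)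
    qed
  qed simp
  then show ?thesis by blast
qed auto

text \<open>Geometrically, all rulings are parallel to \<open>(-k, 1, c)\<close>. One pair
  \<open>k\<close>, \<open>c\<close> is valid on all of \<open>U\<close>, so the same shear
  straightens the surface near every point.\<close>

lemma branch_S0_gradient_linear:
  assumes "branch_S0 F U"
  shows "\<exists>k c. \<forall>(x, y)\<in>U. partial_y F x y = k * partial_x F x y + c"
proof -
  define Fx Fy Fxx Fxy Fyy where "Fx = partial_x F" and "Fy = partial_y F"
    and "Fxx = partial_x Fx" and "Fxy = partial_y Fx" and "Fyy = partial_y Fy"
  note defs = Fx_def Fy_def Fxx_def Fxy_def Fyy_def
  have U: "open U" "connected U" and F: "real_analytic2_on F U" using assms by (auto simp: branch_S0_def)
  have an: "real_analytic2_on Fx U" "real_analytic2_on Fy U" "real_analytic2_on Fxx U"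
    "real_analytic2_on Fxy U" "real_analytic2_on Fyy U"
    unfolding defs by (intro real_analytic2_on_partial_x real_analytic2_on_partial_y F)+
  have nz: "Fxx x y \<noteq> 0" and H: "Fxx x y * Fyy x y = (Fxy x y)\<^sup>2"
    and S: "Fxx x y * partial_y Fxx x y = Fxy x y * partial_x Fxx x y" if "(x, y) \<in> U" for x y
    using assms that by (auto simp: branch_S0_def inv_S_def partials_def eval_nat_numeral defs split: prod.splits)
  define k where "k x y = Fxy x y / Fxx x y" for x y
  have Fxy: "Fxy x y = k x y * Fxx x y" if "(x, y) \<in> U" for x y
    using nz[OF that] by (simp add: k_def)
  have Fyy: "Fyy x y = (k x y)\<^sup>2 * Fxx x y" if "(x, y) \<in> U" for x y
    using nz[OF that] H[OF that] by (simp add: k_def power2_eq_square field_simps)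
  have Fxxy: "partial_y Fxx x y = k x y * partial_x Fxx x y" if "(x, y) \<in> U" for x y
    using nz[OF that] S[OF that] by (simp add: k_def field_simps)
  have Fxyx: "partial_x Fxy x y = partial_y Fxx x y" if "(x, y) \<in> U" for x y
    unfolding Fxy_def Fxx_def by (rule real_analytic2_on_has_partials(5)[OF an(1) that])
  have kx: "((\<lambda>t. k t y) has_real_derivative 0) (at x)" if xy: "(x, y) \<in> U" for x y
  proof -
    have "((\<lambda>t. k t y) has_real_derivative
        (partial_x Fxy x y * Fxx x y - Fxy x y * partial_x Fxx x y) / (Fxx x y * Fxx x y)) (at x)"
      unfolding k_def
      by (rule DERIV_divide[OF real_analytic2_on_has_partials(1)[OF an(4) xy]
            real_analytic2_on_has_partials(1)[OF an(3) xy] nz[OF xy]])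
    then show ?thesis using Fxyx[OF xy] S[OF xy] by (simp add: mult.commute)
  qed
  text \<open>The derivative of \<open>k\<close> in \<open>y\<close> vanishes because \<open>F\<^sub>x\<^sub>y\<^sub>y\<close> can be computed both as
    \<open>\<partial>\<^sub>x (k\<^sup>2 F\<^sub>x\<^sub>x)\<close> and as \<open>\<partial>\<^sub>y (k F\<^sub>x\<^sub>x)\<close>.\<close>
  have Fyyx: "partial_x Fyy x y = partial_y Fxy x y" if "(x, y) \<in> U" for x y
  proof -
    have "partial_x Fyy x y = partial_y (partial_x Fy) x y"
      unfolding Fyy_def by (rule real_analytic2_on_has_partials(5)[OF an(2) that])
    also have "\<dots> = partial_y Fxy x y"
      by (rule partial_cong(2)[OF U(1) _ that])
        (simp add: Fy_def Fxy_def Fx_def real_analytic2_on_has_partials(5)[OF F])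
    finally show ?thesis .
  qed
  have Fxyy: "partial_y Fxy x y = (k x y)\<^sup>2 * partial_x Fxx x y" if xy: "(x, y) \<in> U" for x y
  proof -
    have "((\<lambda>t. (k t y)\<^sup>2 * Fxx t y) has_real_derivative (k x y)\<^sup>2 * partial_x Fxx x y) (at x)"
      using kx[OF xy] real_analytic2_on_has_partials(1)[OF an(3) xy]
      by (auto intro!: derivative_eq_intros)
    then have "partial_x (\<lambda>x y. (k x y)\<^sup>2 * Fxx x y) x y = (k x y)\<^sup>2 * partial_x Fxx x y"
      unfolding partial_x_def by (rule DERIV_imp_deriv)
    moreover have "partial_x Fyy x y = partial_x (\<lambda>x y. (k x y)\<^sup>2 * Fxx x y) x y"
      using U(1) Fyy xy by (rule partial_cong(1))
    ultimately show ?thesis using Fyyx[OF xy] by simp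
  qed
  have ky: "((\<lambda>t. k x t) has_real_derivative 0) (at y)" if xy: "(x, y) \<in> U" for x y
  proof -
    have "((\<lambda>t. k x t) has_real_derivative
        (partial_y Fxy x y * Fxx x y - Fxy x y * partial_y Fxx x y) / (Fxx x y * Fxx x y)) (at y)"
      unfolding k_def
      by (rule DERIV_divide[OF real_analytic2_on_has_partials(2)[OF an(4) xy]
            real_analytic2_on_has_partials(2)[OF an(3) xy] nz[OF xy]])
    then show ?thesis using Fxyy[OF xy] Fxxy[OF xy] Fxy[OF xy] by (simp add: power2_eq_square)
  qed
  obtain \<kappa> where \<kappa>: "\<forall>(x, y)\<in>U. k x y = \<kappa>"
    using zero_partials_constant[OF U kx ky] by blast
  \<comment> \<open>With constant \<open>k\<close>, the two derivatives of
    \<open>F_y - k F_x\<close> are \<open>F_xy - k F_xx\<close> and \<open>F_yy - k F_xy\<close>,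
    and both vanish.\<close>
  have "\<exists>C. \<forall>(x, y)\<in>U. Fy x y - \<kappa> * Fx x y = C"
  proof (rule zero_partials_constant[OF U])
    fix x y assume xy: "(x, y) \<in> U"
    then have k: "Fxy x y = \<kappa> * Fxx x y" "Fyy x y = \<kappa> * Fxy x y"
      using \<kappa> Fxy[OF xy] Fyy[OF xy] by (auto simp: power2_eq_square)
    have "partial_x Fy x y = Fxy x y"
      unfolding Fy_def Fxy_def Fx_def by (rule real_analytic2_on_has_partials(5)[OF F xy])
    then show "((\<lambda>t. Fy t y - \<kappa> * Fx t y) has_real_derivative 0) (at x)"
      using real_analytic2_on_has_partials(1)[OF an(2) xy] real_analytic2_on_has_partials(1)[OF an(1) xy] k
      by (auto intro!: derivative_eq_intros simp: Fxx_def)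
    show "((\<lambda>t. Fy x t - \<kappa> * Fx x t) has_real_derivative 0) (at y)"
      using real_analytic2_on_has_partials(2)[OF an(2) xy] real_analytic2_on_has_partials(2)[OF an(1) xy] k
      by (auto intro!: derivative_eq_intros simp: Fxy_def Fyy_def)
  qed
  then obtain C where "\<forall>(x, y)\<in>U. Fy x y - \<kappa> * Fx x y = C" by blast
  then show ?thesis unfolding Fx_def Fy_def
    by (intro exI[of _ \<kappa>] exI[of _ C]) (auto simp: algebra_simps)
qed

section \<open>Straightened local form \<open>F = f (x + k y) + c y\<close>\<close>

lemma deriv_shift: "deriv (\<lambda>t. f (t + z)) x = deriv f (x + z :: real)"
  unfolding deriv_def by (simp add: DERIV_shift)

lemma iterated_deriv_shift: "(deriv ^^ n) (\<lambda>t. f (t + z)) = (\<lambda>t. (deriv ^^ n) f (t + z :: real))"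
  by (induction n) (simp_all add: deriv_shift)

lemma iterated_deriv_shift_add_const:
  assumes "real_analytic_at f (x + z)" "n > 0"
  shows "(deriv ^^ n) (\<lambda>t. f (t + z) + C) x = (deriv ^^ n) f (x + z)"
proof -
  obtain m where m: "n = Suc m" using assms(2) gr0_implies_Suc by blast
  have "filterlim (\<lambda>t. t + z) (nhds (x + z)) (nhds x)" by (intro tendsto_intros filterlim_ident)
  from eventually_compose_filterlim[OF real_analytic_at_eventually[OF assms(1)] this]
  have "\<forall>\<^sub>F t in nhds x. deriv (\<lambda>t. f (t + z) + C) t = deriv f (t + z)"
  proof eventually_elim
    case (elim t)
    from real_analytic_at_has_deriv[OF this]
    have "((\<lambda>t. f (t + z)) has_real_derivative deriv f (t + z)) (at t)" by (simp add: DERIV_shift)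
    then have "((\<lambda>t. f (t + z) + C) has_real_derivative deriv f (t + z)) (at t)"
      by (auto intro!: derivative_eq_intros)
    then show ?case by (rule DERIV_imp_deriv)
  qed
  from eventually_nhds_x_imp_x[OF iterated_deriv_cong_ev[OF this, of m]]
  have "(deriv ^^ m) (deriv (\<lambda>t. f (t + z) + C)) x = (deriv ^^ m) (deriv f) (x + z)"
    by (simp add: iterated_deriv_shift)
  then show ?thesis by (simp add: m funpow_swap1)
qed

lemma real_analytic_at_shift:
  assumes "real_analytic_at f (a + z)" shows "real_analytic_at (\<lambda>x. f (x + z)) a"
proof -
  obtain r h where r: "r > 0" "h holomorphic_on ball (complex_of_real (a + z)) r"
    "\<And>x. \<bar>x - (a + z)\<bar> < r \<Longrightarrow> h (complex_of_real x) = of_real (f x)"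
    using assms by (rule real_analytic_atE) auto
  show ?thesis
  proof (rule real_analytic_atI[OF r(1)])
    have "(h \<circ> (\<lambda>w. w + of_real z)) holomorphic_on ball (of_real a) r"
      by (rule holomorphic_on_compose_gen[OF _ r(2)]) (auto intro!: holomorphic_intros simp: dist_norm)
    then show "(\<lambda>w. h (w + of_real z)) holomorphic_on ball (of_real a) r" by (simp add: comp_def)
    show "h (complex_of_real x + complex_of_real z) = of_real (f (x + z))" if "\<bar>x - a\<bar> < r" for x
      using r(3)[of "x + z"] that by simp
  qed
qed

lemma iterated_partial_x: "(partial_x ^^ n) F x y = (deriv ^^ n) (\<lambda>t. F t y) x"
proof (induction n arbitrary: x)
  case (Suc n)
  have *: "(\<lambda>t. (partial_x ^^ n) F t y) = (deriv ^^ n) (\<lambda>t. F t y)" using Suc by (simp add: fun_eq_iff)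
  have "(partial_x ^^ Suc n) F x y = partial_x ((partial_x ^^ n) F) x y" by simp
  also have "\<dots> = deriv (\<lambda>t. (partial_x ^^ n) F t y) x" by (rule partial_x_def)
  finally show ?case using * by simp
qed simp

lemma partials_x: "partials n 0 F x y = (deriv ^^ n) (\<lambda>t. F t y) x"
  by (simp add: partials_def iterated_partial_x)

lemma partials_ridge:
  assumes f: "real_analytic_at f (x + k * y)" and n: "n > 0"
    and F: "\<forall>\<^sub>F t in nhds x. F t y = f (t + k * y) + c * y"
  shows "partials n 0 F x y = (deriv ^^ n) f (x + k * y)"
  unfolding partials_x using eventually_nhds_x_imp_x[OF iterated_deriv_cong_ev[OF F, of n]]
    iterated_deriv_shift_add_const[OF f n, of "c * y"] by simp

lemma inv_P_ridge:
  assumes "real_analytic_at f (x + k * y)" "\<forall>\<^sub>F t in nhds x. F t y = f (t + k * y) + c * y"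
  shows "inv_P F x y = curve_P f (x + k * y)"
  unfolding inv_P_def curve_P_def using partials_ridge[where f = f and k = k and F = F and c = c, OF assms(1) _ assms(2)] by simp

lemma branch_S0_local_form:
  assumes br: "branch_S0 F U" and k: "\<forall>(x, y)\<in>U. partial_y F x y = k * partial_x F x y + c"
    and p: "(x0, y0) \<in> U"
  obtains f r where "r > 0"
    "\<And>x y. \<bar>x - x0\<bar> < r \<Longrightarrow> \<bar>y - y0\<bar> < r \<Longrightarrow> (x, y) \<in> U"
    "\<And>x y. \<bar>x - x0\<bar> < r \<Longrightarrow> \<bar>y - y0\<bar> < r \<Longrightarrow> F x y = f (x + k * y) + c * y"
    "\<And>t. \<bar>t - (x0 + k * y0)\<bar> < (1 + \<bar>k\<bar>) * r \<Longrightarrow> real_analytic_at f t \<and> (deriv ^^ 2) f t \<noteq> 0"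
proof -
  have U: "open U" and F: "real_analytic2_on F U" using br by (auto simp: branch_S0_def)
  obtain R where R: "R > 0" "\<And>x y. \<bar>x - x0\<bar> < R \<Longrightarrow> \<bar>y - y0\<bar> < R \<Longrightarrow> (x, y) \<in> U"
    using open_contains_box[OF U p] by blast
  \<comment> \<open>Sliding from \<open>(x, y)\<close> towards height \<open>y0\<close> along
    \<open>x + k y = const\<close> moves \<open>x\<close> by at most \<open>2 |k| r\<close>; as
    \<open>r + 2 |k| r = R\<close>, the box contained in \<open>U\<close> is never left.\<close>
  define r where "r = R / (1 + 2 * \<bar>k\<bar>)"
  have den: "1 + 2 * \<bar>k\<bar> > 0" by (simp add: add_pos_nonneg)
  have r: "r > 0" using R(1) den by (simp add: r_def)
  have rR: "(1 + 2 * \<bar>k\<bar>) * r = R" using den by (simp add: r_def)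
  have kr: "\<bar>k\<bar> * r \<ge> 0" using r by simp
  have rR': "r + 2 * (\<bar>k\<bar> * r) = R" "r \<le> R" "(1 + \<bar>k\<bar>) * r \<le> R"
    using rR kr by (simp_all add: algebra_simps)
  \<comment> \<open>The slice at height \<open>y0\<close>, reparametrized by \<open>x + k y0\<close>
    and freed of the linear term.\<close>
  define f where "f t = F (t + - (k * y0)) y0 + - (c * y0)" for t
  show ?thesis
  proof (rule that[of r f])
    show "r > 0" by (rule r)
    show "(x, y) \<in> U" if "\<bar>x - x0\<bar> < r" "\<bar>y - y0\<bar> < r" for x y
      by (rule R(2)) (use that rR'(2) in linarith)+
    show "F x y = f (x + k * y) + c * y" if xy: "\<bar>x - x0\<bar> < r" "\<bar>y - y0\<bar> < r" for x y
    proof -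
      \<comment> \<open>\<open>F - c y\<close> is constant along the lines \<open>x + k y = const\<close>\<close>
      define \<psi> where "\<psi> t = F (x + k * y - k * t) t - c * t" for t
      have "\<psi> y = \<psi> y0"
      proof (rule DERIV_zero_interval_constant[where f = \<psi> and a = y0 and r = r])
        fix t assume t: "\<bar>t - y0\<bar> < r"
        have "\<bar>k\<bar> * \<bar>y - t\<bar> \<le> \<bar>k\<bar> * (2 * r)" using t xy(2) by (intro mult_left_mono) auto
        then have *: "\<bar>x + k * y - k * t - x0\<bar> < R"
        proof -
          have "x + k * y - k * t - x0 = (x - x0) + k * (y - t)" by (simp add: algebra_simps)
          then have "\<bar>x + k * y - k * t - x0\<bar> \<le> \<bar>x - x0\<bar> + \<bar>k\<bar> * \<bar>y - t\<bar>"
            by (metis abs_mult abs_triangle_ineq)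
          then show ?thesis using xy(1) rR'(1) \<open>\<bar>k\<bar> * \<bar>y - t\<bar> \<le> \<bar>k\<bar> * (2 * r)\<close> by simp
        qed
        have q: "(x + k * y - k * t, t) \<in> U" by (rule R(2)) (use t rR'(2) * in linarith)+
        have "((\<lambda>t. (x + k * y - k * t, t)) has_derivative (\<lambda>h. (- k * h, h))) (at t)"
          by (auto intro!: derivative_eq_intros)
        from has_derivative_compose[OF this real_analytic2_on_has_partials(3)[OF F q]]
        have "((\<lambda>t. F (x + k * y - k * t) t) has_derivative
            (\<lambda>h. partial_x F (x + k * y - k * t) t * (- k * h) + partial_y F (x + k * y - k * t) t * h)) (at t)"
          by simp
        then have "((\<lambda>t. F (x + k * y - k * t) t) has_real_derivative
            partial_x F (x + k * y - k * t) t * (- k) + partial_y F (x + k * y - k * t) t) (at t)"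
          by (rule has_derivative_imp_has_field_derivative) (simp add: algebra_simps)
        moreover have "partial_y F (x + k * y - k * t) t = k * partial_x F (x + k * y - k * t) t + c"
          using k q by blast
        ultimately show "(\<psi> has_real_derivative 0) (at t)"
          unfolding \<psi>_def by (auto intro!: derivative_eq_intros)
      qed (use xy r in auto)
      then show ?thesis by (simp add: \<psi>_def f_def algebra_simps)
    qed
    show "real_analytic_at f t \<and> (deriv ^^ 2) f t \<noteq> 0" if t: "\<bar>t - (x0 + k * y0)\<bar> < (1 + \<bar>k\<bar>) * r" for t
    proof -
      have q: "(t + - (k * y0), y0) \<in> U" by (rule R(2)) (use t rR'(3) R(1) in linarith)+
      note s = real_analytic2_on_has_partials(4)[OF F q]
      have "real_analytic_at f t" unfolding f_def
        by (intro real_analytic_at_add real_analytic_at_const real_analytic_at_shift[where f = "\<lambda>t. F t y0"] s)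
      moreover have "(deriv ^^ 2) f t = partials 2 0 F (t + - (k * y0)) y0"
        unfolding partials_x f_def by (rule iterated_deriv_shift_add_const[OF s]) simp
      ultimately show ?thesis using br q by (auto simp: branch_S0_def)
    qed
  qed
qed

section \<open>Germs and affine maps\<close>

text \<open>For a global homeomorphism, matching relative neighbourhoods amounts to preserving
  membership near \<open>p\<close>. In this form germ maps compose, invert and restrict to slices by
  convergence of filters alone.\<close>

lemma germ_map_homeomorphism_iff:
  fixes \<phi> :: "'a::topological_space \<Rightarrow> 'a"
  assumes "continuous_on UNIV \<phi>" "continuous_on UNIV \<psi>" "\<And>x. \<psi> (\<phi> x) = x" "\<And>x. \<phi> (\<psi> x) = x"
  shows "germ_map \<phi> S p S' p' \<longleftrightarrow> p \<in> S \<and> \<phi> p = p' \<and> (\<forall>\<^sub>F v in nhds p. v \<in> S \<longleftrightarrow> \<phi> v \<in> S')"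
proof
  assume "germ_map \<phi> S p S' p'"
  then obtain W W' where *: "\<phi> p = p'" "open W" "open W'" "p \<in> S \<inter> W" "p' \<in> S' \<inter> W'"
    "\<phi> ` (S \<inter> W) = S' \<inter> W'"
    unfolding germ_map_def openin_open by blast
  have "open (W \<inter> \<phi> -` W')" using * assms(1) by (intro open_Int open_vimage) auto
  moreover have "p \<in> W \<inter> \<phi> -` W'" using * by auto
  moreover have "v \<in> S \<longleftrightarrow> \<phi> v \<in> S'" if v: "v \<in> W \<inter> \<phi> -` W'" for v
  proof
    assume "v \<in> S" then show "\<phi> v \<in> S'" using v *(6) by blast
  next
    assume "\<phi> v \<in> S'"
    then have "\<phi> v \<in> \<phi> ` (S \<inter> W)" using v *(6) by blast
    then obtain w where "w \<in> S" "\<phi> v = \<phi> w" by blast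
    then show "v \<in> S" using assms(3) by metis
  qed
  ultimately show "p \<in> S \<and> \<phi> p = p' \<and> (\<forall>\<^sub>F v in nhds p. v \<in> S \<longleftrightarrow> \<phi> v \<in> S')"
    using * unfolding eventually_nhds by blast
next
  assume *: "p \<in> S \<and> \<phi> p = p' \<and> (\<forall>\<^sub>F v in nhds p. v \<in> S \<longleftrightarrow> \<phi> v \<in> S')"
  then obtain W where W: "open W" "p \<in> W" "\<And>v. v \<in> W \<Longrightarrow> v \<in> S \<longleftrightarrow> \<phi> v \<in> S'"
    unfolding eventually_nhds by blast
  have o: "open (\<psi> -` W)" using W(1) assms(2) by (intro open_vimage)
  have "\<phi> ` (S \<inter> W) = S' \<inter> \<psi> -` W"
  proof
    show "\<phi> ` (S \<inter> W) \<subseteq> S' \<inter> \<psi> -` W" using W(3) assms(3) by auto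
    show "S' \<inter> \<psi> -` W \<subseteq> \<phi> ` (S \<inter> W)"
    proof
      fix w assume "w \<in> S' \<inter> \<psi> -` W"
      then have "\<psi> w \<in> S \<inter> W" using W(3)[of "\<psi> w"] assms(4) by auto
      then show "w \<in> \<phi> ` (S \<inter> W)" using assms(4) by (metis imageI)
    qed
  qed
  moreover have "openin (top_of_set S) (S \<inter> W)" "openin (top_of_set S') (S' \<inter> \<psi> -` W)"
    using W(1) o by (auto simp: openin_open)
  moreover have "p \<in> S \<inter> W" "p' \<in> S' \<inter> \<psi> -` W" using * W assms(3) by auto
  ultimately show "germ_map \<phi> S p S' p'" unfolding germ_map_def using * by blast
qed

lemma affine_inverse:
  fixes A :: "real ^ 'n ^ 'n"
  assumes "invertible A"
  obtains B where "invertible B" "\<And>v b. B *v (A *v v + b) + - (B *v b) = v"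
    "\<And>v b. A *v (B *v v + - (B *v b)) + b = v" "A ** B = mat 1" "B ** A = mat 1"
proof -
  from assms obtain B where B: "A ** B = mat 1" "B ** A = mat 1" by (auto simp: invertible_def)
  show ?thesis
  proof (rule that[of B])
    show "invertible B" using B by (auto simp: invertible_def)
    show "B *v (A *v v + b) + - (B *v b) = v" for v b
      by (simp add: matrix_vector_right_distrib matrix_vector_mul_assoc B)
    show "A *v (B *v v + - (B *v b)) + b = v" for v b
      by (simp add: matrix_vector_right_distrib matrix_vector_mul_assoc B
          matrix_vector_mult_diff_distrib)
  qed (rule B)+
qed

lemma continuous_on_affine:
  fixes A :: "real ^ 'n ^ 'm"
  shows "continuous_on X (\<lambda>v. A *v v + b)"
  by (intro continuous_intros matrix_vector_mult_linear_continuous_on)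

lemma germ_map_affine_iff:
  fixes A :: "real ^ 'n ^ 'n"
  assumes "invertible A"
  shows "germ_map (\<lambda>v. A *v v + b) S p S' p' \<longleftrightarrow>
    p \<in> S \<and> A *v p + b = p' \<and> (\<forall>\<^sub>F v in nhds p. v \<in> S \<longleftrightarrow> A *v v + b \<in> S')"
proof -
  obtain B where "invertible B" "\<And>v b. B *v (A *v v + b) + - (B *v b) = v"
    "\<And>v b. A *v (B *v v + - (B *v b)) + b = v"
    using affine_inverse[OF assms] by metis
  then show ?thesis
    by (intro germ_map_homeomorphism_iff[of _ "\<lambda>v. B *v v + - (B *v b)"] continuous_on_affine)
qed

lemma filterlim_affine:
  fixes A :: "real ^ 'n ^ 'm"
  shows "filterlim (\<lambda>v. A *v v + b) (nhds (A *v p + b)) (nhds p)"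
proof -
  have "isCont (\<lambda>v. A *v v + b) p"
    using continuous_on_affine[of UNIV A b] by (simp add: continuous_on_eq_continuous_at)
  then show ?thesis
    unfolding isCont_def tendsto_at_iff_tendsto_nhds[of "\<lambda>v. A *v v + b" p] .
qed

lemma germ_map_affine_compose:
  fixes A A' :: "real ^ 'n ^ 'n"
  assumes A: "invertible A" "invertible A'"
    and g: "germ_map (\<lambda>v. A *v v + b) S p S' p'" "germ_map (\<lambda>v. A' *v v + b') S' p' S'' p''"
  shows "germ_map (\<lambda>v. (A' ** A) *v v + (A' *v b + b')) S p S'' p''"
proof -
  have eq: "(A' ** A) *v v + (A' *v b + b') = A' *v (A *v v + b) + b'" for v
    by (simp add: matrix_vector_right_distrib matrix_vector_mul_assoc)
  note g1 = g(1)[unfolded germ_map_affine_iff[OF A(1)]]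
  note g2 = g(2)[unfolded germ_map_affine_iff[OF A(2)]]
  have "\<forall>\<^sub>F v in nhds p. A *v v + b \<in> S' \<longleftrightarrow> A' *v (A *v v + b) + b' \<in> S''"
    using eventually_compose_filterlim[OF _ filterlim_affine[of A b p]] g1 g2 by blast
  then have "\<forall>\<^sub>F v in nhds p. v \<in> S \<longleftrightarrow> A' *v (A *v v + b) + b' \<in> S''"
    using conjunct2[OF conjunct2[OF g1]] by eventually_elim simp
  then show ?thesis
    unfolding germ_map_affine_iff[OF invertible_mult[OF A(2,1)]] unfolding eq using g1 g2 by auto
qed

lemma germ_map_affine_inverse:
  fixes A B :: "real ^ 'n ^ 'n"
  assumes AB: "A ** B = mat 1" "B ** A = mat 1" and g: "germ_map (\<lambda>v. A *v v + b) S p S' p'"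
  shows "germ_map (\<lambda>v. B *v v + - (B *v b)) S' p' S p"
proof -
  have inv: "invertible A" "invertible B" using AB by (auto simp: invertible_def)
  have BA: "B *v (A *v v + b) + - (B *v b) = v" for v
    by (simp add: matrix_vector_right_distrib matrix_vector_mul_assoc AB)
  have AB': "A *v (B *v v + - (B *v b)) + b = v" for v
    by (simp add: matrix_vector_right_distrib matrix_vector_mul_assoc AB
          matrix_vector_mult_diff_distrib)
  note g1 = g[unfolded germ_map_affine_iff[OF inv(1)]]
  have p: "B *v p' + - (B *v b) = p" using g1 BA by blast
  have "p' \<in> S'" using eventually_nhds_x_imp_x[of _ p] g1 by blast
  moreover
  have "\<forall>\<^sub>F v in nhds p'. B *v v + - (B *v b) \<in> S \<longleftrightarrow> A *v (B *v v + - (B *v b)) + b \<in> S'"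
    using eventually_compose_filterlim[OF _ filterlim_affine[of B "- (B *v b)" p']] g1 unfolding p by blast
  then have "\<forall>\<^sub>F v in nhds p'. v \<in> S' \<longleftrightarrow> B *v v + - (B *v b) \<in> S"
    by eventually_elim (simp only: AB')
  ultimately show ?thesis
    unfolding germ_map_affine_iff[OF inv(2)] using p by blast
qed

lemma SL3_invertible: "A \<in> SL3 \<Longrightarrow> invertible A"
  by (simp add: SL3_def invertible_det_nz)

lemma germ_equivalent_SA3_iff:
  "germ_equivalent SA3 S p S' p' \<longleftrightarrow> (\<exists>A b. A \<in> SL3 \<and> germ_map (\<lambda>v. A *v v + b) S p S' p')"
  unfolding germ_equivalent_def SA3_def by blast

lemma germ_equivalent_A2_iff:
  "germ_equivalent A2 S p S' p' \<longleftrightarrow> (\<exists>A b. invertible A \<and> germ_map (\<lambda>v. A *v v + b) S p S' p')"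
  unfolding germ_equivalent_def A2_def by blast

lemma germ_equivalent_SA3_trans:
  assumes "germ_equivalent SA3 S p S' p'" "germ_equivalent SA3 S' p' S'' p''"
  shows "germ_equivalent SA3 S p S'' p''"
proof -
  obtain A b A' b' where *: "A \<in> SL3" "germ_map (\<lambda>v. A *v v + b) S p S' p'"
    "A' \<in> SL3" "germ_map (\<lambda>v. A' *v v + b') S' p' S'' p''"
    using assms unfolding germ_equivalent_SA3_iff by blast
  note germ_map_affine_compose[OF SL3_invertible[OF *(1)] SL3_invertible[OF *(3)] *(2,4)]
  moreover have "A' ** A \<in> SL3" using *(1,3) by (simp add: SL3_def det_mul)
  ultimately show ?thesis unfolding germ_equivalent_SA3_iff by blast
qed

lemma germ_equivalent_SA3_sym:
  assumes "germ_equivalent SA3 S p S' p'"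
  shows "germ_equivalent SA3 S' p' S p"
proof -
  obtain A b where *: "A \<in> SL3" "germ_map (\<lambda>v. A *v v + b) S p S' p'"
    using assms unfolding germ_equivalent_SA3_iff by blast
  obtain B where B: "A ** B = mat 1" "B ** A = mat 1"
    using SL3_invertible[OF *(1)] by (auto simp: invertible_def)
  have "det A * det B = 1" using B(1) by (metis det_I det_mul)
  then have "B \<in> SL3" using *(1) by (simp add: SL3_def)
  then show ?thesis unfolding germ_equivalent_SA3_iff
    using germ_map_affine_inverse[OF B *(2)] by blast
qed

lemma germ_equivalent_A2_trans:
  assumes "germ_equivalent A2 S p S' p'" "germ_equivalent A2 S' p' S'' p''"
  shows "germ_equivalent A2 S p S'' p''"
proof -
  obtain A b A' b' where *: "invertible A" "germ_map (\<lambda>v. A *v v + b) S p S' p'"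
    "invertible A'" "germ_map (\<lambda>v. A' *v v + b') S' p' S'' p''"
    using assms unfolding germ_equivalent_A2_iff by blast
  from germ_map_affine_compose[OF *(1,3) *(2,4)]
  show ?thesis unfolding germ_equivalent_A2_iff using invertible_mult[OF *(3,1)] by blast
qed

section \<open>Coordinates of graphs, products and matrices\<close>

lemma mem_graph_surface:
  "v \<in> graph_surface F U \<longleftrightarrow> (v $ 1, v $ 2) \<in> U \<and> v $ 3 = F (v $ 1) (v $ 2)"
proof
  assume "(v $ 1, v $ 2) \<in> U \<and> v $ 3 = F (v $ 1) (v $ 2)"
  moreover from this have "v = vector [v $ 1, v $ 2, F (v $ 1) (v $ 2)]"
    by (simp add: vec_eq_iff forall_3)
  ultimately show "v \<in> graph_surface F U" unfolding graph_surface_def by blast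
qed (auto simp: graph_surface_def)

lemma mem_product_surface: "v \<in> product_surface f I \<longleftrightarrow> v $ 1 \<in> I \<and> v $ 3 = f (v $ 1)"
  by (simp add: product_surface_def mem_graph_surface)

lemma mem_graph_curve: "v \<in> graph_curve f I \<longleftrightarrow> v $ 1 \<in> I \<and> v $ 2 = f (v $ 1)"
proof
  assume "v $ 1 \<in> I \<and> v $ 2 = f (v $ 1)"
  moreover from this have "v = vector [v $ 1, f (v $ 1)]" by (simp add: vec_eq_iff forall_2)
  ultimately show "v \<in> graph_curve f I" unfolding graph_curve_def by blast
qed (auto simp: graph_curve_def)

lemma matrix_vector_mult_3:
  fixes A :: "real ^ 3 ^ 3"
  shows "(A *v v) $ i = A $ i $ 1 * v $ 1 + A $ i $ 2 * v $ 2 + A $ i $ 3 * v $ 3"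
  by (simp add: matrix_vector_mult_def sum_3)

lemma matrix_vector_mult_2:
  fixes A :: "real ^ 2 ^ 2"
  shows "(A *v v) $ i = A $ i $ 1 * v $ 1 + A $ i $ 2 * v $ 2"
  by (simp add: matrix_vector_mult_def sum_2)

lemma tendsto_nth_nhds: "((\<lambda>v. v $ i) \<longlongrightarrow> p $ i) (nhds p)"
  by (intro tendsto_vec_nth filterlim_ident)

lemma tendsto_vector_3:
  fixes f g h :: "'a \<Rightarrow> real"
  assumes "(f \<longlongrightarrow> v $ 1) F" "(g \<longlongrightarrow> v $ 2) F" "(h \<longlongrightarrow> v $ 3) F"
  shows "((\<lambda>x. vector [f x, g x, h x] :: real ^ 3) \<longlongrightarrow> v) F"
proof (rule vec_tendstoI)
  fix i :: 3
  have "i = 1 \<or> i = 2 \<or> i = 3" by (rule exhaust_3)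
  then show "((\<lambda>x. (vector [f x, g x, h x] :: real ^ 3) $ i) \<longlongrightarrow> v $ i) F" using assms by auto
qed

lemma tendsto_vector_2:
  fixes f g :: "'a \<Rightarrow> real"
  assumes "(f \<longlongrightarrow> v $ 1) F" "(g \<longlongrightarrow> v $ 2) F"
  shows "((\<lambda>x. vector [f x, g x] :: real ^ 2) \<longlongrightarrow> v) F"
proof (rule vec_tendstoI)
  fix i :: 2
  have "i = 1 \<or> i = 2" by (rule exhaust_2)
  then show "((\<lambda>x. (vector [f x, g x] :: real ^ 2) $ i) \<longlongrightarrow> v $ i) F" using assms by auto
qed

lemma deriv2_affine_eq_0:
  fixes g :: "real \<Rightarrow> real"
  assumes "\<forall>\<^sub>F s in nhds a. g s = \<alpha> + \<beta> * s"
  shows "(deriv ^^ 2) g a = 0"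
proof -
  have "\<forall>\<^sub>F s in nhds a. deriv g s = \<beta>"
    using iffD2[OF eventually_eventually assms]
  proof eventually_elim
    case (elim s)
    have "((\<lambda>s. \<alpha> + \<beta> * s) has_real_derivative \<beta>) (at s)" by (auto intro!: derivative_eq_intros)
    then show ?case using deriv_cong_ev[OF elim refl] DERIV_imp_deriv by metis
  qed
  from deriv_cong_ev[OF this refl] show ?thesis by (simp add: eval_nat_numeral)
qed

text \<open>The product contains the whole ruling through \<open>p\<close>, whose image must lie
  locally in the cylinder over the graph of \<open>g\<close>. As that graph contains no straight
  segment around the image point, the image is again a ruling. This fixes the second column of
  \<open>A\<close>, and expanding the determinant along it gives the third claim.\<close>

lemma product_germ_planar:
  fixes A :: "real ^ 3 ^ 3"
  assumes A: "A \<in> SL3" and f: "isCont f (p $ 1)" and I: "\<forall>\<^sub>F x in nhds (p $ 1). x \<in> I"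
    and g: "(deriv ^^ 2) g (p' $ 1) \<noteq> 0"
    and germ: "germ_map (\<lambda>v. A *v v + b) (product_surface f I) p (product_surface g J) p'"
  shows "A $ 1 $ 2 = 0" "A $ 3 $ 2 = 0"
    "A $ 2 $ 2 * (A $ 1 $ 1 * A $ 3 $ 3 - A $ 1 $ 3 * A $ 3 $ 1) = 1"
    "p $ 3 = f (p $ 1)" "p' $ 1 = A $ 1 $ 1 * p $ 1 + A $ 1 $ 3 * f (p $ 1) + b $ 1"
    "\<forall>\<^sub>F x in nhds (p $ 1). g (A $ 1 $ 1 * x + A $ 1 $ 3 * f x + b $ 1) = A $ 3 $ 1 * x + A $ 3 $ 3 * f x + b $ 3"
proof -
  note germ' = germ[unfolded germ_map_affine_iff[OF SL3_invertible[OF A]]]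
  have p1: "p $ 1 \<in> I" and p3: "p $ 3 = f (p $ 1)" using germ' by (auto simp: mem_product_surface)
  have p': "p' $ i = A $ i $ 1 * p $ 1 + A $ i $ 2 * p $ 2 + A $ i $ 3 * p $ 3 + b $ i" for i
    using conjunct1[OF conjunct2[OF germ']] by (metis vector_add_component matrix_vector_mult_3)
  have ev: "\<forall>\<^sub>F v in nhds p. v \<in> product_surface f I \<longleftrightarrow> A *v v + b \<in> product_surface g J"
    using germ' by blast
  have "((\<lambda>y. vector [p $ 1, y, p $ 3] :: real ^ 3) \<longlongrightarrow> p) (nhds (p $ 2))"
    by (intro tendsto_vector_3 tendsto_const filterlim_ident)
  from eventually_compose_filterlim[OF ev this]
  have line: "\<forall>\<^sub>F y in nhds (p $ 2). A $ 3 $ 1 * p $ 1 + A $ 3 $ 2 * y + A $ 3 $ 3 * p $ 3 + b $ 3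
      = g (A $ 1 $ 1 * p $ 1 + A $ 1 $ 2 * y + A $ 1 $ 3 * p $ 3 + b $ 1)"
    by eventually_elim (use p1 p3 in \<open>simp add: mem_product_surface matrix_vector_mult_3\<close>)
  show A12: "A $ 1 $ 2 = 0"
  proof (rule ccontr)
    assume nz: "A $ 1 $ 2 \<noteq> 0"
    define \<kappa> where "\<kappa> = A $ 1 $ 1 * p $ 1 + A $ 1 $ 3 * p $ 3 + b $ 1"
    have "((\<lambda>s. (s - \<kappa>) / A $ 1 $ 2) \<longlongrightarrow> (p' $ 1 - \<kappa>) / A $ 1 $ 2) (nhds (p' $ 1))"
      using nz by (intro tendsto_intros filterlim_ident) auto
    moreover have "(p' $ 1 - \<kappa>) / A $ 1 $ 2 = p $ 2" using nz p'[of 1] by (simp add: \<kappa>_def)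
    ultimately have lim: "((\<lambda>s. (s - \<kappa>) / A $ 1 $ 2) \<longlongrightarrow> p $ 2) (nhds (p' $ 1))" by simp
    \<comment> \<open>otherwise the ruling through \<open>p\<close> is mapped to a line in the graph of \<open>g\<close>\<close>
    have "\<forall>\<^sub>F s in nhds (p' $ 1). g s = (A $ 3 $ 1 * p $ 1 - A $ 3 $ 2 * \<kappa> / A $ 1 $ 2 + A $ 3 $ 3 * p $ 3 + b $ 3)
        + A $ 3 $ 2 / A $ 1 $ 2 * s"
      using eventually_compose_filterlim[OF line lim]
    proof eventually_elim
      case (elim s)
      have "A $ 1 $ 1 * p $ 1 + A $ 1 $ 2 * ((s - \<kappa>) / A $ 1 $ 2) + A $ 1 $ 3 * p $ 3 + b $ 1 = s"
        using nz by (simp add: \<kappa>_def)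
      then show ?case using elim by (simp add: diff_divide_distrib right_diff_distrib)
    qed
    from deriv2_affine_eq_0[OF this] g show False by simp
  qed
  \<comment> \<open>Now the right-hand side of \<open>line\<close> is independent of
    \<open>y\<close>, so the left-hand side is too; two values of \<open>y\<close> suffice.\<close>
  show A32: "A $ 3 $ 2 = 0"
  proof -
    obtain e where e: "e > 0" "\<And>y. \<bar>y - p $ 2\<bar> < e \<Longrightarrow> A $ 3 $ 1 * p $ 1 + A $ 3 $ 2 * y + A $ 3 $ 3 * p $ 3 + b $ 3
      = g (A $ 1 $ 1 * p $ 1 + A $ 1 $ 2 * y + A $ 1 $ 3 * p $ 3 + b $ 1)"
      using line by (auto simp: eventually_nhds_metric dist_real_def)
    have "A $ 3 $ 2 * (p $ 2 + e / 2) = A $ 3 $ 2 * p $ 2"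
    proof -
      let ?g = "g (A $ 1 $ 1 * p $ 1 + A $ 1 $ 3 * p $ 3 + b $ 1)"
      have "A $ 3 $ 1 * p $ 1 + A $ 3 $ 2 * p $ 2 + A $ 3 $ 3 * p $ 3 + b $ 3 = ?g"
        "A $ 3 $ 1 * p $ 1 + A $ 3 $ 2 * (p $ 2 + e / 2) + A $ 3 $ 3 * p $ 3 + b $ 3 = ?g"
        using e(1) e(2)[of "p $ 2"] e(2)[of "p $ 2 + e / 2"] A12 by simp_all
      then show ?thesis by linarith
    qed
    then show ?thesis using e(1) by simp
  qed
  show "A $ 2 $ 2 * (A $ 1 $ 1 * A $ 3 $ 3 - A $ 1 $ 3 * A $ 3 $ 1) = 1"
    using A A12 A32 by (simp add: SL3_def det_3 algebra_simps)
  show "p $ 3 = f (p $ 1)" by (rule p3)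
  show "p' $ 1 = A $ 1 $ 1 * p $ 1 + A $ 1 $ 3 * f (p $ 1) + b $ 1" using p'[of 1] A12 p3 by simp
  \<comment> \<open>The section of the surface at the height \<open>p $ 2\<close> is a copy of the
    profile.\<close>
  have "((\<lambda>x. vector [x, p $ 2, f x] :: real ^ 3) \<longlongrightarrow> p) (nhds (p $ 1))"
    using f by (intro tendsto_vector_3 tendsto_const filterlim_ident)
      (simp add: p3 isCont_def tendsto_at_iff_tendsto_nhds)
  from eventually_compose_filterlim[OF ev this] I
  show "\<forall>\<^sub>F x in nhds (p $ 1). g (A $ 1 $ 1 * x + A $ 1 $ 3 * f x + b $ 1) = A $ 3 $ 1 * x + A $ 3 $ 3 * f x + b $ 3"
    by eventually_elim (use A12 A32 in \<open>simp add: mem_product_surface matrix_vector_mult_3\<close>)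
qed

lemma product_germ_imp_curve_germ:
  assumes f: "isCont f (p $ 1)" and I: "\<forall>\<^sub>F x in nhds (p $ 1). x \<in> I"
    and g: "(deriv ^^ 2) g (p' $ 1) \<noteq> 0"
    and equiv: "germ_equivalent SA3 (product_surface f I) p (product_surface g J) p'"
  shows "germ_equivalent A2 (graph_curve f I) (vector [p $ 1, p $ 3]) (graph_curve g J) (vector [p' $ 1, p' $ 3])"
proof -
  obtain A b where A: "A \<in> SL3" and germ: "germ_map (\<lambda>v. A *v v + b) (product_surface f I) p (product_surface g J) p'"
    using equiv unfolding germ_equivalent_SA3_iff by blast
  note pl = product_germ_planar[OF A f I g germ]
  note germ' = germ[unfolded germ_map_affine_iff[OF SL3_invertible[OF A]]]
  \<comment> \<open>Since \<open>A $ 1 $ 2\<close> and \<open>A $ 3 $ 2\<close> vanish, the first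
    and third image coordinates depend only on the first and third coordinates; \<open>B\<close>
    deletes the second row and column of \<open>A\<close>.\<close>
  define B :: "real ^ 2 ^ 2" where "B = vector [vector [A $ 1 $ 1, A $ 1 $ 3], vector [A $ 3 $ 1, A $ 3 $ 3]]"
  define t :: "real ^ 2" where "t = vector [b $ 1, b $ 3]"
  have B: "invertible B" using pl(3) by (auto simp: B_def invertible_det_nz det_2)
  have p': "p' $ i = A $ i $ 1 * p $ 1 + A $ i $ 2 * p $ 2 + A $ i $ 3 * p $ 3 + b $ i" for i
    using conjunct1[OF conjunct2[OF germ']] by (metis vector_add_component matrix_vector_mult_3)
  have "((\<lambda>w :: real ^ 2. vector [w $ 1, p $ 2, w $ 2] :: real ^ 3) \<longlongrightarrow> p) (nhds (vector [p $ 1, p $ 3]))"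
    using tendsto_nth_nhds[of 1 "vector [p $ 1, p $ 3] :: real ^ 2"]
      tendsto_nth_nhds[of 2 "vector [p $ 1, p $ 3] :: real ^ 2"]
    by (intro tendsto_vector_3 tendsto_const) simp_all
  from eventually_compose_filterlim[OF conjunct2[OF conjunct2[OF germ']] this]
  have ev: "\<forall>\<^sub>F w in nhds (vector [p $ 1, p $ 3]). w \<in> graph_curve f I \<longleftrightarrow> B *v w + t \<in> graph_curve g J"
    by eventually_elim
      (use pl(1,2) in \<open>simp add: mem_product_surface mem_graph_curve matrix_vector_mult_3 matrix_vector_mult_2 B_def t_def\<close>)
  show ?thesis unfolding germ_equivalent_A2_iff
  proof (intro exI conjI)
    show "invertible B" by (rule B)
    show "germ_map (\<lambda>v. B *v v + t) (graph_curve f I) (vector [p $ 1, p $ 3]) (graph_curve g J) (vector [p' $ 1, p' $ 3])"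
      unfolding germ_map_affine_iff[OF B]
      using ev germ' pl(1,2)
      by (simp add: mem_product_surface mem_graph_curve vec_eq_iff forall_2 p')
        (simp add: B_def t_def matrix_vector_mult_def sum_2)
  qed
qed

lemma curve_germ_imp_product_germ:
  assumes "germ_equivalent A2 (graph_curve f I) (vector [p $ 1, p $ 3]) (graph_curve g J) (vector [p' $ 1, p' $ 3])"
  shows "germ_equivalent SA3 (product_surface f I) p (product_surface g J) p'"
proof -
  obtain A :: "real ^ 2 ^ 2" and t where A: "invertible A"
    and germ: "germ_map (\<lambda>v. A *v v + t) (graph_curve f I) (vector [p $ 1, p $ 3]) (graph_curve g J) (vector [p' $ 1, p' $ 3])"
    using assms unfolding germ_equivalent_A2_iff by blast
  define D where "D = det A"
  have D: "D \<noteq> 0" using A by (simp add: D_def invertible_det_nz)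
  \<comment> \<open>The entry \<open>1 / D\<close> makes the determinant 1 for every invertible
    \<open>A\<close>, orientation-reversing ones included. The middle entry of \<open>b\<close>
    below sends the height \<open>p $ 2\<close> to \<open>p' $ 2\<close>.\<close>
  define B :: "real ^ 3 ^ 3" where
    "B = vector [vector [A $ 1 $ 1, 0, A $ 1 $ 2], vector [0, 1 / D, 0], vector [A $ 2 $ 1, 0, A $ 2 $ 2]]"
  define b :: "real ^ 3" where "b = vector [t $ 1, p' $ 2 - p $ 2 / D, t $ 2]"
  have B: "B \<in> SL3" using D by (simp add: SL3_def B_def det_3 D_def det_2 field_simps)
  note germ' = germ[unfolded germ_map_affine_iff[OF A]]
  have p': "p' $ 1 = A $ 1 $ 1 * p $ 1 + A $ 1 $ 2 * p $ 3 + t $ 1"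
    "p' $ 3 = A $ 2 $ 1 * p $ 1 + A $ 2 $ 2 * p $ 3 + t $ 2"
    using germ' by (simp_all add: vec_eq_iff forall_2 matrix_vector_mult_def sum_2)
  have "((\<lambda>w :: real ^ 3. vector [w $ 1, w $ 3] :: real ^ 2) \<longlongrightarrow> vector [p $ 1, p $ 3]) (nhds p)"
    using tendsto_nth_nhds[of 1 p] tendsto_nth_nhds[of 3 p]
    by (intro tendsto_vector_2) simp_all
  from eventually_compose_filterlim[OF conjunct2[OF conjunct2[OF germ']] this]
  have ev: "\<forall>\<^sub>F w in nhds p. w \<in> product_surface f I \<longleftrightarrow> B *v w + b \<in> product_surface g J"
    by eventually_elim
      (simp add: mem_product_surface mem_graph_curve matrix_vector_mult_3 matrix_vector_mult_2 B_def b_def)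
  show ?thesis unfolding germ_equivalent_SA3_iff
  proof (intro exI conjI)
    show "B \<in> SL3" by (rule B)
    show "germ_map (\<lambda>v. B *v v + b) (product_surface f I) p (product_surface g J) p'"
      unfolding germ_map_affine_iff[OF SL3_invertible[OF B]]
      using ev germ'
      by (simp add: mem_product_surface mem_graph_curve vec_eq_iff forall_3 p')
        (simp add: B_def b_def matrix_vector_mult_def sum_3)
  qed
qed

text \<open>The first row replaces \<open>x\<close> by \<open>x + k y\<close> and the third removes
  \<open>c y\<close>, so the ruling direction \<open>(-k, 1, c)\<close> goes to the \<open>y\<close>
  axis.\<close>

definition shear :: "real \<Rightarrow> real \<Rightarrow> real ^ 3 ^ 3" where
  "shear k c = vector [vector [1, k, 0], vector [0, 1, 0], vector [0, - c, 1]]"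

lemma shear_SL3: "shear k c \<in> SL3"
  by (simp add: SL3_def shear_def det_3)

lemma shear_mult: "shear k c *v v = vector [v $ 1 + k * v $ 2, v $ 2, v $ 3 - c * v $ 2]"
  by (simp add: vec_eq_iff forall_3 matrix_vector_mult_def sum_3 shear_def)

lemma shear_inverse: "shear k c ** shear (- k) (- c) = mat 1"
  by (simp add: vec_eq_iff forall_3 matrix_matrix_mult_def sum_3 shear_def mat_def)

lemma shear_germ:
  assumes r: "r > 0" "\<And>x y. \<bar>x - x0\<bar> < r \<Longrightarrow> \<bar>y - y0\<bar> < r \<Longrightarrow> (x, y) \<in> U"
    "\<And>x y. \<bar>x - x0\<bar> < r \<Longrightarrow> \<bar>y - y0\<bar> < r \<Longrightarrow> F x y = f (x + k * y) + c * y"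
    and I: "\<forall>\<^sub>F t in nhds (x0 + k * y0). t \<in> I"
  shows "germ_map (\<lambda>v. shear k c *v v + 0) (graph_surface F U) (vector [x0, y0, F x0 y0])
    (product_surface f I) (vector [x0 + k * y0, y0, F x0 y0 - c * y0])"
proof -
  let ?p = "vector [x0, y0, F x0 y0] :: real ^ 3"
  have lim: "((\<lambda>v. v $ 1) \<longlongrightarrow> x0) (nhds ?p)" "((\<lambda>v. v $ 2) \<longlongrightarrow> y0) (nhds ?p)"
    using tendsto_nth_nhds[of 1 ?p] tendsto_nth_nhds[of 2 ?p] by simp_all
  have "\<forall>\<^sub>F v in nhds ?p. \<bar>v $ 1 - x0\<bar> < r" "\<forall>\<^sub>F v in nhds ?p. \<bar>v $ 2 - y0\<bar> < r"
    using tendstoD[OF lim(1) r(1)] tendstoD[OF lim(2) r(1)] by (simp_all add: dist_real_def)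
  moreover have "\<forall>\<^sub>F v in nhds ?p. v $ 1 + k * v $ 2 \<in> I"
    by (rule eventually_compose_filterlim[OF I]) (intro tendsto_intros lim)
  ultimately have "\<forall>\<^sub>F v in nhds ?p. v \<in> graph_surface F U \<longleftrightarrow> shear k c *v v + 0 \<in> product_surface f I"
  proof eventually_elim
    case (elim v)
    then show ?case using r(2,3)[of "v $ 1" "v $ 2"]
      by (auto simp: mem_graph_surface mem_product_surface shear_mult)
  qed
  then show ?thesis
    unfolding germ_map_affine_iff[OF SL3_invertible[OF shear_SL3]]
    using r by (simp add: mem_graph_surface shear_mult)
qed

section \<open>Normalization of curves and surfaces\<close>

lemma isCont_filterlim_nhds: "isCont f a \<Longrightarrow> filterlim f (nhds (f a)) (nhds a)"
  by (simp add: isCont_def tendsto_at_iff_tendsto_nhds)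

lemma invertible_2:
  fixes a b c d :: real
  assumes "a * d - b * c \<noteq> 0"
  shows "invertible (vector [vector [a, b], vector [c, d]] :: real ^ 2 ^ 2)"
  using assms by (simp add: invertible_det_nz det_2)

text \<open>The use of \<open>sgn\<close> treats both cases at once: for nonzero \<open>P\<close>
  the 4-jet is that of the normal form, and for \<open>P = 0\<close> the quartic term at the point
  disappears as well. The last conclusion transports vanishing of \<open>P\<close> near the point,
  as the parabola case requires.\<close>

lemma curve_normalization:
  assumes f: "real_analytic_at f x0" and f2: "(deriv ^^ 2) f x0 \<noteq> 0"
    and I: "\<forall>\<^sub>F x in nhds x0. x \<in> I"
  obtains h k r where "r > 0" "k holomorphic_on ball (complex_of_real 0) r"
    "\<And>x. \<bar>x - 0\<bar> < r \<Longrightarrow> k (complex_of_real x) = of_real (h x)"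
    "h 0 = 0" "deriv h 0 = 0" "(deriv ^^ 2) h 0 = 1" "(deriv ^^ 3) h 0 = 0"
    "(deriv ^^ 4) h 0 = sgn (curve_P f x0)"
    "germ_equivalent A2 (graph_curve f I) (vector [x0, f x0]) (graph_curve h {-r<..<r}) 0"
    "(\<forall>\<^sub>F x in nhds x0. curve_P f x = 0) \<Longrightarrow> (\<forall>\<^sub>F w in nhds 0. curve_P h w = 0)"
proof -
  define P p q w where "P = curve_P f x0" and "p = deriv f x0" and "q = (deriv ^^ 2) f x0" and "w = (deriv ^^ 3) f x0"
  have q: "q \<noteq> 0" using f2 by (simp add: q_def)
  \<comment> \<open>After moving the point to the origin and the tangent to the axis, \<open>\<beta>\<close> is chosen to kill the
    cubic term and \<open>l\<close> to normalize the quartic one.\<close>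
  define l where "l = (if P = 0 then 1 else sqrt \<bar>P\<bar>)"
  have l: "l > 0" by (auto simp: l_def)
  have Pl: "P / l\<^sup>2 = sgn P" by (auto simp: l_def sgn_if)
  define \<beta> where "\<beta> = w / (3 * q)"
  \<comment> \<open>These solve four conditions: \<open>a + b p = l\<close>, so that
    \<open>m = l\<close>; \<open>c + d p = 0\<close>, so that the tangent is horizontal;
    \<open>D q / m^3 = 1\<close>, that is \<open>D = l^3 / q\<close>; and
    \<open>w m = 3 b q^2\<close>, which removes the cubic term.\<close>
  define a b c d where "a = l * (1 - \<beta> * p / q)" and "b = l * \<beta> / q" and "c = - (l\<^sup>2 * p / q)" and "d = l\<^sup>2 / q"
  define e e' where "e = - (a * x0 + b * f x0)" and "e' = - (c * x0 + d * f x0)"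
  have s0: "a * x0 + b * f x0 + e = 0" "c * x0 + d * f x0 + e' = 0" by (simp_all add: e_def e'_def)
  have m: "a + b * p = l" using q by (simp add: a_def b_def field_simps)
  have n: "c + d * p = 0" by (simp add: c_def d_def)
  have D: "a * d - b * c = l ^ 3 / q"
    using q by (simp add: a_def b_def c_def d_def field_simps power2_eq_square power3_eq_cube)
  have D0: "a * d - b * c \<noteq> 0" using D l q by simp
  obtain h k X r where r: "r > 0" and k: "k holomorphic_on ball (of_real 0) r"
    and kh: "\<And>w. \<bar>w - 0\<bar> < r \<Longrightarrow> k (complex_of_real w) = of_real (h w)"
    and X: "\<And>w. \<bar>w - 0\<bar> < r \<Longrightarrow> a * X w + b * f (X w) + e = w"
    and h: "\<And>w. h w = c * X w + d * f (X w) + e'"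
    and Xs: "\<forall>\<^sub>F x in nhds x0. X (a * x + b * f x + e) = x"
    and contX: "isCont X 0" and X0: "X 0 = x0"
    using affine_image_exists[OF f, of a b e c d e' thesis] m l unfolding s0 p_def[symmetric] by auto
  have hra: "real_analytic_at h 0" by (rule real_analytic_atI[OF r k kh])
  have hra': "real_analytic_at h (a * x0 + b * f x0 + e)" using hra s0 by simp
  have eq: "\<forall>\<^sub>F x in nhds x0. h (a * x + b * f x + e) = c * x + d * f x + e'"
    using Xs by eventually_elim (simp add: h)
  note der = eventually_nhds_x_imp_x[OF affine_image_derivs[OF f hra' eq D0]]
  have h1: "deriv h 0 = 0" and h2: "(deriv ^^ 2) h 0 = 1" and h3: "(deriv ^^ 3) h 0 = 0"
    using der l q unfolding Let_def s0 p_def[symmetric] q_def[symmetric] w_def[symmetric] m n D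
    by (simp_all add: b_def \<beta>_def power2_eq_square)
  have PP: "\<forall>\<^sub>F x in nhds x0. a + b * deriv f x \<noteq> 0 \<and>
      curve_P h (a * x + b * f x + e) = curve_P f x / (a + b * deriv f x)\<^sup>2"
    by (rule affine_image_curve_P[OF f hra' eq D0 f2])
  from eventually_nhds_x_imp_x[OF this]
  have "curve_P h 0 = sgn P" unfolding s0 p_def[symmetric] m P_def[symmetric] using Pl by simp
  \<comment> \<open>Where the second derivative is 1 and the third is 0, \<open>curve_P\<close>
    equals the fourth derivative.\<close>
  then have h4: "(deriv ^^ 4) h 0 = sgn P" by (simp add: curve_P_def h2 h3)
  define B :: "real ^ 2 ^ 2" where "B = vector [vector [a, b], vector [c, d]]"
  define t :: "real ^ 2" where "t = vector [e, e']"
  have B: "invertible B" unfolding B_def by (rule invertible_2[OF D0])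
  have Bt: "(B *v v + t) $ 1 = a * v $ 1 + b * v $ 2 + e" "(B *v v + t) $ 2 = c * v $ 1 + d * v $ 2 + e'" for v
    by (simp_all add: matrix_vector_mult_2 B_def t_def)
  let ?p = "vector [x0, f x0] :: real ^ 2"
  have lim: "((\<lambda>v. v $ 1) \<longlongrightarrow> x0) (nhds ?p)" "((\<lambda>v. v $ 2) \<longlongrightarrow> f x0) (nhds ?p)"
    using tendsto_nth_nhds[of 1 ?p] tendsto_nth_nhds[of 2 ?p] by simp_all
  have "((\<lambda>v. a * v $ 1 + b * v $ 2 + e) \<longlongrightarrow> a * x0 + b * f x0 + e) (nhds ?p)"
    by (intro tendsto_intros lim)
  then have "((\<lambda>v. a * v $ 1 + b * v $ 2 + e) \<longlongrightarrow> 0) (nhds ?p)" by (simp only: s0)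
  from tendstoD[OF this r]
  have "\<forall>\<^sub>F v in nhds ?p. \<bar>a * v $ 1 + b * v $ 2 + e\<bar> < r" by simp
  moreover note eventually_compose_filterlim[OF I lim(1)] eventually_compose_filterlim[OF Xs lim(1)]
  ultimately have "\<forall>\<^sub>F v in nhds ?p. v \<in> graph_curve f I \<longleftrightarrow> B *v v + t \<in> graph_curve h {-r<..<r}"
  proof eventually_elim
    case (elim v)
    define s where "s = a * v $ 1 + b * v $ 2 + e"
    have "v $ 2 = f (v $ 1) \<longleftrightarrow> c * v $ 1 + d * v $ 2 + e' = h s"
    proof
      assume "v $ 2 = f (v $ 1)"
      then have "X s = v $ 1" using elim(3) by (simp add: s_def)
      then show "c * v $ 1 + d * v $ 2 + e' = h s" using \<open>v $ 2 = _\<close> by (simp add: h)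
    next
      assume *: "c * v $ 1 + d * v $ 2 + e' = h s"
      \<comment> \<open>The point \<open>v\<close> and the curve point over \<open>X s\<close> have
        the same image under the plane map; its linear part is invertible, so the points
        coincide.\<close>
      define u1 u2 where "u1 = X s - v $ 1" and "u2 = f (X s) - v $ 2"
      have "a * u1 + b * u2 = 0" "c * u1 + d * u2 = 0"
        using X[of s] elim(1) * h[of s] by (simp_all add: s_def u1_def u2_def algebra_simps)
      note E = this
      have "(a * d - b * c) * u1 = d * (a * u1 + b * u2) - b * (c * u1 + d * u2)"
        "(a * d - b * c) * u2 = a * (c * u1 + d * u2) - c * (a * u1 + b * u2)"
        by (simp_all add: algebra_simps)
      then have "(a * d - b * c) * u1 = 0" "(a * d - b * c) * u2 = 0" unfolding E by simp_all
      then have "u1 = 0" "u2 = 0" using D0 by (simp_all del: right_minus_eq)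
      then show "v $ 2 = f (v $ 1)" by (simp add: u1_def u2_def)
    qed
    then show ?case using elim(1,2) by (auto simp: mem_graph_curve Bt s_def simp del: vector_add_component)
  qed
  moreover have "?p \<in> graph_curve f I" using eventually_nhds_x_imp_x[OF I] by (simp add: mem_graph_curve)
  moreover have "B *v ?p + t = 0"
    using Bt[of ?p] s0 by (simp add: vec_eq_iff forall_2 del: vector_add_component)
  ultimately have germ: "germ_equivalent A2 (graph_curve f I) ?p (graph_curve h {-r<..<r}) 0"
    unfolding germ_equivalent_A2_iff using germ_map_affine_iff[OF B] B by blast
  have van: "\<forall>\<^sub>F w in nhds 0. curve_P h w = 0" if z: "\<forall>\<^sub>F x in nhds x0. curve_P f x = 0"
  proof -
    have "\<forall>\<^sub>F x in nhds x0. curve_P h (a * x + b * f x + e) = 0"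
      using PP z by eventually_elim simp
    then have "\<forall>\<^sub>F x in nhds (X 0). curve_P h (a * x + b * f x + e) = 0" by (simp only: X0)
    from eventually_compose_filterlim[OF this isCont_filterlim_nhds[OF contX]]
      eventually_abs_less[OF r, of 0]
    show ?thesis by eventually_elim (simp add: X)
  qed
  show ?thesis
    by (rule that[OF r k kh _ h1 h2 h3 h4[unfolded P_def] germ van])
      (use h[of 0] X0 s0 in auto)
qed

lemma curve_P_zero_imp_parabola:
  assumes h: "real_analytic_at h 0" "h 0 = 0" "deriv h 0 = 0" "(deriv ^^ 2) h 0 = 1" "(deriv ^^ 3) h 0 = 0"
    and P: "\<forall>\<^sub>F w in nhds 0. curve_P h w = 0"
  shows "\<forall>\<^sub>F w in nhds 0. h w = w\<^sup>2 / 2"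
proof -
  define h1 h2 h3 h4 where "h1 = deriv h" and "h2 = deriv h1" and "h3 = deriv h2" and "h4 = deriv h3"
  note hd = h1_def h2_def h3_def h4_def
  have ra: "real_analytic_at h1 0" "real_analytic_at h2 0" "real_analytic_at h3 0"
    unfolding hd by (intro real_analytic_at_deriv h(1))+
  have v: "h1 0 = 0" "h2 0 = 1" "h3 0 = 0" using h(3-5) by (simp_all add: hd deriv_numerals)
  have "\<forall>\<^sub>F w in nhds 0. h2 w \<noteq> 0"
    using isCont_filterlim_nhds[OF real_analytic_at_isCont[OF ra(2)]] v
    by (intro tendsto_imp_eventually_ne[where c = 1]) simp_all
  then have "\<forall>\<^sub>F w in nhds 0. (h has_real_derivative h1 w) (at w) \<and> (h1 has_real_derivative h2 w) (at w) \<and>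
      (h2 has_real_derivative h3 w) (at w) \<and> (h3 has_real_derivative h4 w) (at w) \<and> h2 w \<noteq> 0 \<and> curve_P h w = 0"
    using P real_analytic_at_eventually_has_deriv[OF h(1), folded hd]
      real_analytic_at_eventually_has_deriv[OF ra(1), folded hd]
      real_analytic_at_eventually_has_deriv[OF ra(2), folded hd]
      real_analytic_at_eventually_has_deriv[OF ra(3), folded hd]
    by eventually_elim blast
  then obtain r where r: "r > 0" and R: "\<And>w. \<bar>w - 0\<bar> < r \<Longrightarrow> (h has_real_derivative h1 w) (at w) \<and>
      (h1 has_real_derivative h2 w) (at w) \<and> (h2 has_real_derivative h3 w) (at w) \<and>
      (h3 has_real_derivative h4 w) (at w) \<and> h2 w \<noteq> 0 \<and> curve_P h w = 0"
    unfolding eventually_nhds_abs by blast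
  have r0: "\<bar>0 - 0 :: real\<bar> < r" using r by simp
  have e3: "h3 w = 0" if w: "\<bar>w - 0\<bar> < r" for w
  proof -
    \<comment> \<open>first integral of the equation \<open>3 h'' h'''' = 5 h'''\<^sup>2\<close>\<close>
    have "h3 w ^ 3 / h2 w ^ 5 = h3 0 ^ 3 / h2 0 ^ 5"
    proof (rule DERIV_zero_interval_constant[where f = "\<lambda>w. h3 w ^ 3 / h2 w ^ 5", OF _ w r0])
      fix t assume "\<bar>t - 0\<bar> < r"
      note R' = R[OF this]
      then have "curve_P h t = 0" "h2 t \<noteq> 0" by blast+
      then have ode: "3 * h2 t * h4 t = 5 * (h3 t)\<^sup>2" by (simp add: curve_P_def deriv_numerals hd)
      have "((\<lambda>w. h3 w ^ 3) has_real_derivative 3 * (h3 t)\<^sup>2 * h4 t) (at t)"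
        using R' by (auto intro!: derivative_eq_intros)
      from DERIV_quotient_power[OF this, of h2 "h3 t" 5] R'
      have "((\<lambda>w. h3 w ^ 3 / h2 w ^ 5) has_real_derivative
          (3 * (h3 t)\<^sup>2 * h4 t * h2 t - real 5 * h3 t ^ 3 * h3 t) / h2 t ^ Suc 5) (at t)" by blast
      moreover have "3 * (h3 t)\<^sup>2 * h4 t * h2 t - real 5 * h3 t ^ 3 * h3 t = (h3 t)\<^sup>2 * (3 * h2 t * h4 t - 5 * (h3 t)\<^sup>2)"
        by (simp add: algebra_simps power2_eq_square power3_eq_cube)
      ultimately show "((\<lambda>w. h3 w ^ 3 / h2 w ^ 5) has_real_derivative 0) (at t)" using ode by simp
    qed
    then show ?thesis using v R[OF w] by simp
  qed
  have e2: "h2 w = 1" if w: "\<bar>w - 0\<bar> < r" for w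
    using DERIV_zero_interval_constant[of 0 r h2, OF _ w r0] R e3 v by auto
  have e1: "h1 w = w" if w: "\<bar>w - 0\<bar> < r" for w
  proof -
    have "h1 w - w = h1 0 - 0"
    proof (rule DERIV_zero_interval_constant[where f = "\<lambda>w. h1 w - w", OF _ w r0])
      fix t assume t: "\<bar>t - 0\<bar> < r"
      then show "((\<lambda>w. h1 w - w) has_real_derivative 0) (at t)"
        using R[OF t] e2[OF t] by (auto intro!: derivative_eq_intros)
    qed
    then show ?thesis using v by simp
  qed
  have "h w = w\<^sup>2 / 2" if w: "\<bar>w - 0\<bar> < r" for w
  proof -
    have "h w - w\<^sup>2 / 2 = h 0 - 0\<^sup>2 / 2"
    proof (rule DERIV_zero_interval_constant[where f = "\<lambda>w. h w - w\<^sup>2 / 2", OF _ w r0])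
      fix t assume t: "\<bar>t - 0\<bar> < r"
      then show "((\<lambda>w. h w - w\<^sup>2 / 2) has_real_derivative 0) (at t)"
        using R[OF t] e1[OF t] by (auto intro!: derivative_eq_intros)
    qed
    then show ?thesis using h(2) by simp
  qed
  then show ?thesis using r unfolding eventually_nhds_abs by blast
qed

lemma half_parabola_germ:
  assumes "r > 0" "\<forall>\<^sub>F w in nhds 0. h w = w\<^sup>2 / 2"
  shows "germ_equivalent A2 (graph_curve h {-r<..<r}) 0 (graph_curve (\<lambda>x. x\<^sup>2) UNIV) 0"
proof -
  \<comment> \<open>Doubling the ordinate turns \<open>x^2 / 2\<close> into \<open>x^2\<close>. The
    determinant 2 is admissible in the plane group and is compensated along \<open>y\<close> when
    the map is lifted to products.\<close>
  define B :: "real ^ 2 ^ 2" where "B = vector [vector [1, 0], vector [0, 2]]"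
  have B: "invertible B" unfolding B_def by (rule invertible_2) simp
  have lim: "((\<lambda>v :: real ^ 2. v $ 1) \<longlongrightarrow> 0) (nhds 0)"
    using tendsto_nth_nhds[of 1 "0 :: real ^ 2"] by simp
  have "\<forall>\<^sub>F v in nhds 0. v \<in> graph_curve h {-r<..<r} \<longleftrightarrow> B *v v + 0 \<in> graph_curve (\<lambda>x. x\<^sup>2) UNIV"
    using eventually_compose_filterlim[OF assms(2) lim] tendstoD[OF lim assms(1)]
    by eventually_elim (auto simp: mem_graph_curve matrix_vector_mult_2 B_def)
  moreover have "0 \<in> graph_curve h {-r<..<r}"
    using assms(1) eventually_nhds_x_imp_x[OF assms(2)] by (simp add: mem_graph_curve)
  ultimately have "germ_map (\<lambda>v. B *v v + 0) (graph_curve h {-r<..<r}) 0 (graph_curve (\<lambda>x. x\<^sup>2) UNIV) 0"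
    unfolding germ_map_affine_iff[OF B] by simp
  then show ?thesis unfolding germ_equivalent_A2_iff using B by blast
qed

text \<open>\<open>inv_P\<close> and \<open>F_x\<close> involve only derivatives in
  \<open>x\<close>, for which \<open>c y\<close> is a constant and \<open>k y\<close> a shift; hence
  they are expressions of the profile at \<open>x + k y\<close>. The interval of radius
  \<open>(1 + |k|) r\<close> is the range of \<open>x + k y\<close> over the box.\<close>

lemma branch_S0_local_invariants:
  assumes br: "branch_S0 F U" and k: "\<forall>(x, y)\<in>U. partial_y F x y = k * partial_x F x y + c"
    and p: "(x0, y0) \<in> U"
  obtains f r where "r > 0"
    "\<And>x y. \<bar>x - x0\<bar> < r \<Longrightarrow> \<bar>y - y0\<bar> < r \<Longrightarrow> (x, y) \<in> U"
    "\<And>t. \<bar>t - (x0 + k * y0)\<bar> < (1 + \<bar>k\<bar>) * r \<Longrightarrow> real_analytic_at f t \<and> (deriv ^^ 2) f t \<noteq> 0"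
    "\<And>x y. \<bar>x - x0\<bar> < r \<Longrightarrow> \<bar>y - y0\<bar> < r \<Longrightarrow> \<bar>x + k * y - (x0 + k * y0)\<bar> < (1 + \<bar>k\<bar>) * r \<and>
       F x y = f (x + k * y) + c * y \<and> partial_x F x y = deriv f (x + k * y) \<and>
       inv_P F x y = curve_P f (x + k * y)"
    "\<And>I. \<forall>\<^sub>F t in nhds (x0 + k * y0). t \<in> I \<Longrightarrow>
       germ_map (\<lambda>v. shear k c *v v + 0) (graph_surface F U) (vector [x0, y0, F x0 y0])
         (product_surface f I) (vector [x0 + k * y0, y0, f (x0 + k * y0)])"
proof -
  obtain f r where f: "r > 0"
    "\<And>x y. \<bar>x - x0\<bar> < r \<Longrightarrow> \<bar>y - y0\<bar> < r \<Longrightarrow> (x, y) \<in> U"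
    "\<And>x y. \<bar>x - x0\<bar> < r \<Longrightarrow> \<bar>y - y0\<bar> < r \<Longrightarrow> F x y = f (x + k * y) + c * y"
    "\<And>t. \<bar>t - (x0 + k * y0)\<bar> < (1 + \<bar>k\<bar>) * r \<Longrightarrow> real_analytic_at f t \<and> (deriv ^^ 2) f t \<noteq> 0"
    by (rule branch_S0_local_form[OF br k p]) (rule that, assumption+)
  show ?thesis
  proof (rule that[of r f])
    show "r > 0" by (rule f(1))
    show "(x, y) \<in> U" if "\<bar>x - x0\<bar> < r" "\<bar>y - y0\<bar> < r" for x y by (rule f(2)[OF that])
    show "real_analytic_at f t \<and> (deriv ^^ 2) f t \<noteq> 0" if "\<bar>t - (x0 + k * y0)\<bar> < (1 + \<bar>k\<bar>) * r" for t
      by (rule f(4)[OF that])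
    show "\<bar>x + k * y - (x0 + k * y0)\<bar> < (1 + \<bar>k\<bar>) * r \<and> F x y = f (x + k * y) + c * y \<and>
        partial_x F x y = deriv f (x + k * y) \<and> inv_P F x y = curve_P f (x + k * y)"
      if xy: "\<bar>x - x0\<bar> < r" "\<bar>y - y0\<bar> < r" for x y
    proof -
      have "\<bar>k\<bar> * \<bar>y - y0\<bar> \<le> \<bar>k\<bar> * r" using xy(2) by (intro mult_left_mono) auto
      moreover have "x + k * y - (x0 + k * y0) = (x - x0) + k * (y - y0)" by (simp add: algebra_simps)
      then have "\<bar>x + k * y - (x0 + k * y0)\<bar> \<le> \<bar>x - x0\<bar> + \<bar>k\<bar> * \<bar>y - y0\<bar>"
        by (metis abs_mult abs_triangle_ineq)
      ultimately have t: "\<bar>x + k * y - (x0 + k * y0)\<bar> < (1 + \<bar>k\<bar>) * r"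
        using xy(1) by (simp add: distrib_right)
      have "\<forall>\<^sub>F t in nhds x. \<bar>t - x\<bar> < r - \<bar>x - x0\<bar>" using xy(1) by (intro eventually_abs_less) simp
      then have ev: "\<forall>\<^sub>F t in nhds x. F t y = f (t + k * y) + c * y"
      proof eventually_elim
        case (elim t)
        then have "\<bar>t - x0\<bar> < r" by linarith
        then show ?case using f(3) xy(2) by blast
      qed
      have ra: "real_analytic_at f (x + k * y)" using f(4)[OF t] by blast
      have "partials 1 0 F x y = (deriv ^^ 1) f (x + k * y)"
        by (rule partials_ridge[where f = f and k = k and F = F and c = c, OF ra _ ev]) simp
      then have "partial_x F x y = deriv f (x + k * y)" by (simp add: partials_def)
      moreover have "inv_P F x y = curve_P f (x + k * y)"
        by (rule inv_P_ridge[where f = f and k = k and F = F and c = c, OF ra ev])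
      ultimately show ?thesis using t f(3)[OF xy] by blast
    qed
    show "germ_map (\<lambda>v. shear k c *v v + 0) (graph_surface F U) (vector [x0, y0, F x0 y0])
         (product_surface f I) (vector [x0 + k * y0, y0, f (x0 + k * y0)])"
      if "\<forall>\<^sub>F t in nhds (x0 + k * y0). t \<in> I" for I
      using shear_germ[OF f(1-3) that] f(3)[of x0 y0] f(1) by simp
  qed
qed

lemma graph_surface_pointE:
  assumes "p \<in> graph_surface F U"
  obtains x y where "(x, y) \<in> U" "p = vector [x, y, F x y]"
  using assms unfolding graph_surface_def by blast

text \<open>Besides the equivalence it records how \<open>P\<close> passes to the profile: its value
  at the point decides the sign in the normal form, its vanishing leads to the parabola.\<close>

lemma branch_S0_equivalent_product:
  assumes br: "branch_S0 F U" and p: "p \<in> graph_surface F U"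
  shows "\<exists>f I. nondegenerate_curve f I \<and> (\<exists>p'\<in>product_surface f I.
    germ_equivalent SA3 (graph_surface F U) p (product_surface f I) p' \<and>
    (inv_P F (p $ 1) (p $ 2) = curve_P f (p' $ 1)) \<and>
    ((\<forall>(x, y)\<in>U. inv_P F x y = 0) \<longrightarrow> (\<forall>\<^sub>F t in nhds (p' $ 1). curve_P f t = 0)))"
proof -
  obtain k c where k: "\<forall>(x, y)\<in>U. partial_y F x y = k * partial_x F x y + c"
    using branch_S0_gradient_linear[OF br] by blast
  obtain x0 y0 where p: "(x0, y0) \<in> U" "p = vector [x0, y0, F x0 y0]"
    using graph_surface_pointE[OF p] by blast
  obtain f r where f: "r > 0"
    "\<And>x y. \<bar>x - x0\<bar> < r \<Longrightarrow> \<bar>y - y0\<bar> < r \<Longrightarrow> (x, y) \<in> U"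
    "\<And>t. \<bar>t - (x0 + k * y0)\<bar> < (1 + \<bar>k\<bar>) * r \<Longrightarrow> real_analytic_at f t \<and> (deriv ^^ 2) f t \<noteq> 0"
    "\<And>x y. \<bar>x - x0\<bar> < r \<Longrightarrow> \<bar>y - y0\<bar> < r \<Longrightarrow> \<bar>x + k * y - (x0 + k * y0)\<bar> < (1 + \<bar>k\<bar>) * r \<and>
       F x y = f (x + k * y) + c * y \<and> partial_x F x y = deriv f (x + k * y) \<and>
       inv_P F x y = curve_P f (x + k * y)"
    "\<And>I. \<forall>\<^sub>F t in nhds (x0 + k * y0). t \<in> I \<Longrightarrow>
       germ_map (\<lambda>v. shear k c *v v + 0) (graph_surface F U) (vector [x0, y0, F x0 y0])
         (product_surface f I) (vector [x0 + k * y0, y0, f (x0 + k * y0)])"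
    by (rule branch_S0_local_invariants[OF br k p(1)]) (rule that, assumption+)
  define X0 where "X0 = x0 + k * y0"
  define I where "I = ball X0 ((1 + \<bar>k\<bar>) * r)"
  have R: "(1 + \<bar>k\<bar>) * r > 0" using f(1) by (simp add: add_pos_nonneg)
  have I: "t \<in> I \<longleftrightarrow> \<bar>t - X0\<bar> < (1 + \<bar>k\<bar>) * r" for t
    by (simp add: I_def dist_real_def abs_minus_commute)
  have X0: "X0 \<in> I" using R by (simp add: I)
  then have evI: "\<forall>\<^sub>F t in nhds X0. t \<in> I" by (intro eventually_nhds_in_open) (simp add: I_def)
  have nd: "nondegenerate_curve f I"
    unfolding nondegenerate_curve_def real_analytic_on_iff using f(3) X0
    by (auto simp: I[symmetric] X0_def[symmetric]) (auto simp: I_def)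
  show ?thesis
  proof (intro exI[of _ f] exI[of _ I] conjI bexI[of _ "vector [X0, y0, f X0]"] impI)
    show "nondegenerate_curve f I" by (rule nd)
    show "germ_equivalent SA3 (graph_surface F U) p (product_surface f I) (vector [X0, y0, f X0])"
      unfolding germ_equivalent_SA3_iff using f(5)[OF evI[unfolded X0_def]] shear_SL3
      unfolding p(2) X0_def by blast
    show "inv_P F (p $ 1) (p $ 2) = curve_P f ((vector [X0, y0, f X0] :: real ^ 3) $ 1)"
      using f(4)[of x0 y0] f(1) by (simp add: p X0_def)
    show "vector [X0, y0, f X0] \<in> product_surface f I" using X0 by (simp add: mem_product_surface)
    assume z: "\<forall>(x, y)\<in>U. inv_P F x y = 0"
    have "\<forall>\<^sub>F t in nhds X0. curve_P f t = 0" using eventually_abs_less[OF f(1)]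
    proof eventually_elim
      case (elim t)
      \<comment> \<open>The points \<open>(t - k y0, y0)\<close> of one horizontal segment already
        realize every parameter \<open>t\<close> near \<open>X0\<close>.\<close>
      then have "\<bar>(t - k * y0) - x0\<bar> < r" "\<bar>y0 - y0\<bar> < r" using f(1) by (simp_all add: X0_def algebra_simps)
      from f(4)[OF this] f(2)[OF this] z show ?case by auto
    qed
    then show "\<forall>\<^sub>F t in nhds ((vector [X0, y0, f X0] :: real ^ 3) $ 1). curve_P f t = 0" by simp
  qed
qed

lemma nondegenerate_curveD:
  assumes "nondegenerate_curve f I" "x \<in> I"
  shows "real_analytic_at f x" "(deriv ^^ 2) f x \<noteq> 0" "\<forall>\<^sub>F t in nhds x. t \<in> I" "isCont f x"
  using assms real_analytic_at_isCont
  by (auto simp: nondegenerate_curve_def real_analytic_on_iff intro: eventually_nhds_in_open)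

lemma product_equivalent_iff_curve_equivalent:
  assumes f: "nondegenerate_curve f I" and g: "nondegenerate_curve g J"
  shows "locally_equivalent SA3 (product_surface f I) (product_surface g J) \<longleftrightarrow>
         locally_equivalent A2 (graph_curve f I) (graph_curve g J)"
proof
  assume "locally_equivalent SA3 (product_surface f I) (product_surface g J)"
  then obtain p p' where p: "p \<in> product_surface f I" "p' \<in> product_surface g J"
    and germ: "germ_equivalent SA3 (product_surface f I) p (product_surface g J) p'"
    unfolding locally_equivalent_def by blast
  have m: "p $ 1 \<in> I" "p' $ 1 \<in> J" "p $ 3 = f (p $ 1)" "p' $ 3 = g (p' $ 1)"
    using p by (simp_all add: mem_product_surface)
  show "locally_equivalent A2 (graph_curve f I) (graph_curve g J)"
    unfolding locally_equivalent_def
  proof (intro bexI)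
    show "germ_equivalent A2 (graph_curve f I) (vector [p $ 1, p $ 3]) (graph_curve g J) (vector [p' $ 1, p' $ 3])"
      by (rule product_germ_imp_curve_germ[OF _ _ _ germ])
        (use nondegenerate_curveD[OF f m(1)] nondegenerate_curveD[OF g m(2)] in auto)
  qed (use m in \<open>simp_all add: mem_graph_curve\<close>)
next
  assume "locally_equivalent A2 (graph_curve f I) (graph_curve g J)"
  then obtain p p' where p: "p \<in> graph_curve f I" "p' \<in> graph_curve g J"
    and germ: "germ_equivalent A2 (graph_curve f I) p (graph_curve g J) p'"
    unfolding locally_equivalent_def by blast
  have v: "vector [v $ 1, v $ 2] = v" for v :: "real ^ 2" by (simp add: vec_eq_iff forall_2)
  show "locally_equivalent SA3 (product_surface f I) (product_surface g J)"
    unfolding locally_equivalent_def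
  proof (intro bexI)
    show "germ_equivalent SA3 (product_surface f I) (vector [p $ 1, 0, p $ 2]) (product_surface g J) (vector [p' $ 1, 0, p' $ 2])"
      by (rule curve_germ_imp_product_germ) (use germ in \<open>simp add: v\<close>)
  qed (use p in \<open>simp_all add: mem_graph_curve mem_product_surface\<close>)
qed

section \<open>Relative invariance and normal forms\<close>

lemma parabola_derivs:
  "(deriv ^^ 2) (\<lambda>x :: real. x\<^sup>2) = (\<lambda>_. 2)" "curve_P (\<lambda>x. x\<^sup>2) = (\<lambda>_. 0)"
  "real_analytic_at (\<lambda>x. x\<^sup>2) a"
proof -
  have 1: "deriv (\<lambda>x :: real. x\<^sup>2) = (\<lambda>x. 2 * x)"
    by (rule ext, rule DERIV_imp_deriv) (auto intro!: derivative_eq_intros)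
  have 2: "deriv (\<lambda>x :: real. 2 * x) = (\<lambda>_. 2)"
    by (rule ext, rule DERIV_imp_deriv) (auto intro!: derivative_eq_intros)
  show "(deriv ^^ 2) (\<lambda>x :: real. x\<^sup>2) = (\<lambda>_. 2)" by (simp add: deriv_numerals 1 2)
  show "curve_P (\<lambda>x. x\<^sup>2) = (\<lambda>_. 0)" by (simp add: fun_eq_iff curve_P_def deriv_numerals 1 2)
  show "real_analytic_at (\<lambda>x. x\<^sup>2) a"
    unfolding power2_eq_square by (intro real_analytic_at_mult real_analytic_at_ident)
qed

lemma inv_P_zero_imp_parabola:
  assumes br: "branch_S0 F U" and z: "\<forall>(x, y)\<in>U. inv_P F x y = 0"
  shows "locally_equivalent SA3 (graph_surface F U) (product_surface (\<lambda>x. x ^ 2) UNIV)"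
proof -
  have "U \<noteq> {}" using br by (simp add: branch_S0_def)
  then obtain p where p: "p \<in> graph_surface F U" unfolding graph_surface_def by fast
  obtain f I p' where f: "nondegenerate_curve f I" "p' \<in> product_surface f I"
    "germ_equivalent SA3 (graph_surface F U) p (product_surface f I) p'"
    "\<forall>\<^sub>F t in nhds (p' $ 1). curve_P f t = 0"
    using branch_S0_equivalent_product[OF br p] z by blast
  have m: "p' $ 1 \<in> I" "p' $ 3 = f (p' $ 1)" using f(2) by (simp_all add: mem_product_surface)
  note nd = nondegenerate_curveD[OF f(1) m(1)]
  obtain h k r where h: "r > 0" "k holomorphic_on ball (complex_of_real 0) r"
    "\<And>x. \<bar>x - 0\<bar> < r \<Longrightarrow> k (complex_of_real x) = of_real (h x)"
    "h 0 = 0" "deriv h 0 = 0" "(deriv ^^ 2) h 0 = 1" "(deriv ^^ 3) h 0 = 0"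
    "(deriv ^^ 4) h 0 = sgn (curve_P f (p' $ 1))"
    "germ_equivalent A2 (graph_curve f I) (vector [p' $ 1, f (p' $ 1)]) (graph_curve h {-r<..<r}) 0"
    "(\<forall>\<^sub>F x in nhds (p' $ 1). curve_P f x = 0) \<Longrightarrow> (\<forall>\<^sub>F w in nhds 0. curve_P h w = 0)"
    by (rule curve_normalization[OF nd(1-3)]) (rule that, assumption+)
  have "\<forall>\<^sub>F w in nhds 0. h w = w\<^sup>2 / 2"
    by (rule curve_P_zero_imp_parabola[OF real_analytic_atI[OF h(1-3)] h(4-7) h(10)[OF f(4)]])
  from germ_equivalent_A2_trans[OF h(9) half_parabola_germ[OF h(1) this]]
  have "germ_equivalent A2 (graph_curve f I) (vector [p' $ 1, p' $ 3]) (graph_curve (\<lambda>x. x\<^sup>2) UNIV)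
      (vector [(0 :: real ^ 3) $ 1, (0 :: real ^ 3) $ 3])"
    unfolding m(2) by (rule back_subst) (simp add: vec_eq_iff forall_2)
  from germ_equivalent_SA3_trans[OF f(3) curve_germ_imp_product_germ[OF this]]
  have "germ_equivalent SA3 (graph_surface F U) p (product_surface (\<lambda>x. x\<^sup>2) UNIV) 0" .
  moreover have "0 \<in> product_surface (\<lambda>x. x\<^sup>2) UNIV" by (simp add: mem_product_surface)
  ultimately show ?thesis unfolding locally_equivalent_def using p by blast
qed

text \<open>On a small box \<open>P\<close> is an analytic function of \<open>x + k y\<close> alone.
  Vanishing near one point of the box therefore spreads over the profile interval and back over the
  box, and by connectedness over \<open>U\<close>. In this way an equivalence of single germs
  controls all of \<open>U\<close>.\<close>

lemma inv_P_vanishing: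
  assumes br: "branch_S0 F U" and p: "(a, b) \<in> U"
    and z: "\<forall>\<^sub>F q in nhds (a, b). inv_P F (fst q) (snd q) = 0"
  shows "\<forall>(x, y)\<in>U. inv_P F x y = 0"
proof -
  define V where "V q \<longleftrightarrow> (\<forall>\<^sub>F q in nhds q. inv_P F (fst q) (snd q) = 0)" for q
  have U: "open U" "connected U" using br by (auto simp: branch_S0_def)
  obtain k c where k: "\<forall>(x, y)\<in>U. partial_y F x y = k * partial_x F x y + c"
    using branch_S0_gradient_linear[OF br] by blast
  have "V q" if q: "q \<in> U" for q
  proof (rule connected_induction_simple[where P = V, OF U(2) p q])
    show "V (a, b)" using z by (simp add: V_def)
  next
    fix w assume w: "w \<in> U"
    obtain x0 y0 where w': "w = (x0, y0)" by fastforce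
    obtain f r where f: "r > 0"
      "\<And>x y. \<bar>x - x0\<bar> < r \<Longrightarrow> \<bar>y - y0\<bar> < r \<Longrightarrow> (x, y) \<in> U"
      "\<And>t. \<bar>t - (x0 + k * y0)\<bar> < (1 + \<bar>k\<bar>) * r \<Longrightarrow> real_analytic_at f t \<and> (deriv ^^ 2) f t \<noteq> 0"
      "\<And>x y. \<bar>x - x0\<bar> < r \<Longrightarrow> \<bar>y - y0\<bar> < r \<Longrightarrow> \<bar>x + k * y - (x0 + k * y0)\<bar> < (1 + \<bar>k\<bar>) * r \<and>
         F x y = f (x + k * y) + c * y \<and> partial_x F x y = deriv f (x + k * y) \<and>
         inv_P F x y = curve_P f (x + k * y)"
      by (rule branch_S0_local_invariants[OF br k w[unfolded w']]) (rule that, assumption+)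
    define T where "T = ball x0 r \<times> ball y0 r"
    define I where "I = ball (x0 + k * y0) ((1 + \<bar>k\<bar>) * r)"
    have T: "q \<in> T \<longleftrightarrow> \<bar>fst q - x0\<bar> < r \<and> \<bar>snd q - y0\<bar> < r" for q
      by (auto simp: T_def dist_real_def abs_minus_commute mem_Times_iff)
    have I: "t \<in> I \<longleftrightarrow> \<bar>t - (x0 + k * y0)\<bar> < (1 + \<bar>k\<bar>) * r" for t
      by (simp add: I_def dist_real_def abs_minus_commute)
    have oT: "open T" by (simp add: T_def open_Times)
    have TU: "T \<subseteq> U"
    proof
      fix q assume "q \<in> T" then show "q \<in> U" using f(2)[of "fst q" "snd q"] by (simp add: T)
    qed
    have PT: "fst q + k * snd q \<in> I \<and> inv_P F (fst q) (snd q) = curve_P f (fst q + k * snd q)"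
      if "q \<in> T" for q
      using f(4)[of "fst q" "snd q"] that unfolding T I by blast
    have "V v" if u: "u \<in> T" and v: "v \<in> T" and V: "V u" for u v
    proof -
      let ?t = "fst u + k * snd u"
      \<comment> \<open>On the horizontal line through \<open>u\<close> the parameter
        \<open>x + k y\<close> runs through a neighbourhood of \<open>?t\<close>, which turns
        vanishing near \<open>u\<close> into vanishing of \<open>curve_P f\<close> near
        \<open>?t\<close>.\<close>
      have "((\<lambda>t. (t - k * snd u, snd u)) \<longlongrightarrow> (?t - k * snd u, snd u)) (nhds ?t)"
        by (intro tendsto_intros filterlim_ident)
      then have lim: "((\<lambda>t. (t - k * snd u, snd u)) \<longlongrightarrow> u) (nhds ?t)" by simp
      have "\<forall>\<^sub>F t in nhds ?t. curve_P f t = 0"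
        using eventually_compose_filterlim[OF V[unfolded V_def] lim]
          eventually_compose_filterlim[OF eventually_nhds_in_open[OF oT u] lim]
        by eventually_elim (use PT in fastforce)
      then have fz: "curve_P f t = 0" if "t \<in> I" for t
        using real_analytic_vanishing[of I "curve_P f" ?t t] that PT[OF u] real_analytic_at_curve_P f(3)
        unfolding I by (simp add: I_def)
      show ?thesis unfolding V_def using eventually_nhds_in_open[OF oT v]
        by eventually_elim (use PT fz in auto)
    qed
    then show "\<exists>T. openin (top_of_set U) T \<and> w \<in> T \<and> (\<forall>x\<in>T. \<forall>y\<in>T. V x \<longrightarrow> V y)"
    proof (intro exI[of _ T] conjI)
      show "openin (top_of_set U) T" by (rule open_subset[OF TU oT])
      show "w \<in> T" using f(1) by (simp add: T w')
    qed blast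
  qed
  then have "inv_P F (fst q) (snd q) = 0" if "q \<in> U" for q
    using eventually_nhds_x_imp_x[of _ q] that unfolding V_def by blast
  then show ?thesis by fastforce
qed

text \<open>The parabola has \<open>P = 0\<close>, and the plane map between the profiles changes
  \<open>P\<close> by a factor without zeros. So \<open>P\<close> vanishes near one point of
  \<open>U\<close>, and analyticity does the rest.\<close>

lemma parabola_imp_inv_P_zero:
  assumes br: "branch_S0 F U"
    and le: "locally_equivalent SA3 (graph_surface F U) (product_surface (\<lambda>x. x ^ 2) UNIV)"
  shows "\<forall>(x, y)\<in>U. inv_P F x y = 0"
proof -
  obtain p p' where p: "p \<in> graph_surface F U"
    and germ: "germ_equivalent SA3 (graph_surface F U) p (product_surface (\<lambda>x. x ^ 2) UNIV) p'"
    using le unfolding locally_equivalent_def by blast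
  obtain k c where k: "\<forall>(x, y)\<in>U. partial_y F x y = k * partial_x F x y + c"
    using branch_S0_gradient_linear[OF br] by blast
  obtain x0 y0 where p: "(x0, y0) \<in> U" "p = vector [x0, y0, F x0 y0]"
    using graph_surface_pointE[OF p] by blast
  obtain f r where f: "r > 0"
    "\<And>x y. \<bar>x - x0\<bar> < r \<Longrightarrow> \<bar>y - y0\<bar> < r \<Longrightarrow> (x, y) \<in> U"
    "\<And>t. \<bar>t - (x0 + k * y0)\<bar> < (1 + \<bar>k\<bar>) * r \<Longrightarrow> real_analytic_at f t \<and> (deriv ^^ 2) f t \<noteq> 0"
    "\<And>x y. \<bar>x - x0\<bar> < r \<Longrightarrow> \<bar>y - y0\<bar> < r \<Longrightarrow> \<bar>x + k * y - (x0 + k * y0)\<bar> < (1 + \<bar>k\<bar>) * r \<and>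
       F x y = f (x + k * y) + c * y \<and> partial_x F x y = deriv f (x + k * y) \<and>
       inv_P F x y = curve_P f (x + k * y)"
    "\<And>I. \<forall>\<^sub>F t in nhds (x0 + k * y0). t \<in> I \<Longrightarrow>
       germ_map (\<lambda>v. shear k c *v v + 0) (graph_surface F U) (vector [x0, y0, F x0 y0])
         (product_surface f I) (vector [x0 + k * y0, y0, f (x0 + k * y0)])"
    by (rule branch_S0_local_invariants[OF br k p(1)]) (rule that, assumption+)
  define X0 where "X0 = x0 + k * y0"
  define p1 :: "real ^ 3" where "p1 = vector [X0, y0, f X0]"
  \<comment> \<open>Only the germ at \<open>X0\<close> counts, so the profile may be taken over the
    whole line.\<close>
  have "germ_map (\<lambda>v. shear k c *v v + 0) (graph_surface F U) p (product_surface f UNIV) p1"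
    unfolding p p1_def X0_def by (rule f(5)) simp
  then have "germ_equivalent SA3 (graph_surface F U) p (product_surface f UNIV) p1"
    unfolding germ_equivalent_SA3_iff using shear_SL3 by blast
  from germ_equivalent_SA3_trans[OF germ_equivalent_SA3_sym[OF this] germ]
  obtain A b where A: "A \<in> SL3" and germ: "germ_map (\<lambda>v. A *v v + b) (product_surface f UNIV) p1 (product_surface (\<lambda>x. x ^ 2) UNIV) p'"
    unfolding germ_equivalent_SA3_iff by blast
  have p1: "p1 $ 1 = X0" by (simp add: p1_def)
  have "0 < (1 + \<bar>k\<bar>) * r" using f(1) by (simp add: add_pos_nonneg)
  then have ra: "real_analytic_at f X0" "(deriv ^^ 2) f X0 \<noteq> 0" using f(3)[of X0] by (simp_all add: X0_def)
  have ne: "(deriv ^^ 2) (\<lambda>x :: real. x\<^sup>2) (p' $ 1) \<noteq> 0" by (simp add: parabola_derivs(1))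
  have cont: "isCont f (p1 $ 1)" using real_analytic_at_isCont[OF ra(1)] by (simp add: p1)
  note pl = product_germ_planar[OF A cont _ ne germ, unfolded p1, simplified]
  have "\<forall>\<^sub>F x in nhds X0. A $ 1 $ 1 + A $ 1 $ 3 * deriv f x \<noteq> 0 \<and>
      curve_P (\<lambda>x. x\<^sup>2) (A $ 1 $ 1 * x + A $ 1 $ 3 * f x + b $ 1) = curve_P f x / (A $ 1 $ 1 + A $ 1 $ 3 * deriv f x)\<^sup>2"
    by (rule affine_image_curve_P[where d = "A $ 3 $ 3" and c = "A $ 3 $ 1", OF ra(1) parabola_derivs(3) pl(6) _ ra(2)])
      (use pl(3) in auto)
  then have z: "\<forall>\<^sub>F x in nhds X0. curve_P f x = 0"
    by eventually_elim (auto simp: parabola_derivs(2))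
  have l1: "((\<lambda>q. fst q + k * snd q) \<longlongrightarrow> X0) (nhds (x0, y0))"
    unfolding X0_def by (rule tendsto_eq_intros filterlim_ident refl | simp)+
  have l2: "((\<lambda>q. fst q) \<longlongrightarrow> x0) (nhds (x0, y0))" "((\<lambda>q. snd q) \<longlongrightarrow> y0) (nhds (x0, y0))"
    by (rule tendsto_eq_intros filterlim_ident refl | simp)+
  have "\<forall>\<^sub>F q in nhds (x0, y0). inv_P F (fst q) (snd q) = 0"
    using eventually_compose_filterlim[OF z l1] tendstoD[OF l2(1) f(1)] tendstoD[OF l2(2) f(1)]
    by eventually_elim (use f(4) in \<open>simp add: dist_real_def\<close>)
  then show ?thesis by (rule inv_P_vanishing[OF br p(1)])
qed

text \<open>Locally \<open>F_x\<close> is \<open>f' (x + k y)\<close>, so the factor is an analytic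
  function of \<open>x + k y\<close> alone, and its double power series comes from the ridge
  expansion.\<close>

lemma real_analytic2_on_multiplier:
  assumes br: "branch_S0 F U" and nz: "\<And>x y. (x, y) \<in> U \<Longrightarrow> \<alpha> + \<beta> * partial_x F x y \<noteq> 0"
  shows "real_analytic2_on (\<lambda>x y. 1 / (\<alpha> + \<beta> * partial_x F x y)\<^sup>2) U"
  unfolding real_analytic2_on_iff
proof clarify
  fix x0 y0 assume p: "(x0, y0) \<in> U"
  obtain k c where k: "\<forall>(x, y)\<in>U. partial_y F x y = k * partial_x F x y + c"
    using branch_S0_gradient_linear[OF br] by blast
  obtain f r where f: "r > 0"
    "\<And>t. \<bar>t - (x0 + k * y0)\<bar> < (1 + \<bar>k\<bar>) * r \<Longrightarrow> real_analytic_at f t \<and> (deriv ^^ 2) f t \<noteq> 0"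
    "\<And>x y. \<bar>x - x0\<bar> < r \<Longrightarrow> \<bar>y - y0\<bar> < r \<Longrightarrow> \<bar>x + k * y - (x0 + k * y0)\<bar> < (1 + \<bar>k\<bar>) * r \<and>
       F x y = f (x + k * y) + c * y \<and> partial_x F x y = deriv f (x + k * y) \<and>
       inv_P F x y = curve_P f (x + k * y)"
    by (rule branch_S0_local_invariants[OF br k p]) (rule that, assumption+)
  have "0 < (1 + \<bar>k\<bar>) * r" using f(1) by (simp add: add_pos_nonneg)
  then have ra: "real_analytic_at f (x0 + k * y0)" using f(2) by simp
  have m: "\<alpha> + \<beta> * deriv f (x0 + k * y0) \<noteq> 0" using nz[OF p] f(3)[of x0 y0] f(1) by simp
  define q where "q t = inverse ((\<alpha> + \<beta> * deriv f t) * (\<alpha> + \<beta> * deriv f t))" for t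
  have "real_analytic_at q (x0 + k * y0)"
    unfolding q_def using m
    by (intro real_analytic_at_inverse real_analytic_at_mult real_analytic_at_add
        real_analytic_at_const real_analytic_at_deriv ra) simp
  from real_analytic2_on_ridge[OF this] obtain s e where s: "has_powser2 e x0 y0 s (\<lambda>x y. q (x + k * y))"
    by blast
  have "has_powser2 e x0 y0 (min r s) (\<lambda>x y. 1 / (\<alpha> + \<beta> * partial_x F x y)\<^sup>2)"
    by (rule has_powser2_cong[OF s])
      (use f has_powser2_pos[OF s] in \<open>auto simp: q_def power2_eq_square inverse_eq_divide\<close>)
  then show "\<exists>r c. has_powser2 c x0 y0 r (\<lambda>x y. 1 / (\<alpha> + \<beta> * partial_x F x y)\<^sup>2)" by blast
qed

text \<open>Straightening source and target reduces the map to one between products, where the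
  profiles satisfy the plane rule with factor \<open>1 / m^2\<close>. The coefficients of
  \<open>m\<close> are built from \<open>A\<close> and \<open>k'\<close> alone, so one pair
  \<alpha>, \<beta> serves every point of \<open>U\<close>.\<close>

lemma inv_P_transform:
  fixes A :: "real ^ 3 ^ 3"
  assumes A: "A \<in> SL3" and F: "branch_S0 F U" and G: "branch_S0 G V"
    and im: "(\<lambda>v. A *v v + b) ` graph_surface F U = graph_surface G V"
  shows "\<exists>\<alpha> \<beta>. \<forall>(x, y)\<in>U. \<alpha> + \<beta> * partial_x F x y \<noteq> 0 \<and>
    (let w = A *v vector [x, y, F x y] + b in
      inv_P G (w $ 1) (w $ 2) = 1 / (\<alpha> + \<beta> * partial_x F x y)\<^sup>2 * inv_P F x y)"
proof -
  obtain k c where k: "\<forall>(x, y)\<in>U. partial_y F x y = k * partial_x F x y + c"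
    using branch_S0_gradient_linear[OF F] by blast
  obtain k' c' where k': "\<forall>(x, y)\<in>V. partial_y G x y = k' * partial_x G x y + c'"
    using branch_S0_gradient_linear[OF G] by blast
  \<comment> \<open>entries of the first row of the transformation between the two straightened products\<close>
  define \<alpha> \<beta> where "\<alpha> = A $ 1 $ 1 + k' * A $ 2 $ 1" and "\<beta> = A $ 1 $ 3 + k' * A $ 2 $ 3"
  have "\<alpha> + \<beta> * partial_x F x0 y0 \<noteq> 0 \<and> (let w = A *v vector [x0, y0, F x0 y0] + b in
      inv_P G (w $ 1) (w $ 2) = 1 / (\<alpha> + \<beta> * partial_x F x0 y0)\<^sup>2 * inv_P F x0 y0)"
    if p: "(x0, y0) \<in> U" for x0 y0
  proof -
    define P where "P = (vector [x0, y0, F x0 y0] :: real ^ 3)"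
    define s0 t0 where "s0 = (A *v P + b) $ 1" and "t0 = (A *v P + b) $ 2"
    have PS: "P \<in> graph_surface F U" using p by (simp add: P_def mem_graph_surface)
    then have "A *v P + b \<in> graph_surface G V" using im by blast
    then have p': "(s0, t0) \<in> V" and P': "A *v P + b = vector [s0, t0, G s0 t0]"
      by (simp_all add: mem_graph_surface s0_def t0_def vec_eq_iff forall_3)
    obtain f r where f: "r > 0"
      "\<And>t. \<bar>t - (x0 + k * y0)\<bar> < (1 + \<bar>k\<bar>) * r \<Longrightarrow> real_analytic_at f t \<and> (deriv ^^ 2) f t \<noteq> 0"
      "\<And>x y. \<bar>x - x0\<bar> < r \<Longrightarrow> \<bar>y - y0\<bar> < r \<Longrightarrow> \<bar>x + k * y - (x0 + k * y0)\<bar> < (1 + \<bar>k\<bar>) * r \<and>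
         F x y = f (x + k * y) + c * y \<and> partial_x F x y = deriv f (x + k * y) \<and>
         inv_P F x y = curve_P f (x + k * y)"
      "\<And>I. \<forall>\<^sub>F t in nhds (x0 + k * y0). t \<in> I \<Longrightarrow>
         germ_map (\<lambda>v. shear k c *v v + 0) (graph_surface F U) (vector [x0, y0, F x0 y0])
           (product_surface f I) (vector [x0 + k * y0, y0, f (x0 + k * y0)])"
      by (rule branch_S0_local_invariants[OF F k p]) (rule that, assumption+)
    obtain g r' where g: "r' > 0"
      "\<And>t. \<bar>t - (s0 + k' * t0)\<bar> < (1 + \<bar>k'\<bar>) * r' \<Longrightarrow> real_analytic_at g t \<and> (deriv ^^ 2) g t \<noteq> 0"
      "\<And>x y. \<bar>x - s0\<bar> < r' \<Longrightarrow> \<bar>y - t0\<bar> < r' \<Longrightarrow> \<bar>x + k' * y - (s0 + k' * t0)\<bar> < (1 + \<bar>k'\<bar>) * r' \<and>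
         G x y = g (x + k' * y) + c' * y \<and> partial_x G x y = deriv g (x + k' * y) \<and>
         inv_P G x y = curve_P g (x + k' * y)"
      "\<And>I. \<forall>\<^sub>F t in nhds (s0 + k' * t0). t \<in> I \<Longrightarrow>
         germ_map (\<lambda>v. shear k' c' *v v + 0) (graph_surface G V) (vector [s0, t0, G s0 t0])
           (product_surface g I) (vector [s0 + k' * t0, t0, g (s0 + k' * t0)])"
      by (rule branch_S0_local_invariants[OF G k' p']) (rule that, assumption+)
    define X0 S0 where "X0 = x0 + k * y0" and "S0 = s0 + k' * t0"
    have "0 < (1 + \<bar>k\<bar>) * r" "0 < (1 + \<bar>k'\<bar>) * r'" using f(1) g(1) by (simp_all add: add_pos_nonneg)
    then have fX: "real_analytic_at f X0" "(deriv ^^ 2) f X0 \<noteq> 0"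
      and gS: "real_analytic_at g S0" "(deriv ^^ 2) g S0 \<noteq> 0"
      using f(2)[of X0] g(2)[of S0] by (simp_all add: X0_def S0_def)
    have "germ_map (\<lambda>v. shear k c *v v + 0) (graph_surface F U) P (product_surface f UNIV) (vector [X0, y0, f X0])"
      using f(4)[of UNIV] by (simp add: X0_def P_def)
    from germ_map_affine_inverse[OF shear_inverse _ this] shear_inverse[of "- k" "- c"]
    have g1: "germ_map (\<lambda>v. shear (- k) (- c) *v v + - (shear (- k) (- c) *v 0)) (product_surface f UNIV) (vector [X0, y0, f X0]) (graph_surface F U) P"
      by simp
    have g2: "germ_map (\<lambda>v. A *v v + b) (graph_surface F U) P (graph_surface G V) (vector [s0, t0, G s0 t0])"
    proof -
      obtain B where B: "\<And>v b. B *v (A *v v + b) + - (B *v b) = v"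
        using affine_inverse[OF SL3_invertible[OF A]] by metis
      have "v \<in> graph_surface F U \<longleftrightarrow> A *v v + b \<in> graph_surface G V" for v
        unfolding im[symmetric] using B by (metis (no_types, lifting) imageE imageI)
      then show ?thesis unfolding germ_map_affine_iff[OF SL3_invertible[OF A]] using PS P' by simp
    qed
    have g3: "germ_map (\<lambda>v. shear k' c' *v v + 0) (graph_surface G V) (vector [s0, t0, G s0 t0]) (product_surface g UNIV) (vector [S0, t0, g S0])"
      using g(4)[of UNIV] by (simp add: S0_def)
    define M where "M = shear k' c' ** (A ** shear (- k) (- c))"
    define b' where "b' = shear k' c' *v (A *v - (shear (- k) (- c) *v 0) + b) + 0"
    have inv: "invertible (shear k c)" for k c by (rule SL3_invertible[OF shear_SL3])
    have germ: "germ_map (\<lambda>v. M *v v + b') (product_surface f UNIV) (vector [X0, y0, f X0]) (product_surface g UNIV) (vector [S0, t0, g S0])"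
      unfolding M_def b'_def
      by (rule germ_map_affine_compose[OF invertible_mult[OF SL3_invertible[OF A] inv] inv
            germ_map_affine_compose[OF inv SL3_invertible[OF A] g1 g2] g3])
    have M: "M \<in> SL3" using A shear_SL3 by (simp add: M_def SL3_def det_mul)
    \<comment> \<open>The first column of a shear is a unit vector, and so is the third; composing
      with the inverse shear of the source thus leaves these two entries unchanged.\<close>
    have M1: "M $ 1 $ 1 = \<alpha>" "M $ 1 $ 3 = \<beta>"
      by (simp_all add: M_def matrix_matrix_mult_def sum_3 shear_def \<alpha>_def \<beta>_def)
    have pl: "M $ 2 $ 2 * (M $ 1 $ 1 * M $ 3 $ 3 - M $ 1 $ 3 * M $ 3 $ 1) = 1"
      "S0 = M $ 1 $ 1 * X0 + M $ 1 $ 3 * f X0 + b' $ 1"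
      "\<forall>\<^sub>F x in nhds X0. g (M $ 1 $ 1 * x + M $ 1 $ 3 * f x + b' $ 1) = M $ 3 $ 1 * x + M $ 3 $ 3 * f x + b' $ 3"
      using product_germ_planar(3,5,6)[OF M _ _ _ germ] real_analytic_at_isCont[OF fX(1)] gS(2) by simp_all
    have gS': "real_analytic_at g (M $ 1 $ 1 * X0 + M $ 1 $ 3 * f X0 + b' $ 1)" using gS(1) pl(2) by simp
    have "M $ 1 $ 1 * M $ 3 $ 3 - M $ 1 $ 3 * M $ 3 $ 1 \<noteq> 0" using pl(1) by auto
    from eventually_nhds_x_imp_x[OF affine_image_curve_P[OF fX(1) gS' pl(3) this fX(2)]]
    have "\<alpha> + \<beta> * deriv f X0 \<noteq> 0" "curve_P g S0 = curve_P f X0 / (\<alpha> + \<beta> * deriv f X0)\<^sup>2"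
      by (simp_all add: pl(2) M1)
    moreover have "partial_x F x0 y0 = deriv f X0" "inv_P F x0 y0 = curve_P f X0" "inv_P G s0 t0 = curve_P g S0"
      using f(3)[of x0 y0] g(3)[of s0 t0] f(1) g(1) by (simp_all add: X0_def S0_def)
    ultimately show ?thesis unfolding P_def[symmetric] Let_def s0_def[symmetric] t0_def[symmetric] by simp
  qed
  then show ?thesis by blast
qed

lemma relative_invariant_inv_P: "relative_invariant branch_S0 4 inv_P"
  unfolding relative_invariant_def
proof (intro conjI)
  show "\<exists>\<Phi>. \<forall>F U. branch_S0 F U \<longrightarrow> (\<forall>(x, y)\<in>U. inv_P F x y = \<Phi> x y (jet 4 F x y))"
    by (rule exI[of _ "\<lambda>x y j. 1/3 * ((- 5 * (j 3 0)\<^sup>2 + 3 * j 2 0 * j 4 0) / (j 2 0)\<^sup>2)"])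
      (simp add: inv_P_def jet_def)
  have "\<exists>\<mu>. real_analytic2_on \<mu> U \<and> (\<forall>(x, y)\<in>U. \<mu> x y \<noteq> 0) \<and>
      (\<forall>(x, y)\<in>U. let w = A *v vector [x, y, F x y] + b in inv_P G (w $ 1) (w $ 2) = \<mu> x y * inv_P F x y)"
    if *: "A \<in> SL3" "branch_S0 F U" "branch_S0 G V"
      "(\<lambda>v. A *v v + b) ` graph_surface F U = graph_surface G V" for A b F U G V
  proof -
    obtain \<alpha> \<beta> where ab: "\<forall>(x, y)\<in>U. \<alpha> + \<beta> * partial_x F x y \<noteq> 0 \<and>
      (let w = A *v vector [x, y, F x y] + b in
        inv_P G (w $ 1) (w $ 2) = 1 / (\<alpha> + \<beta> * partial_x F x y)\<^sup>2 * inv_P F x y)"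
      using inv_P_transform[OF *] by blast
    show ?thesis
      by (rule exI[of _ "\<lambda>x y. 1 / (\<alpha> + \<beta> * partial_x F x y)\<^sup>2"], intro conjI real_analytic2_on_multiplier[OF *(2)])
        (use ab in auto)
  qed
  then show "\<exists>N. open N \<and> (mat 1, 0) \<in> N \<and> (\<forall>(A, b)\<in>N. \<forall>F U G V.
      A \<in> SL3 \<and> branch_S0 F U \<and> branch_S0 G V \<and> (\<lambda>v. A *v v + b) ` graph_surface F U = graph_surface G V \<longrightarrow>
      (\<exists>\<mu>. real_analytic2_on \<mu> U \<and> (\<forall>(x, y)\<in>U. \<mu> x y \<noteq> 0) \<and>
        (\<forall>(x, y)\<in>U. let w = A *v vector [x, y, F x y] + b in inv_P G (w $ 1) (w $ 2) = \<mu> x y * inv_P F x y)))"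
    by (intro exI[of _ UNIV]) blast
qed

section \<open>Existence and uniqueness of the normal form\<close>

lemma normal_form_exists:
  assumes br: "branch_S0 F U" and nz: "\<forall>(x, y)\<in>U. inv_P F x y \<noteq> 0" and p: "p \<in> graph_surface F U"
  shows "\<exists>\<epsilon> c f r. normal_form \<epsilon> c f r \<and>
    germ_equivalent SA3 (graph_surface F U) p (product_surface f {-r<..<r}) 0"
proof -
  obtain f I p' where f: "nondegenerate_curve f I" "p' \<in> product_surface f I"
    "germ_equivalent SA3 (graph_surface F U) p (product_surface f I) p'"
    "inv_P F (p $ 1) (p $ 2) = curve_P f (p' $ 1)"
    using branch_S0_equivalent_product[OF br p] by blast
  have m: "p' $ 1 \<in> I" "p' $ 3 = f (p' $ 1)" using f(2) by (simp_all add: mem_product_surface)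
  have P: "curve_P f (p' $ 1) \<noteq> 0" using nz p f(4) by (auto simp: mem_graph_surface)
  note nd = nondegenerate_curveD[OF f(1) m(1)]
  obtain h k r where h: "r > 0" "k holomorphic_on ball (complex_of_real 0) r"
    "\<And>x. \<bar>x - 0\<bar> < r \<Longrightarrow> k (complex_of_real x) = of_real (h x)"
    "h 0 = 0" "deriv h 0 = 0" "(deriv ^^ 2) h 0 = 1" "(deriv ^^ 3) h 0 = 0"
    "(deriv ^^ 4) h 0 = sgn (curve_P f (p' $ 1))"
    "germ_equivalent A2 (graph_curve f I) (vector [p' $ 1, f (p' $ 1)]) (graph_curve h {-r<..<r}) 0"
    by (rule curve_normalization[OF nd(1-3)]) (rule that, assumption+)
  define \<epsilon> where "\<epsilon> = sgn (curve_P f (p' $ 1))"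
  have "normal_form \<epsilon> (\<lambda>j. (deriv ^^ j) h 0) h r"
    unfolding normal_form_def
  proof (intro conjI allI impI)
    show "\<epsilon> \<in> {1, -1}" using P by (auto simp: \<epsilon>_def sgn_if)
    show "r > 0" by (rule h(1))
    fix x :: real assume "\<bar>x\<bar> < r"
    then have "(\<lambda>n. (deriv ^^ n) h 0 / fact n * (x - 0) ^ n) sums h x"
      by (intro holomorphic_extension_taylor[OF h(2,3)]) simp_all
    then have "(\<lambda>n. (deriv ^^ (n + 5)) h 0 / fact (n + 5) * x ^ (n + 5)) sums
        (h x - (\<Sum>n<5. (deriv ^^ n) h 0 / fact n * x ^ n))"
      by (subst sums_iff_shift') simp
    \<comment> \<open>Of the Taylor coefficients of order below 5 only those of order 2 and 4
      survive the normalization.\<close>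
    moreover have "(\<Sum>n<5. (deriv ^^ n) h 0 / fact n * x ^ n) = x ^ 2 / fact 2 + \<epsilon> * x ^ 4 / fact 4"
      using h(4-8) by (simp add: eval_nat_numeral \<epsilon>_def)
    ultimately show "(\<lambda>k. (deriv ^^ (k + 5)) h 0 * x ^ (k + 5) / fact (k + 5)) sums
        (h x - (x ^ 2 / fact 2 + \<epsilon> * x ^ 4 / fact 4))" by simp
  qed
  moreover have "germ_equivalent A2 (graph_curve f I) (vector [p' $ 1, p' $ 3]) (graph_curve h {-r<..<r})
      (vector [(0 :: real ^ 3) $ 1, (0 :: real ^ 3) $ 3])"
    using h(9) unfolding m(2) by (rule back_subst) (simp add: vec_eq_iff forall_2)
  from germ_equivalent_SA3_trans[OF f(3) curve_germ_imp_product_germ[OF this]]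
  have "germ_equivalent SA3 (graph_surface F U) p (product_surface h {-r<..<r}) 0" .
  ultimately show ?thesis by blast
qed

lemma normal_form_derivs:
  assumes "normal_form \<epsilon> c f r"
  shows "real_analytic_at f 0" "f 0 = 0" "deriv f 0 = 0" "(deriv ^^ 2) f 0 = 1" "(deriv ^^ 3) f 0 = 0"
    "(deriv ^^ 4) f 0 = \<epsilon>" "\<And>j. j \<ge> 5 \<Longrightarrow> (deriv ^^ j) f 0 = c j"
proof -
  \<comment> \<open>Full Taylor coefficients: below order 5 they are \<open>1 / 2!\<close> and
    \<open>\<epsilon> / 4!\<close>, taken from the leading terms rather than from
    \<open>c\<close>.\<close>
  define a where "a n = (if n < 5 then (if n = 2 then 1 / 2 else if n = 4 then \<epsilon> / 24 else 0) else c n / fact n)" for n :: nat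
  have r: "r > 0" using assms by (simp add: normal_form_def)
  have s: "(\<lambda>n. a n * x ^ n) sums f x" if "\<bar>x\<bar> < r" for x
  proof -
    have "(\<lambda>k. c (k + 5) * x ^ (k + 5) / fact (k + 5)) sums (f x - (x ^ 2 / fact 2 + \<epsilon> * x ^ 4 / fact 4))"
      using assms that by (simp add: normal_form_def)
    moreover have "(\<Sum>n<5. a n * x ^ n) = x ^ 2 / fact 2 + \<epsilon> * x ^ 4 / fact 4"
      by (simp add: a_def eval_nat_numeral)
    ultimately have "(\<lambda>n. a (n + 5) * x ^ (n + 5)) sums (f x - (\<Sum>n<5. a n * x ^ n))"
      by (simp add: a_def)
    then show ?thesis by (subst (asm) sums_iff_shift')
  qed
  have d: "(deriv ^^ n) f 0 = fact n * a n" for n by (rule powser_iterated_deriv[OF r s])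
  show "real_analytic_at f 0" by (rule real_analytic_at_powser[OF r, of 0 a]) (use s in simp)
  show "f 0 = 0" "deriv f 0 = 0" using d[of 0] d[of 1] by (simp_all add: a_def)
  show "(deriv ^^ 2) f 0 = 1" "(deriv ^^ 3) f 0 = 0" "(deriv ^^ 4) f 0 = \<epsilon>"
    using d[of 2] d[of 3] d[of 4] by (simp_all add: a_def fact_numeral)
  show "(deriv ^^ j) f 0 = c j" if "j \<ge> 5" for j using d[of j] that by (simp add: a_def)
qed

text \<open>Comparing 4-jets at 0 leaves only the identity and the reflection
  \<open>x \<mapsto> -x\<close> of the profile. Positivity of \<open>A $ 1 $ 1\<close> is an open
  condition that holds at the identity and discards the reflection; then \<open>f\<close> and
  \<open>g\<close> agree near 0.\<close>

lemma normal_form_unique: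
  fixes A :: "real ^ 3 ^ 3"
  assumes A: "A \<in> SL3" "A $ 1 $ 1 > 0"
    and f: "normal_form \<epsilon> c f r" and g: "normal_form \<delta> d g \<rho>"
    and germ: "germ_map (\<lambda>v. A *v v) (product_surface f {-r<..<r}) 0 (product_surface g {-\<rho><..<\<rho>}) 0"
  shows "\<epsilon> = \<delta> \<and> (\<forall>j\<ge>5. d j = c j)"
proof -
  note F = normal_form_derivs[OF f] and G = normal_form_derivs[OF g]
  have r: "r > 0" and eps: "\<epsilon> \<in> {1, -1}" "\<delta> \<in> {1, -1}" using f g by (simp_all add: normal_form_def)
  have germ': "germ_map (\<lambda>v. A *v v + 0) (product_surface f {-r<..<r}) 0 (product_surface g {-\<rho><..<\<rho>}) 0"
    using germ by simp
  have I: "\<forall>\<^sub>F x in nhds ((0 :: real ^ 3) $ 1). x \<in> {-r<..<r}"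
    using r by (intro eventually_nhds_in_open) auto
  have pl: "A $ 2 $ 2 * (A $ 1 $ 1 * A $ 3 $ 3 - A $ 1 $ 3 * A $ 3 $ 1) = 1"
    "\<forall>\<^sub>F x in nhds 0. g (A $ 1 $ 1 * x + A $ 1 $ 3 * f x + 0) = A $ 3 $ 1 * x + A $ 3 $ 3 * f x + 0"
    using product_germ_planar(3,6)[OF A(1) _ I _ germ'] real_analytic_at_isCont[OF F(1)] G(4) by simp_all
  define a b c' d' where "a = A $ 1 $ 1" and "b = A $ 1 $ 3" and "c' = A $ 3 $ 1" and "d' = A $ 3 $ 3"
  note abcd = a_def[symmetric] b_def[symmetric] c'_def[symmetric] d'_def[symmetric]
  have a: "a > 0" using A(2) by (simp add: a_def)
  have D: "a * d' - b * c' \<noteq> 0" using pl(1) unfolding abcd by auto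
  have Gs: "real_analytic_at g (a * 0 + b * f 0 + 0)" using G(1) F(2) by simp
  have s0: "a * 0 + b * f 0 + 0 = 0" using F(2) by simp
  note der = eventually_nhds_x_imp_x[OF affine_image_derivs[OF F(1) Gs pl(2)[unfolded abcd] D],
      unfolded Let_def s0 F(3-6) G(3-6)]
  \<comment> \<open>Order 1 gives \<open>c' = 0\<close>, order 3 gives \<open>b = 0\<close>, and
    order 2 then gives \<open>d' = a^2\<close>. Order 4 becomes
    \<open>\<delta> a^2 = \<epsilon>\<close>, which forces equal signs and
    \<open>a^2 = 1\<close>.\<close>
  have E: "0 = (c' + d' * 0) / (a + b * 0)" "1 = (a * d' - b * c') * 1 / (a + b * 0) ^ 3"
    "0 = (a * d' - b * c') * (0 * (a + b * 0) - 3 * b * 1\<^sup>2) / (a + b * 0) ^ 5"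
    "\<delta> = (a * d' - b * c') * (\<epsilon> * (a + b * 0)\<^sup>2 - 10 * b * 1 * 0 * (a + b * 0) + 15 * b\<^sup>2 * 1 ^ 3) / (a + b * 0) ^ 7"
    using der by blast+
  have c0: "c' = 0" using E(1) a by simp
  have b0: "b = 0" using E(3) a D by simp
  have d'2: "d' = a\<^sup>2" using E(2) a c0 by (simp add: field_simps power2_eq_square power3_eq_cube)
  have "\<delta> * a\<^sup>2 = \<epsilon>"
    using E(4) a unfolding b0 c0 d'2 by (simp add: field_simps eval_nat_numeral)
  then have "\<delta> = \<epsilon>" "a\<^sup>2 = 1" using eps a by (auto simp: power2_eq_square) (smt (verit) mult_pos_pos)+
  then have "a = 1" using a by (simp add: power2_eq_1_iff)
  then have "\<forall>\<^sub>F x in nhds 0. g x = f x" using pl(2) unfolding abcd b0 c0 d'2 by simp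
  then have "(deriv ^^ j) g 0 = (deriv ^^ j) f 0" for j
    using eventually_nhds_x_imp_x[OF iterated_deriv_cong_ev] by blast
  then show ?thesis using \<open>\<delta> = \<epsilon>\<close> F(7) G(7) by metis
qed

theorem theorem2p7:
  shows
    "(\<forall>F U. branch_S0 F U \<longrightarrow>
        (\<forall>p\<in>graph_surface F U. \<exists>f I. nondegenerate_curve f I \<and>
           (\<exists>p'\<in>product_surface f I.
              germ_equivalent SA3 (graph_surface F U) p (product_surface f I) p'))) \<and>
     (\<forall>f I g J. nondegenerate_curve f I \<and> nondegenerate_curve g J \<longrightarrow>
        (locally_equivalent SA3 (product_surface f I) (product_surface g J) \<longleftrightarrow>
         locally_equivalent A2 (graph_curve f I) (graph_curve g J))) \<and>
     relative_invariant branch_S0 4 inv_P \<and>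
     (\<forall>F U. branch_S0 F U \<longrightarrow>
        ((\<forall>(x, y)\<in>U. inv_P F x y = 0) \<longleftrightarrow>
         locally_equivalent SA3 (graph_surface F U) (product_surface (\<lambda>x. x ^ 2) UNIV))) \<and>
     (\<forall>F U. branch_S0 F U \<and> (\<forall>(x, y)\<in>U. inv_P F x y \<noteq> 0) \<longrightarrow>
        (\<forall>p\<in>graph_surface F U. \<exists>\<epsilon> c f r. normal_form \<epsilon> c f r \<and>
           germ_equivalent SA3 (graph_surface F U) p (product_surface f {-r<..<r}) 0)) \<and>
     (\<exists>\<U>. openin (top_of_set SL3) \<U> \<and> mat 1 \<in> \<U> \<and>
        (\<forall>A\<in>\<U>. \<forall>\<epsilon> c f r \<delta> d g \<rho>.
           normal_form \<epsilon> c f r \<and> normal_form \<delta> d g \<rho> \<and>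
           germ_map (\<lambda>v. A *v v) (product_surface f {-r<..<r}) 0
             (product_surface g {-\<rho><..<\<rho>}) 0 \<longrightarrow>
           \<epsilon> = \<delta> \<and> (\<forall>j\<ge>5. d j = c j)))"
proof (intro conjI)
  show "\<forall>F U. branch_S0 F U \<longrightarrow>
        (\<forall>p\<in>graph_surface F U. \<exists>f I. nondegenerate_curve f I \<and>
           (\<exists>p'\<in>product_surface f I.
              germ_equivalent SA3 (graph_surface F U) p (product_surface f I) p'))"
    using branch_S0_equivalent_product by blast
  show "\<forall>f I g J. nondegenerate_curve f I \<and> nondegenerate_curve g J \<longrightarrow>
        (locally_equivalent SA3 (product_surface f I) (product_surface g J) \<longleftrightarrow>
         locally_equivalent A2 (graph_curve f I) (graph_curve g J))"
    using product_equivalent_iff_curve_equivalent by blast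
  show "relative_invariant branch_S0 4 inv_P" by (rule relative_invariant_inv_P)
  show "\<forall>F U. branch_S0 F U \<longrightarrow>
        ((\<forall>(x, y)\<in>U. inv_P F x y = 0) \<longleftrightarrow>
         locally_equivalent SA3 (graph_surface F U) (product_surface (\<lambda>x. x ^ 2) UNIV))"
    using inv_P_zero_imp_parabola parabola_imp_inv_P_zero by blast
  show "\<forall>F U. branch_S0 F U \<and> (\<forall>(x, y)\<in>U. inv_P F x y \<noteq> 0) \<longrightarrow>
        (\<forall>p\<in>graph_surface F U. \<exists>\<epsilon> c f r. normal_form \<epsilon> c f r \<and>
           germ_equivalent SA3 (graph_surface F U) p (product_surface f {-r<..<r}) 0)"
    using normal_form_exists by blast
  show "\<exists>\<U>. openin (top_of_set SL3) \<U> \<and> mat 1 \<in> \<U> \<and>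
        (\<forall>A\<in>\<U>. \<forall>\<epsilon> c f r \<delta> d g \<rho>.
           normal_form \<epsilon> c f r \<and> normal_form \<delta> d g \<rho> \<and>
           germ_map (\<lambda>v. A *v v) (product_surface f {-r<..<r}) 0
             (product_surface g {-\<rho><..<\<rho>}) 0 \<longrightarrow>
           \<epsilon> = \<delta> \<and> (\<forall>j\<ge>5. d j = c j))"
  proof (intro exI[of _ "SL3 \<inter> {A. A $ 1 $ 1 > 0}"] conjI ballI allI impI)
    have "open {A :: real ^ 3 ^ 3. A $ 1 $ 1 > 0}"
      by (intro open_Collect_less continuous_intros)
    then show "openin (top_of_set SL3) (SL3 \<inter> {A. A $ 1 $ 1 > 0})" by (auto simp: openin_open)
    have "mat 1 \<in> SL3" by (simp add: SL3_def)
    moreover have "(mat 1 :: real ^ 3 ^ 3) $ 1 $ 1 > 0" by (simp add: mat_def)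
    ultimately show "mat 1 \<in> SL3 \<inter> {A :: real ^ 3 ^ 3. A $ 1 $ 1 > 0}" by blast
  qed (use normal_form_unique in blast)+
qed

end
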